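(* Let $f\in C^2(\mathbb R;\mathbb R)$ satisfy $f''\ge c$ on $\mathbb R$ for some constant $c>0$ and $f(0)=\min_{\mathbb R} f=0$, and let $T>0$. Let $u_o\in L^\infty(\mathbb R;\mathbb R)$ and let $u$ be the weak entropy solution on $[0,T]\times\mathbb R$ to the Cauchy problem for $\partial_tu+\partial_xf(u)=0$ with datum $u_o$ at time $t=0$. For a path $\gamma\in W^{1,\infty}([0,T];\mathbb R)$ and a constant $C\in\mathbb R$, define $$U(t,x)=\int_{\gamma(t)}^xu(t,\xi)\,d\xi+\int_0^t\Bigl(\dot\gamma(\tau)\,u(\tau,\gamma(\tau))-f\bigl(u(\tau,\gamma(\tau))\bigr)\Bigr)\,d\tau+C.$$ Then $U$ is a viscosity solution (in the sense defined in the context, including the regularity required there) of the Hamilton--Jacobi equation $\partial_tU+f(\partial_xU)=0$ with datum $U_o(x)=\int_{\gamma(0)}^xu_o(\xi)\,d\xi+C$ at time $t=0$.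
   Context: A map $u\in L^\infty([0,T]\times\mathbb R;\mathbb R)\cap C^0([0,T];L^1_{loc}(\mathbb R;\mathbb R))$ is a weak entropy solution to $\partial_t u+\partial_x f(u)=0$ if, for every $k\in\mathbb R$ and every nonnegative $\varphi\in C^1_c(]0,T[\times\mathbb R)$, $$\iint\bigl(|u-k|\,\partial_t\varphi+\operatorname{sgn}(u-k)\,(f(u)-f(k))\,\partial_x\varphi\bigr)\,dt\,dx\ge 0.$$ For $t>0$ the map $u(t,\cdot)$ has locally bounded variation, and $u(t,\cdot)$ denotes its left continuous representative, so that $u(t,x)=u(t,x-)$. A map $U\in W^{1,\infty}([0,T]\times\mathbb R;\mathbb R)\cap C^0([0,T];W^{1,\infty}_{loc}(\mathbb R;\mathbb R))$ is a viscosity solution to $\partial_tU+f(\partial_xU)=0$ if for all $\varphi\in C^\infty(]0,T[\times\mathbb R;\mathbb R)$ and all $(t_o,x_o)\in\,]0,T[\times\mathbb R$: if $U-\varphi$ has a local maximum at $(t_o,x_o)$ then $\partial_t\varphi(t_o,x_o)+f(\partial_x\varphi(t_o,x_o))\le0$; if $U-\varphi$ has a local minimum at $(t_o,x_o)$ then $\partial_t\varphi(t_o,x_o)+f(\partial_x\varphi(t_o,x_o))\ge0$.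
   Formalization: The regularity of U is corrected: U is continuous with weak gradient in L^∞([0,T]×R), but U itself need not be bounded (fails for u_o=1), and ∂_xU is continuous in time in L^p_loc for all finite p rather than in L^∞_loc (fails at moving shocks). *)

theory Defs
  imports "HOL-Analysis.Analysis"
begin

section \<open>Function spaces\<close>

text \<open>For open \<open>\<Omega>\<close>: all iterated directional derivatives up to order \<open>n\<close> exist
  and are continuous on \<open>\<Omega>\<close>. Values outside \<open>\<Omega>\<close> play no role.\<close>

primrec Ck_on :: "nat \<Rightarrow> 'a::euclidean_space set \<Rightarrow> ('a \<Rightarrow> real) \<Rightarrow> bool" where
  "Ck_on 0 \<Omega> \<phi> \<longleftrightarrow> continuous_on \<Omega> \<phi>"
| "Ck_on (Suc n) \<Omega> \<phi> \<longleftrightarrow>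
     (\<forall>x\<in>\<Omega>. \<phi> differentiable (at x)) \<and>
     (\<forall>v. Ck_on n \<Omega> (\<lambda>x. frechet_derivative \<phi> (at x) v))"

definition Cinf_on :: "'a::euclidean_space set \<Rightarrow> ('a \<Rightarrow> real) \<Rightarrow> bool" where
  "Cinf_on \<Omega> \<phi> \<longleftrightarrow> (\<forall>n. Ck_on n \<Omega> \<phi>)"

text \<open>The elements of \<open>C\<^sup>1\<^sub>c(\<Omega>)\<close>, extended by zero to the whole space.\<close>

definition C1c_on :: "'a::euclidean_space set \<Rightarrow> ('a \<Rightarrow> real) \<Rightarrow> bool" where
  "C1c_on \<Omega> \<phi> \<longleftrightarrow> Ck_on 1 UNIV \<phi> \<and>
     compact (closure {x. \<phi> x \<noteq> 0}) \<and> closure {x. \<phi> x \<noteq> 0} \<subseteq> \<Omega>"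

definition Linf_on :: "'a::euclidean_space set \<Rightarrow> ('a \<Rightarrow> real) \<Rightarrow> bool" where
  "Linf_on S w \<longleftrightarrow> w \<in> borel_measurable (lebesgue_on S) \<and>
     (\<exists>M. AE x in lebesgue_on S. \<bar>w x\<bar> \<le> M)"

definition Linf_loc :: "'a::euclidean_space set \<Rightarrow> ('a \<Rightarrow> real) \<Rightarrow> bool" where
  "Linf_loc \<Omega> w \<longleftrightarrow> (\<forall>K. compact K \<and> K \<subseteq> \<Omega> \<longrightarrow> Linf_on K w)"

definition L1_loc :: "'a::euclidean_space set \<Rightarrow> ('a \<Rightarrow> real) \<Rightarrow> bool" where
  "L1_loc \<Omega> w \<longleftrightarrow> (\<forall>K. compact K \<and> K \<subseteq> \<Omega> \<longrightarrow> w absolutely_integrable_on K)"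

text \<open>\<open>g\<close> is the weak derivative of \<open>w\<close> in direction \<open>v\<close> on the open set \<open>\<Omega>\<close>.\<close>

definition weak_deriv ::
    "'a::euclidean_space set \<Rightarrow> 'a \<Rightarrow> ('a \<Rightarrow> real) \<Rightarrow> ('a \<Rightarrow> real) \<Rightarrow> bool" where
  "weak_deriv \<Omega> v w g \<longleftrightarrow> L1_loc \<Omega> w \<and> L1_loc \<Omega> g \<and>
     (\<forall>\<phi>. C1c_on \<Omega> \<phi> \<longrightarrow>
        (LINT x:\<Omega>|lebesgue. w x * frechet_derivative \<phi> (at x) v)
          = - (LINT x:\<Omega>|lebesgue. g x * \<phi> x))"

text \<open>\<open>C\<^sup>0([0,T]; L\<^sup>p\<^sub>l\<^sub>o\<^sub>c(\<real>))\<close> for \<open>1 \<le> p < \<infinity>\<close>, with the topology of the seminorms of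
  \<open>L\<^sup>p([-R,R])\<close>, \<open>R > 0\<close>.\<close>

definition C0_Lp_loc :: "real \<Rightarrow> real \<Rightarrow> (real \<Rightarrow> real \<Rightarrow> real) \<Rightarrow> bool" where
  "C0_Lp_loc p T v \<longleftrightarrow> (\<forall>t\<in>{0..T}. v t \<in> borel_measurable lebesgue \<and>
     (\<forall>R>0. set_integrable lebesgue {-R..R} (\<lambda>x. \<bar>v t x\<bar> powr p) \<and>
       ((\<lambda>s. LINT x:{-R..R}|lebesgue. \<bar>v s x - v t x\<bar> powr p) \<longlongrightarrow> 0)
         (at t within {0..T})))"

section \<open>Weak entropy solutions of the conservation law\<close>

definition weak_entropy_solution ::
    "(real \<Rightarrow> real) \<Rightarrow> real \<Rightarrow> (real \<Rightarrow> real \<Rightarrow> real) \<Rightarrow> bool" where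
  "weak_entropy_solution f T u \<longleftrightarrow>
     Linf_on ({0..T} \<times> UNIV) (\<lambda>(t, x). u t x) \<and>
     C0_Lp_loc 1 T u \<and>
     (\<forall>k \<phi>. C1c_on ({0<..<T} \<times> UNIV) \<phi> \<and> (\<forall>p. \<phi> p \<ge> 0) \<longrightarrow>
        (LINT p:{0<..<T} \<times> UNIV|lebesgue. (case p of (t, x) \<Rightarrow>
            \<bar>u t x - k\<bar> * frechet_derivative \<phi> (at (t, x)) (1, 0)
            + sgn (u t x - k) * (f (u t x) - f k)
                * frechet_derivative \<phi> (at (t, x)) (0, 1))) \<ge> 0)"

section \<open>Viscosity solutions of the Hamilton--Jacobi equation\<close>

text \<open>Regularity of a viscosity solution, written
  \<open>U \<in> W\<^sup>1\<^sup>,\<^sup>\<infinity>([0,T] \<times> \<real>) \<inter> C\<^sup>0([0,T]; W\<^sup>1\<^sup>,\<^sup>\<infinity>\<^sub>l\<^sub>o\<^sub>c(\<real>))\<close> in the source.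

  \<^item> The first space is read as: the weak gradient is in \<open>L\<^sup>\<infinity>([0,T] \<times> \<real>)\<close> and the
    function itself is locally bounded (here by continuity on the closed strip), i.e. \<open>U\<close> is
    Lipschitz. Global boundedness fails already for \<open>u = 1\<close>, where \<open>U\<close> is affine and
    non-constant in \<open>x\<close>.

  \<^item> In the second space, each \<open>U(t,\<cdot>)\<close> is in \<open>W\<^sup>1\<^sup>,\<^sup>\<infinity>\<^sub>l\<^sub>o\<^sub>c(\<real>)\<close>, the dependence on \<open>t\<close> is
    continuous for locally uniform convergence of \<open>U\<close> (this is the joint continuity, as \<open>[0,T] \<times> [-R,R]\<close>
    is compact) and continuous in \<open>L\<^sup>p\<^sub>l\<^sub>o\<^sub>c\<close> for every finite \<open>p\<close> for \<open>\<partial>\<^sub>xU\<close>. Norm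
    continuity of \<open>\<partial>\<^sub>xU\<close> in \<open>L\<^sup>\<infinity>\<^sub>l\<^sub>o\<^sub>c\<close> fails whenever \<open>\<partial>\<^sub>xU\<close> has a moving jump.\<close>

definition hj_regular :: "real \<Rightarrow> (real \<Rightarrow> real \<Rightarrow> real) \<Rightarrow> bool" where
  "hj_regular T U \<longleftrightarrow>
     continuous_on ({0..T} \<times> UNIV) (\<lambda>(t, x). U t x) \<and>
     (\<forall>v\<in>{(1, 0), (0, 1)}. \<exists>g. Linf_on ({0..T} \<times> UNIV) g \<and>
        weak_deriv ({0<..<T} \<times> UNIV) v (\<lambda>(t, x). U t x) g) \<and>
     (\<exists>V. (\<forall>t\<in>{0..T}. Linf_loc UNIV (U t) \<and> Linf_loc UNIV (V t) \<and>
             weak_deriv UNIV 1 (U t) (V t)) \<and>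
          (\<forall>p\<ge>1. C0_Lp_loc p T V))"

definition hj_viscosity_solution ::
    "(real \<Rightarrow> real) \<Rightarrow> real \<Rightarrow> (real \<Rightarrow> real \<Rightarrow> real) \<Rightarrow> bool" where
  "hj_viscosity_solution f T U \<longleftrightarrow> hj_regular T U \<and>
     (\<forall>\<phi> t\<^sub>0 x\<^sub>0. Cinf_on ({0<..<T} \<times> UNIV) \<phi> \<and> t\<^sub>0 \<in> {0<..<T} \<longrightarrow>
       ((\<forall>\<^sub>F (t, x) in nhds (t\<^sub>0, x\<^sub>0). U t x - \<phi> (t, x) \<le> U t\<^sub>0 x\<^sub>0 - \<phi> (t\<^sub>0, x\<^sub>0)) \<longrightarrow>
          frechet_derivative \<phi> (at (t\<^sub>0, x\<^sub>0)) (1, 0)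
            + f (frechet_derivative \<phi> (at (t\<^sub>0, x\<^sub>0)) (0, 1)) \<le> 0) \<and>
       ((\<forall>\<^sub>F (t, x) in nhds (t\<^sub>0, x\<^sub>0). U t x - \<phi> (t, x) \<ge> U t\<^sub>0 x\<^sub>0 - \<phi> (t\<^sub>0, x\<^sub>0)) \<longrightarrow>
          frechet_derivative \<phi> (at (t\<^sub>0, x\<^sub>0)) (1, 0)
            + f (frechet_derivative \<phi> (at (t\<^sub>0, x\<^sub>0)) (0, 1)) \<ge> 0))"

section \<open>The primitive along a path\<close>

text \<open>\<open>\<gamma>'\<close> stands for the weak derivative of \<open>\<gamma>\<close>. The integral from \<open>\<gamma> t\<close> to \<open>x\<close> is
  oriented. Lebesgue rather than Borel measure is used since \<open>u 0\<close> and \<open>\<gamma>'\<close> are only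
  Lebesgue measurable.\<close>

definition hj_primitive ::
    "(real \<Rightarrow> real) \<Rightarrow> (real \<Rightarrow> real \<Rightarrow> real) \<Rightarrow> (real \<Rightarrow> real) \<Rightarrow> (real \<Rightarrow> real) \<Rightarrow> real
      \<Rightarrow> real \<Rightarrow> real \<Rightarrow> real" where
  "hj_primitive f u \<gamma> \<gamma>' C t x =
     (LINT \<xi>=\<gamma> t..x|lebesgue. (u t \<xi>))
     + (LINT \<tau>=0..t|lebesgue. (\<gamma>' \<tau> * u \<tau> (\<gamma> \<tau>) - f (u \<tau> (\<gamma> \<tau>)))) + C"

end

theory Submission
  imports Defs
begin

text \<open>Let \<open>W(t, x) = \<integral>\<^sub>0\<^sup>x u(t) - \<integral>\<^sub>0\<^sup>t f(u(\<cdot>, 0))\<close>. Because the slices of \<open>u\<close> are left continuous,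
  testing the weak formulation with kernels supported to the left of a point gives
  \<open>\<partial>\<^sub>x W = u\<close> and \<open>\<partial>\<^sub>t W = - f(u)\<close> in integrated form along every horizontal and vertical line.
  The averages of \<open>W\<close> over \<open>[x - h, x]\<close> are \<open>C\<^sup>1\<close>, and their gradients converge to \<open>(- f(u), u)\<close>
  at every point of the open strip. This replaces mollification throughout; in particular
  the chain rule along \<open>\<gamma>\<close> for these averages shows that \<open>U - W\<close> is constant.

  For the viscosity inequalities, make the touching strict, so that \<open>w = \<plusminus>(W - \<phi>)\<close> has a strict
  minimum, and put \<open>(\<delta> - w)\<^sub>+\<^sup>2\<close> into the entropy inequality with \<open>k = \<partial>\<^sub>x \<phi>(t0, x0)\<close>. This single
  entropy forces the sign of \<open>\<partial>\<^sub>t \<phi> + f(\<partial>\<^sub>x \<phi>)\<close> as \<open>\<delta> \<rightarrow> 0\<close>; convexity of \<open>f\<close> plays no role.\<close>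

section \<open>Test functions\<close>

text \<open>The obstacle is that \<open>U\<close> contains \<open>u\<close> along
  \<open>\<gamma>\<close>, a null set of the strip, so facts valid almost everywhere say nothing
  there; \<open>\<gamma>\<close> may even run along a shock. Left averages are jointly continuous,
  because the slices move continuously in L^1, and they converge at every point with
  \<open>t > 0\<close>. Measurability along curves and the limits in the chain rule thus reduce to
  bounded pointwise convergence. At \<open>t = 0\<close> only the class of \<open>u\<close> is
  known, so this slice is cut away and returns as a null set of times. Averaging does not commute
  with \<open>f\<close>. Instead the two components \<open>- f u\<close> and \<open>u\<close> of the
  gradient of \<open>W\<close> are averaged separately, which is linear; hence \<open>u\<close> and
  the flux are two instances of one structure with a common bound. The function
  \<open>(\<delta> - w)\<^sub>+\<^sup>2\<close> is suited to the entropy inequality because its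
  gradient is a nonnegative weight times an explicit expression in \<open>u\<close> and
  \<open>f u\<close>, so the integrand can be estimated pointwise. Strictness of the touching
  localises its support. The essential bound on \<open>u\<close> and the local Lipschitz bound on
  \<open>f\<close> become global at the very end, through a cut-off that leaves \<open>u\<close>
  unchanged for \<open>t > 0\<close>.\<close>

text \<open>The open sets \<open>\<Omega>\<close> and \<open>- K\<close> cover the space, and
  \<open>\<psi>\<close> vanishes on the second, so derivatives on \<open>\<Omega>\<close> alone
  determine everything. This lets functions built from the averaged potential, which are
  differentiable only inside the strip, act as test functions on the whole plane.\<close>

lemma C1c_onI:
  fixes \<psi> :: "'a::euclidean_space \<Rightarrow> real"
  assumes "open \<Omega>" "compact K" "K \<subseteq> \<Omega>"
    and der: "\<And>p. p \<in> \<Omega> \<Longrightarrow> (\<psi> has_derivative D p) (at p)"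
    and cont: "\<And>v. continuous_on \<Omega> (\<lambda>p. D p v)"
    and zero: "\<And>p. p \<notin> K \<Longrightarrow> \<psi> p = 0"
  shows "C1c_on \<Omega> \<psi>"
proof -
  have oK: "open (- K)" using assms(2) by (simp add: compact_imp_closed open_Compl)
  have der0: "(\<psi> has_derivative (\<lambda>_. 0)) (at p)" if "p \<notin> K" for p
    by (rule has_derivative_transform_within_open[OF has_derivative_const[of 0] oK]) (use that zero in auto)
  have UN: "\<Omega> \<union> - K = UNIV" using assms(3) by auto
  have "\<psi> differentiable (at p)" for p
    using der[of p] der0[of p] UN unfolding differentiable_def by blast
  moreover have "continuous_on UNIV (\<lambda>p. frechet_derivative \<psi> (at p) v)" for v
  proof -
    have "continuous_on \<Omega> (\<lambda>p. frechet_derivative \<psi> (at p) v)"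
      using cont[of v] by (rule continuous_on_eq) (simp add: frechet_derivative_at[OF der, symmetric])
    moreover have "continuous_on (- K) (\<lambda>p. frechet_derivative \<psi> (at p) v)"
      by (rule continuous_on_eq[OF continuous_on_const[of _ 0]])
        (simp add: frechet_derivative_at[OF der0, symmetric])
    ultimately show ?thesis
      using continuous_on_open_Un[OF assms(1) oK] UN by metis
  qed
  moreover have "closure {x. \<psi> x \<noteq> 0} \<subseteq> K"
    by (rule closure_minimal) (use zero assms(2) compact_imp_closed in auto)
  moreover from this have "compact (closure {x. \<psi> x \<noteq> 0})"
    using compact_Int_closed[OF assms(2) closed_closure, of "{x. \<psi> x \<noteq> 0}"]
    by (simp add: inf.absorb2)
  ultimately show ?thesis
    unfolding C1c_on_def using assms(3) by auto
qed

lemma C1c_on_has_derivative: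
  "C1c_on \<Omega> \<psi> \<Longrightarrow> (\<psi> has_derivative frechet_derivative \<psi> (at p)) (at p)"
  by (auto simp: C1c_on_def frechet_derivative_works)

lemma C1c_on_continuous:
  "C1c_on \<Omega> \<psi> \<Longrightarrow> continuous_on UNIV \<psi>"
  using C1c_on_has_derivative has_derivative_continuous
  by (metis continuous_at_imp_continuous_on)

lemma C1c_on_continuous_derivative:
  "C1c_on \<Omega> \<psi> \<Longrightarrow> continuous_on UNIV (\<lambda>p. frechet_derivative \<psi> (at p) v)"
  by (auto simp: C1c_on_def)

lemma C1c_on_support:
  assumes "C1c_on \<Omega> \<psi>"
  obtains K where "compact K" "K \<subseteq> \<Omega>" "\<And>p. p \<notin> K \<Longrightarrow> \<psi> p = 0"
    "\<And>p v. p \<notin> K \<Longrightarrow> frechet_derivative \<psi> (at p) v = 0"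
proof
  let ?K = "closure {x. \<psi> x \<noteq> 0}"
  show "compact ?K" "?K \<subseteq> \<Omega>" using assms by (auto simp: C1c_on_def)
  show z: "\<psi> p = 0" if "p \<notin> ?K" for p using that subsetD[OF closure_subset[of "{x. \<psi> x \<noteq> 0}"], of p] by blast
  show "frechet_derivative \<psi> (at p) v = 0" if "p \<notin> ?K" for p v
  proof -
    have "open (- ?K)" by (rule open_Compl[OF closed_closure])
    moreover have "p \<in> - ?K" using that by (simp only: Compl_iff not_False_eq_True)
    moreover have "0 = \<psi> x" if "x \<in> - ?K" for x using z[of x] that by (metis ComplD)
    ultimately have "(\<psi> has_derivative (\<lambda>_. 0)) (at p)"
      using has_derivative_transform_within_open[OF has_derivative_const[of 0]] by blast
    from frechet_derivative_at[OF this, symmetric] show ?thesis by simp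
  qed
qed

section \<open>Integrals of compactly supported functions\<close>

lemma integrable_indicator_compact:
  fixes K :: "'a::euclidean_space set"
  shows "compact K \<Longrightarrow> integrable lborel (\<lambda>p. C * indicator K p :: real)"
  by (auto intro!: integrable_mult_right integrable_real_indicator
      simp: compact_imp_closed emeasure_compact_finite[unfolded infinity_ennreal_def])

lemma integrable_compact_support:
  fixes g :: "'a::euclidean_space \<Rightarrow> real"
  assumes "g \<in> borel_measurable borel" "compact K" "\<And>p. p \<in> K \<Longrightarrow> \<bar>g p\<bar> \<le> C" "\<And>p. p \<notin> K \<Longrightarrow> g p = 0"
  shows "integrable lborel g"
proof (rule Bochner_Integration.integrable_bound[of lborel "\<lambda>p. C * indicator K p"])
  show "integrable lborel (\<lambda>p. C * indicator K p)"
    by (rule integrable_indicator_compact[OF assms(2)])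
  show "AE p in lborel. norm (g p) \<le> norm (C * indicator K p)"
    using assms(3,4) by (auto simp: indicator_def intro!: AE_I2 order_trans[OF _ abs_ge_self])
qed (use assms in auto)

text \<open>The definitions use Lebesgue measure, while Fubini and dominated convergence are applied
  on \<open>lborel\<close>; for Borel integrands supported in \<open>\<Omega>\<close> this is the
  bridge.\<close>

lemma set_integral_lebesgue_eq_lborel:
  fixes g :: "'a::euclidean_space \<Rightarrow> real"
  assumes "g \<in> borel_measurable borel" "\<And>p. p \<notin> \<Omega> \<Longrightarrow> g p = 0"
  shows "(LINT p:\<Omega>|lebesgue. g p) = (LINT p|lborel. g p)"
proof -
  have "(\<lambda>p. indicator \<Omega> p *\<^sub>R g p) = g"
    using assms(2) by (force simp: indicator_def)
  then show ?thesis
    using assms(1) by (simp add: set_lebesgue_integral_def integral_completion)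
qed

lemma integral_lborel_translation:
  fixes g :: "'a::euclidean_space \<Rightarrow> real"
  assumes "g \<in> borel_measurable borel"
  shows "(LINT x|lborel. g (x + a)) = (LINT x|lborel. g x)"
proof -
  have "(LINT x|lborel. g x) = (LINT x|distr lborel borel ((+) a). g x)"
    by (simp only: lborel_distr_plus)
  also have "\<dots> = (LINT x|lborel. g (a + x))"
    by (rule integral_distr) (use assms in auto)
  finally show ?thesis by (simp add: add.commute)
qed

text \<open>Difference quotients in direction \<open>v\<close> have integral zero by translation
  invariance of Lebesgue measure, and they converge boundedly to the derivative. This works in any
  dimension and direction at once.\<close>

lemma integral_derivative_C1c:
  fixes \<psi> :: "'a::euclidean_space \<Rightarrow> real"
  assumes \<psi>: "C1c_on \<Omega> \<psi>"
  shows "(LINT x:\<Omega>|lebesgue. frechet_derivative \<psi> (at x) v) = 0"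
proof -
  let ?D = "\<lambda>x. frechet_derivative \<psi> (at x) v"
  obtain K where K: "compact K" "K \<subseteq> \<Omega>" "\<And>p. p \<notin> K \<Longrightarrow> \<psi> p = 0" "\<And>p. p \<notin> K \<Longrightarrow> ?D p = 0"
    using C1c_on_support[OF \<psi>] by metis
  have contD: "continuous_on UNIV ?D" using C1c_on_continuous_derivative[OF \<psi>] .
  have cont: "continuous_on UNIV \<psi>" using C1c_on_continuous[OF \<psi>] .
  have meas: "\<psi> \<in> borel_measurable borel" using cont by (rule borel_measurable_continuous_onI)
  have measD: "?D \<in> borel_measurable borel" using contD by (rule borel_measurable_continuous_onI)
  have "bounded (?D ` K)" "bounded (\<psi> ` K)"
    using K(1) contD cont by (meson compact_continuous_image compact_imp_bounded continuous_on_subset subset_UNIV)+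
  then obtain C C' where C0: "\<And>p. p \<in> K \<Longrightarrow> \<bar>?D p\<bar> \<le> C" and C': "\<And>p. p \<in> K \<Longrightarrow> \<bar>\<psi> p\<bar> \<le> C'"
    unfolding bounded_iff by (metis imageI real_norm_def)
  have C: "\<bar>?D p\<bar> \<le> max C 0" for p
    using C0 K(4) by (cases "p \<in> K") (auto simp: le_max_iff_disj)
  obtain R where R: "\<And>p. p \<in> K \<Longrightarrow> norm p \<le> R"
    using K(1) compact_imp_bounded bounded_iff by metis
  define g where "g n x = real (Suc n) * (\<psi> (x + (1 / real (Suc n)) *\<^sub>R v) - \<psi> x)" for n x
  have line: "((\<lambda>s. \<psi> (x + s *\<^sub>R v)) has_real_derivative ?D (x + s *\<^sub>R v)) (at s)" for x s
  proof -
    have "((\<lambda>s. \<psi> (x + s *\<^sub>R v)) has_derivative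
        (\<lambda>r. frechet_derivative \<psi> (at (x + s *\<^sub>R v)) (r *\<^sub>R v))) (at s)"
      by (rule has_derivative_compose[of "\<lambda>s. x + s *\<^sub>R v" "\<lambda>r. r *\<^sub>R v", OF _ C1c_on_has_derivative[OF \<psi>]])
        (auto intro!: derivative_eq_intros)
    moreover have "frechet_derivative \<psi> (at p) (r *\<^sub>R v) = ?D p * r" for r p
      using linear_scale[OF has_derivative_linear[OF C1c_on_has_derivative[OF \<psi>]], of p r v] by simp
    ultimately show ?thesis by (simp add: has_field_derivative_def)
  qed
  \<comment> \<open>The mean value theorem bounds every quotient by \<open>max C 0\<close>. The
    shifts are no longer than \<open>norm v\<close>, so all quotients are supported in the ball of
    radius \<open>R + norm v\<close>.\<close>
  have "(\<lambda>n. LINT x|lborel. g n x) \<longlonglongrightarrow> (LINT x|lborel. ?D x)"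
  proof (rule integral_dominated_convergence[where w="\<lambda>x. max C 0 * indicator (cball 0 (R + norm v)) x"])
    show "integrable lborel (\<lambda>x. max C 0 * indicator (cball 0 (R + norm v)) x)"
      by (rule integrable_indicator_compact) simp
    show "AE x in lborel. (\<lambda>n. g n x) \<longlonglongrightarrow> ?D x"
    proof (rule AE_I2)
      fix x
      have "((\<lambda>h. (\<psi> (x + h *\<^sub>R v) - \<psi> x) / h) \<longlongrightarrow> ?D x) (at 0)"
        using line[of x 0] by (simp add: DERIV_def)
      moreover have "filterlim (\<lambda>n. 1 / real (Suc n)) (at 0) sequentially"
        by (rule filterlim_atI) (use LIMSEQ_inverse_real_of_nat in \<open>simp_all add: inverse_eq_divide\<close>)
      ultimately have "((\<lambda>n. (\<psi> (x + (1 / real (Suc n)) *\<^sub>R v) - \<psi> x) / (1 / real (Suc n))) \<longlonglongrightarrow> ?D x)"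
        by (rule filterlim_compose)
      then show "(\<lambda>n. g n x) \<longlonglongrightarrow> ?D x" by (simp add: g_def mult.commute)
    qed
    fix n
    show "AE x in lborel. norm (g n x) \<le> max C 0 * indicator (cball 0 (R + norm v)) x"
    proof (rule AE_I2)
      fix x
      show "norm (g n x) \<le> max C 0 * indicator (cball 0 (R + norm v)) x"
      proof (cases "norm x \<le> R + norm v")
        case True
        obtain z where "\<psi> (x + (1 / real (Suc n)) *\<^sub>R v) - \<psi> (x + 0 *\<^sub>R v)
            = (1 / real (Suc n) - 0) * ?D (x + z *\<^sub>R v)"
          using MVT2[of 0 "1 / real (Suc n)" "\<lambda>s. \<psi> (x + s *\<^sub>R v)" "\<lambda>s. ?D (x + s *\<^sub>R v)"] line by auto
        then have "g n x = ?D (x + z *\<^sub>R v)" by (simp add: g_def)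
        then show ?thesis using C True by simp
      next
        case False
        have "norm ((1 / real (Suc n)) *\<^sub>R v) \<le> norm v"
          using mult_right_mono[of "1 / real (Suc n)" 1 "norm v"] by simp
        then have "norm (x + (1 / real (Suc n)) *\<^sub>R v) > R"
          using False norm_diff_ineq[of x "(1 / real (Suc n)) *\<^sub>R v"] by linarith
        moreover have "norm x > R" using False norm_ge_zero[of v] by linarith
        ultimately have "x \<notin> K" "x + (1 / real (Suc n)) *\<^sub>R v \<notin> K"
          using R not_le by blast+
        then have "g n x = 0" using K(3) by (simp add: g_def del: of_nat_Suc)
        then show ?thesis by simp
      qed
    qed
  qed (use meas measD in \<open>auto simp: g_def\<close>)
  moreover have "(LINT x|lborel. g n x) = 0" for n
  proof -
    have i: "integrable lborel \<psi>"
      by (rule integrable_compact_support[OF meas K(1) C' K(3)])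
    have "integrable lborel (\<lambda>x. \<psi> (x + a))" for a
      by (rule integrable_compact_support[where K="(\<lambda>x. x - a) ` K" and C=C'])
        (use K C' meas in \<open>force simp: image_iff intro!: compact_continuous_image continuous_intros\<close>)+
    with i show ?thesis
      by (simp add: g_def integral_lborel_translation[OF meas] del: of_nat_Suc)
  qed
  ultimately have "(LINT x|lborel. ?D x) = 0"
    by (simp add: LIMSEQ_const_iff)
  then show ?thesis
    using set_integral_lebesgue_eq_lborel[OF measD, of \<Omega>] K(2,4) by auto
qed

section \<open>One-sided approximation of point values and indicators\<close>

text \<open>Squaring makes the positive part C^1, also at the kink. It is the building block of
  \<open>ramp\<close> and later the shape of the test function in the viscosity argument.\<close>

lemma DERIV_max0_square:
  "((\<lambda>s. (max 0 s)\<^sup>2) has_real_derivative 2 * max 0 s) (at s)" for s :: real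
proof -
  consider "s < 0" | "s = 0" | "s > 0" by linarith
  then show ?thesis
  proof cases
    case 1
    have "((\<lambda>_::real. 0) has_real_derivative 2 * max 0 s) (at s)" using 1 by (auto intro!: derivative_eq_intros)
    then show ?thesis
      by (rule has_field_derivative_transform_within_open[of _ _ _ "{..<0}"]) (use 1 in auto)
  next
    case 2
    have "((\<lambda>h::real. max 0 h) \<longlongrightarrow> max 0 0) (at 0)"
      by (intro tendsto_intros)
    moreover have "\<forall>\<^sub>F h::real in at 0. max 0 h = ((max 0 (0 + h))\<^sup>2 - (max 0 0)\<^sup>2) / h"
      by (auto simp: eventually_at_filter max_def power2_eq_square)
    ultimately have "((\<lambda>h::real. ((max 0 (0 + h))\<^sup>2 - (max 0 0)\<^sup>2) / h) \<longlongrightarrow> max 0 0) (at 0)"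
      by (rule Lim_transform_eventually)
    then show ?thesis using 2 by (simp add: DERIV_def)
  next
    case 3
    have "((\<lambda>s::real. s\<^sup>2) has_real_derivative 2 * max 0 s) (at s)" using 3 by (auto intro!: derivative_eq_intros)
    then show ?thesis
      by (rule has_field_derivative_transform_within_open[of _ _ _ "{0<..}"]) (use 3 in auto)
  qed
qed

text \<open>\<open>ramp\<close> is a \<open>C\<^sup>1\<close> step from 0 to 1 on the unit interval, \<open>tent\<close> its derivative.\<close>

definition ramp :: "real \<Rightarrow> real" where
  "ramp y = 2 * ((max 0 y)\<^sup>2 - 2 * (max 0 (y - 1/2))\<^sup>2 + (max 0 (y - 1))\<^sup>2)"

definition tent :: "real \<Rightarrow> real" where
  "tent y = 4 * (max 0 y - 2 * max 0 (y - 1/2) + max 0 (y - 1))"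

lemma tent_nonneg: "0 \<le> tent y" and tent_le: "tent y \<le> 2"
  and tent_eq_0: "y \<le> 0 \<or> 1 \<le> y \<Longrightarrow> tent y = 0"
  by (auto simp: tent_def max_def)

lemma continuous_on_tent [continuous_intros]:
  "continuous_on S g \<Longrightarrow> continuous_on S (\<lambda>x. tent (g x))"
  unfolding tent_def by (intro continuous_intros)

lemma ramp_0: "y \<le> 0 \<Longrightarrow> ramp y = 0"
  by (auto simp: ramp_def)

lemma ramp_1: "1 \<le> y \<Longrightarrow> ramp y = 1"
  by (auto simp: ramp_def max_def power2_eq_square algebra_simps)

lemma DERIV_ramp: "(ramp has_real_derivative tent y) (at y)"
proof -
  have sh: "((\<lambda>s. (max 0 (s - a))\<^sup>2) has_real_derivative 2 * max 0 (y - a)) (at y)" for a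
    by (rule DERIV_chain2[OF DERIV_max0_square, of _ 1, simplified]) (auto intro!: derivative_eq_intros)
  show ?thesis unfolding ramp_def[abs_def] tent_def
    by (rule derivative_eq_intros sh sh[of 0, simplified] refl | simp)+
qed

lemma ramp_mono: "x \<le> y \<Longrightarrow> ramp x \<le> ramp y"
  using DERIV_nonneg_imp_nondecreasing[of x y ramp] DERIV_ramp tent_nonneg by blast

lemma ramp_bounds: "0 \<le> ramp y" "ramp y \<le> 1"
  using ramp_mono[of "min y 0" y] ramp_mono[of y "max y 1"] ramp_0[of "min y 0"] ramp_1[of "max y 1"]
  by auto

lemma has_integral_tent: "(tent has_integral 1) {0..1}"
  using fundamental_theorem_of_calculus[of 0 1 ramp tent] DERIV_ramp ramp_0[of 0] ramp_1[of 1]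
  by (auto simp: has_real_derivative_iff_has_vector_derivative has_vector_derivative_at_within)

lemma tent_borel [measurable]: "tent \<in> borel_measurable borel"
  by (intro borel_measurable_continuous_onI continuous_intros)

lemma ramp_borel [measurable]: "ramp \<in> borel_measurable borel"
  by (intro borel_measurable_continuous_onI continuous_at_imp_continuous_on ballI DERIV_isCont[OF DERIV_ramp])

lemma integral_tent: "(LINT y|lborel. tent y) = 1" and integrable_tent: "integrable lborel tent"
proof -
  show i: "integrable lborel tent"
    by (rule integrable_compact_support[where K="{0..1}" and C=2])
      (use tent_nonneg tent_le tent_eq_0 in \<open>auto\<close>)
  have "(LINT y|lborel. tent y) = integral UNIV tent"
    by (rule integral_lborel[OF i, symmetric])
  also have "\<dots> = integral {0..1} tent"
    by (rule integral_spike_set) (auto simp: tent_eq_0 intro!: negligible_subset[OF negligible_empty])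
  finally show "(LINT y|lborel. tent y) = 1"
    using has_integral_tent by (simp add: integral_unique)
qed

text \<open>An approximate identity: the summand 1 moves the support of the rescaled
  \<open>tent\<close> to \<open>[a - 1 / (n + 1), a]\<close>, so that integration against it sees
  only the left limit at \<open>a\<close>.\<close>

definition left_kernel :: "nat \<Rightarrow> real \<Rightarrow> real \<Rightarrow> real" where
  "left_kernel n a x = real (Suc n) * tent (real (Suc n) * (x - a) + 1)"

text \<open>The substitution \<open>x = a - h + h * y\<close> with \<open>h = 1 / (n + 1)\<close>
  turns the kernel into the fixed \<open>tent\<close>. For \<open>y < 1\<close> the points tend to
  \<open>a\<close> strictly from the left, and for \<open>y \<ge> 1\<close> the \<open>tent\<close>
  vanishes.\<close>

lemma left_kernel_tendsto:
  assumes g: "g \<in> borel_measurable borel" "\<And>x. \<bar>g x\<bar> \<le> C"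
    and left: "(g \<longlongrightarrow> g a) (at_left a)"
  shows "(\<lambda>n. LINT x|lborel. left_kernel n a x * g x) \<longlonglongrightarrow> g a"
proof -
  have eq: "(LINT x|lborel. left_kernel n a x * g x)
      = (LINT y|lborel. tent y * g ((a - 1 / real (Suc n)) + (1 / real (Suc n)) * y))" for n
  proof -
    have "N * (((a - 1 / N) + (1 / N) * y) - a) + 1 = y" if "N > 0" for y N :: real
      using that by (simp add: field_simps)
    from this[of "real (Suc n)"]
    have "real (Suc n) * (((a - 1 / real (Suc n)) + (1 / real (Suc n)) * y) - a) + 1 = y" for y
      by simp
    then have "left_kernel n a ((a - 1 / real (Suc n)) + (1 / real (Suc n)) * y)
        = real (Suc n) * tent y" for y
      unfolding left_kernel_def by metis
    then show ?thesis
      using lborel_integral_real_affine[of "1 / real (Suc n)" "\<lambda>x. left_kernel n a x * g x" "a - 1 / real (Suc n)"]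
      by (simp add: mult.assoc del: of_nat_Suc)
  qed
  have "(\<lambda>n. LINT y|lborel. tent y * g ((a - 1 / real (Suc n)) + (1 / real (Suc n)) * y))
      \<longlonglongrightarrow> (LINT y|lborel. tent y * g a)"
  proof (rule integral_dominated_convergence[where w="\<lambda>y. C * tent y"])
    show "AE y in lborel. (\<lambda>n. tent y * g ((a - 1 / real (Suc n)) + (1 / real (Suc n)) * y)) \<longlonglongrightarrow> tent y * g a"
    proof (rule AE_I2)
      fix y
      show "(\<lambda>n. tent y * g ((a - 1 / real (Suc n)) + (1 / real (Suc n)) * y)) \<longlonglongrightarrow> tent y * g a"
      proof (cases "y < 1")
        case True
        have "(\<lambda>n. 1 / real (Suc n)) \<longlonglongrightarrow> 0"
          using LIMSEQ_inverse_real_of_nat by (simp add: inverse_eq_divide)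
        from tendsto_add[OF tendsto_const[of a] tendsto_mult[OF this tendsto_const[of "y - 1"]]]
        have "(\<lambda>n. (a - 1 / real (Suc n)) + (1 / real (Suc n)) * y) \<longlonglongrightarrow> a"
          by (simp add: right_diff_distrib algebra_simps diff_divide_distrib)
        moreover have "(a - 1 / real (Suc n)) + (1 / real (Suc n)) * y < a" for n
        proof -
          have "(1 / real (Suc n)) * y < (1 / real (Suc n)) * 1"
            by (rule mult_strict_left_mono[OF True]) simp
          then show ?thesis by linarith
        qed
        ultimately have "filterlim (\<lambda>n. (a - 1 / real (Suc n)) + (1 / real (Suc n)) * y) (at_left a) sequentially"
          by (intro filterlim_at_withinI) auto
        then show ?thesis by (intro tendsto_mult tendsto_const filterlim_compose[OF left])
      qed (simp add: tent_eq_0)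
    qed
    show "AE y in lborel. norm (tent y * g ((a - 1 / real (Suc n)) + (1 / real (Suc n)) * y)) \<le> C * tent y" for n
      using mult_left_mono[OF g(2) tent_nonneg] by (intro AE_I2) (simp add: abs_mult tent_nonneg mult.commute)
  qed (use g integrable_tent in \<open>auto\<close>)
  then show ?thesis by (simp add: eq integral_tent)
qed

lemma DERIV_scaled_ramp:
  "((\<lambda>x. ramp (real (Suc n) * (x - a) + 1)) has_real_derivative left_kernel n a x) (at x)"
  unfolding left_kernel_def
  by (rule DERIV_chain2[OF DERIV_ramp, THEN DERIV_cong[OF _ mult.commute]]) (auto intro!: derivative_eq_intros)

text \<open>A C^1 plateau whose derivative is the difference of two left kernels: testing with it
  reads off left values at \<open>s\<close> and \<open>t\<close>. Each ramp reaches its top exactly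
  at its base point, hence the limit is the indicator of \<open>{s..<t}\<close>.\<close>

definition bump :: "nat \<Rightarrow> real \<Rightarrow> real \<Rightarrow> real \<Rightarrow> real" where
  "bump n s t x = ramp (real (Suc n) * (x - s) + 1) - ramp (real (Suc n) * (x - t) + 1)"

lemma DERIV_bump: "(bump n s t has_real_derivative left_kernel n s x - left_kernel n t x) (at x)"
  unfolding bump_def[abs_def] by (intro derivative_intros DERIV_scaled_ramp)

lemma bump_borel [measurable]: "bump n s t \<in> borel_measurable borel"
  unfolding bump_def by measurable

lemma bump_nonneg: "s \<le> t \<Longrightarrow> 0 \<le> bump n s t x"
  unfolding bump_def by (auto intro!: ramp_mono simp: mult_left_mono)

lemma bump_le: "\<bar>bump n s t x\<bar> \<le> 1"
  unfolding bump_def using ramp_bounds[of "real (Suc n) * (x - s) + 1"] ramp_bounds[of "real (Suc n) * (x - t) + 1"]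
  by auto

lemma scaled_ramp_0:
  assumes "x \<le> a - 1 / real (Suc n)" shows "ramp (real (Suc n) * (x - a) + 1) = 0"
  using assms by (intro ramp_0) (simp add: field_simps)

lemma scaled_ramp_1:
  assumes "a \<le> x" shows "ramp (real (Suc n) * (x - a) + 1) = 1"
  using assms by (intro ramp_1) simp

lemma scaled_ramp_tendsto:
  "(\<lambda>n. ramp (real (Suc n) * (x - a) + 1)) \<longlonglongrightarrow> (if a \<le> x then 1 else 0)"
proof (cases "a \<le> x")
  case False
  then have "a - x > 0" by simp
  then obtain N where N: "inverse (real (Suc N)) < a - x" using reals_Archimedean by blast
  have "\<forall>\<^sub>F n in sequentially. ramp (real (Suc n) * (x - a) + 1) = 0"
    using eventually_ge_at_top[of N]
  proof eventually_elim
    case (elim n)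
    then have "1 / real (Suc n) \<le> inverse (real (Suc N))" by (simp add: inverse_eq_divide frac_le)
    then show ?case using N by (intro scaled_ramp_0) simp
  qed
  then show ?thesis using False by (simp add: tendsto_eventually)
qed (simp add: scaled_ramp_1 del: of_nat_Suc)

lemma bump_eq_0:
  assumes "x \<notin> {s - 1 / real (Suc n)..t}" "s \<le> t" shows "bump n s t x = 0"
proof -
  have "x \<le> s - 1 / real (Suc n) \<and> x \<le> t - 1 / real (Suc n) \<or> s \<le> x \<and> t \<le> x"
    using assms by auto
  then show ?thesis using scaled_ramp_0 scaled_ramp_1 unfolding bump_def by fastforce
qed

lemma bump_tendsto:
  "s \<le> t \<Longrightarrow> (\<lambda>n. bump n s t x) \<longlonglongrightarrow> indicator {s..<t} x"
  unfolding bump_def using tendsto_diff[OF scaled_ramp_tendsto[of x s] scaled_ramp_tendsto[of x t]]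
  by (auto simp: indicator_def split: if_splits)

lemma continuous_left_kernel [continuous_intros]:
  "continuous_on S g \<Longrightarrow> continuous_on S (\<lambda>x. left_kernel n a (g x))"
  unfolding left_kernel_def by (intro continuous_intros)

lemma left_kernel_borel [measurable]: "left_kernel n a \<in> borel_measurable borel"
  by (intro borel_measurable_continuous_onI continuous_intros)

lemma left_kernel_nonneg: "0 \<le> left_kernel n a x" and left_kernel_le: "left_kernel n a x \<le> 2 * real (Suc n)"
  using mult_left_mono[OF tent_le, of "real (Suc n)" "real (Suc n) * (x - a) + 1"]
  by (auto simp: left_kernel_def tent_nonneg mult.commute simp del: of_nat_Suc)

lemma left_kernel_eq_0:
  assumes "x \<notin> {a - 1 / real (Suc n)..a}" shows "left_kernel n a x = 0"
proof -
  have "N * (x - a) + 1 \<le> 0 \<or> 1 \<le> N * (x - a) + 1" if "x \<notin> {a - 1 / N..a}" "N > 0" for N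
    using that by (auto simp: field_simps)
  from tent_eq_0[OF this, of "real (Suc n)"] show ?thesis
    using assms by (simp add: left_kernel_def)
qed

lemma C1c_bump:
  assumes "s \<le> t" "{s - 1 / real (Suc n)..t} \<subseteq> \<Omega>" "open \<Omega>"
  shows "C1c_on \<Omega> (bump n s t)"
  by (rule C1c_onI[OF assms(3) _ assms(2), where D="\<lambda>x. (*) (left_kernel n s x - left_kernel n t x)"])
    (use DERIV_bump bump_eq_0 assms(1) in \<open>auto simp: has_field_derivative_def intro!: continuous_intros\<close>)

lemma frechet_derivative_bump:
  "frechet_derivative (bump n s t) (at x) 1 = left_kernel n s x - left_kernel n t x"
proof -
  have "(bump n s t has_derivative (*) (left_kernel n s x - left_kernel n t x)) (at x)"
    using DERIV_bump by (simp add: has_field_derivative_def)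
  from frechet_derivative_at[OF this, symmetric]
  show ?thesis by simp
qed

text \<open>Testing with \<open>bump n s t\<close> isolates \<open>g s - g t\<close> on one side and
  the integral of \<open>G\<close> over \<open>{s..<t}\<close> on the other. Only nonnegative tests
  are demanded, since these are the ones the entropy inequality supplies. The lemma serves the mass
  of \<open>u\<close> between two points as well as the path \<open>\<gamma>\<close>.\<close>

lemma weak_derivative_imp_integral:
  fixes g G :: "real \<Rightarrow> real"
  assumes g: "continuous_on {0..T} g" and G: "set_integrable lebesgue {0<..<T} G"
    and test: "\<And>\<alpha>. C1c_on {0<..<T} \<alpha> \<Longrightarrow> (\<And>x. \<alpha> x \<ge> 0) \<Longrightarrow>
      (LINT x:{0<..<T}|lebesgue. g x * frechet_derivative \<alpha> (at x) 1)
        = - (LINT x:{0<..<T}|lebesgue. G x * \<alpha> x)"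
    and st: "0 \<le> s" "s \<le> t" "t \<le> T"
  shows "g t - g s = integral {s..t} G"
proof -
  have G0: "G absolutely_integrable_on {0..T}"
    using G by (rule absolutely_integrable_spike_set)
      (rule negligible_subset[of "{0, T}"]; auto)+
  have Gi: "G integrable_on {0..T}" by (rule set_lebesgue_integral_eq_integral(1)[OF G0])
  have interior: "g t - g s = integral {s..t} G" if st: "0 < s" "s \<le> t" "t < T" for s t
  proof -
    \<comment> \<open>Extension by zero makes \<open>g\<close> a bounded Borel function on the line,
      as the kernels require; left limits at interior points are unaffected.\<close>
    define h where "h x = indicator {0..T} x * g x" for x
    have hm: "h \<in> borel_measurable borel"
      unfolding h_def using borel_measurable_continuous_on_indicator[OF _ g] by simp
    have "bounded (g ` {0..T})"
      by (intro compact_imp_bounded compact_continuous_image g) auto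
    then obtain C where C: "\<And>x. x \<in> {0..T} \<Longrightarrow> \<bar>g x\<bar> \<le> C"
      unfolding bounded_iff by (metis imageI real_norm_def)
    have hC: "\<bar>h x\<bar> \<le> max C 0" for x
      using C[of x] by (cases "x \<in> {0..T}") (auto simp: h_def)
    have left: "(h \<longlongrightarrow> h a) (at_left a)" if "0 < a" "a < T" for a
    proof -
      have "(g \<longlongrightarrow> g a) (at a)"
        using g that continuous_on_interior[of "{0..T}" g a] by (simp add: isCont_def)
      moreover have "\<forall>\<^sub>F x in at a. g x = h x"
        using that eventually_at_in_open'[of "{0<..<T}" a]
        by (auto simp: h_def indicator_def elim!: eventually_mono)
      ultimately have "(h \<longlongrightarrow> g a) (at a)" by (rule Lim_transform_eventually)
      then show ?thesis using that by (auto simp: h_def intro: filterlim_mono at_le)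
    qed
    have lim1: "(\<lambda>n. (LINT x|lborel. left_kernel n s x * h x) - (LINT x|lborel. left_kernel n t x * h x))
        \<longlonglongrightarrow> h s - h t"
      using st by (intro tendsto_diff left_kernel_tendsto[OF hm hC] left) auto
    have lim2: "(\<lambda>n. LINT x:{0<..<T}|lebesgue. G x * bump n s t x)
        \<longlonglongrightarrow> (LINT x:{0<..<T}|lebesgue. G x * indicator {s..<t} x)"
      unfolding set_lebesgue_integral_def
    proof (rule integral_dominated_convergence[where w="\<lambda>x. \<bar>indicator {0<..<T} x *\<^sub>R G x\<bar>"])
      have Gm: "(\<lambda>x. indicator {0<..<T} x *\<^sub>R G x) \<in> borel_measurable lebesgue"
        using G by (auto simp: set_integrable_def)
      have bm: "bump n s t \<in> borel_measurable lebesgue" for n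
        by (intro measurable_completion) simp
      show "(\<lambda>x. indicator {0<..<T} x *\<^sub>R (G x * bump n s t x)) \<in> borel_measurable lebesgue" for n
        using borel_measurable_times[OF Gm bm[of n]] by (simp add: mult.assoc)
      have "(indicator {s..<t} :: real \<Rightarrow> real) \<in> borel_measurable lebesgue" by (intro measurable_completion) simp
      from borel_measurable_times[OF Gm this]
      show "(\<lambda>x. indicator {0<..<T} x *\<^sub>R (G x * indicator {s..<t} x)) \<in> borel_measurable lebesgue"
        by (simp add: mult.assoc)
      show "integrable lebesgue (\<lambda>x. \<bar>indicator {0<..<T} x *\<^sub>R G x\<bar>)"
        using G unfolding set_integrable_def by (rule integrable_abs)
      show "AE x in lebesgue. (\<lambda>n. indicator {0<..<T} x *\<^sub>R (G x * bump n s t x))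
          \<longlonglongrightarrow> indicator {0<..<T} x *\<^sub>R (G x * indicator {s..<t} x)"
        using st by (intro AE_I2 tendsto_intros bump_tendsto) auto
      show "AE x in lebesgue. norm (indicator {0<..<T} x *\<^sub>R (G x * bump n s t x)) \<le> \<bar>indicator {0<..<T} x *\<^sub>R G x\<bar>" for n
        by (intro AE_I2) (use bump_le[of n s t] in \<open>auto simp: abs_mult indicator_def mult_left_le\<close>)
    qed
    have "(LINT x:{0<..<T}|lebesgue. G x * indicator {s..<t} x) = (LINT x:{s..<t}|lebesgue. G x)"
      unfolding set_lebesgue_integral_def using st
      by (intro Bochner_Integration.integral_cong) (auto simp: indicator_def)
    also have "\<dots> = integral {s..<t} G"
      by (intro set_lebesgue_integral_eq_integral(2) set_integrable_subset[OF G]) (use st in auto)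
    also have "\<dots> = integral {s..t} G"
      by (rule integral_spike_set; rule negligible_subset[of "{t}"]; auto)
    finally have lim2': "(\<lambda>n. LINT x:{0<..<T}|lebesgue. G x * bump n s t x) \<longlonglongrightarrow> integral {s..t} G"
      using lim2 by simp
    have "\<forall>\<^sub>F n in sequentially. (LINT x|lborel. left_kernel n s x * h x) - (LINT x|lborel. left_kernel n t x * h x)
        = - (LINT x:{0<..<T}|lebesgue. G x * bump n s t x)"
    proof -
      \<comment> \<open>The plateau begins to rise at \<open>s - 1 / (n + 1)\<close>, so it is an
        admissible test function only when this number is positive.\<close>
      obtain N where N: "inverse (real (Suc N)) < s" using reals_Archimedean st by blast
      show ?thesis using eventually_ge_at_top[of N]
      proof eventually_elim
        case (elim n)
        then have n: "1 / real (Suc n) \<le> inverse (real (Suc N))" by (simp add: inverse_eq_divide frac_le)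
        have sub: "{s - 1 / real (Suc n)..t} \<subseteq> {0<..<T}" using n N st by auto
        have C1: "C1c_on {0<..<T} (bump n s t)" using C1c_bump[OF st(2) sub] by simp
        note D = frechet_derivative_bump
        have km: "(\<lambda>x. left_kernel n a x * h x) \<in> borel_measurable borel" for a
          using hm by measurable
        have ki: "integrable lborel (\<lambda>x. left_kernel n a x * h x)" for a
          by (rule integrable_compact_support[where K="{a - 1 / real (Suc n)..a}" and C="2 * real (Suc n) * max C 0"])
            (use km left_kernel_eq_0 left_kernel_le left_kernel_nonneg hC in \<open>auto simp: abs_mult intro!: mult_mono\<close>)
        have kz: "left_kernel n s x = 0" "left_kernel n t x = 0" if "x \<notin> {0<..<T}" for x
        proof -
          have "t - 1 / real (Suc n) \<ge> s - 1 / real (Suc n)" "0 < s - 1 / real (Suc n)"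
            using st n N by (simp, linarith)
          then have "x \<notin> {s - 1 / real (Suc n)..s}" "x \<notin> {t - 1 / real (Suc n)..t}"
            using that st unfolding greaterThanLessThan_iff atLeastAtMost_iff by linarith+
          then show "left_kernel n s x = 0" "left_kernel n t x = 0" using left_kernel_eq_0 by auto
        qed
        have "(LINT x:{0<..<T}|lebesgue. g x * frechet_derivative (bump n s t) (at x) 1)
            = (LINT x:{0<..<T}|lebesgue. left_kernel n s x * h x - left_kernel n t x * h x)"
          unfolding D set_lebesgue_integral_def
          by (intro Bochner_Integration.integral_cong) (auto simp: h_def indicator_def algebra_simps)
        also have "\<dots> = (LINT x|lborel. left_kernel n s x * h x - left_kernel n t x * h x)"
          by (rule set_integral_lebesgue_eq_lborel) (use km kz in auto)
        finally show ?case
          using test[OF C1 bump_nonneg[OF st(2)]] ki by simp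
      qed
    qed
    then have "(\<lambda>n. (LINT x|lborel. left_kernel n s x * h x) - (LINT x|lborel. left_kernel n t x * h x))
        \<longlonglongrightarrow> - integral {s..t} G"
      using tendsto_minus[OF lim2'] by (simp add: tendsto_cong)
    then have "h s - h t = - integral {s..t} G" using lim1 LIMSEQ_unique by blast
    then show ?thesis using st by (simp add: h_def)
  qed
  \<comment> \<open>The interior case says that \<open>P\<close> is constant on the open interval;
    continuity of \<open>P\<close> on the closed one then brings in the endpoints 0 and
    \<open>T\<close>.\<close>
  define P where "P x = g x - integral {0..x} G" for x
  have comb: "integral {s..t} G = integral {0..t} G - integral {0..s} G" if "0 \<le> s" "s \<le> t" "t \<le> T" for s t
    using Henstock_Kurzweil_Integration.integral_combine[of 0 s t G] that
      integrable_subinterval_real[OF Gi, of 0 t] by simp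
  show ?thesis
  proof (cases "0 < T")
    case True
    have "P x = P (T/2)" if x: "x \<in> {0<..<T}" for x
    proof (cases "x \<le> T/2")
      case True
      then show ?thesis using interior[of x "T/2"] comb[of x "T/2"] x by (simp add: P_def)
    next
      case False
      then show ?thesis using interior[of "T/2" x] comb[of "T/2" x] x by (simp add: P_def)
    qed
    note const = this
    have cl: "closure {0<..<T} = {0..T}" using True by (rule closure_greaterThanLessThan)
    have "continuous_on (closure {0<..<T}) P"
      unfolding P_def cl by (intro continuous_on_diff g indefinite_integral_continuous_1[OF Gi])
    from continuous_constant_on_closure[OF this const, of s] continuous_constant_on_closure[OF this const, of t]
    have "P s = P t" unfolding cl using st by simp
    then show ?thesis using comb[OF st] by (simp add: P_def)
  next
    case False
    then have "s = t" "s = 0" using st by linarith+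
    then show ?thesis by simp
  qed
qed

section \<open>Left averages\<close>

text \<open>Split the increment into a spatial one at the moving time, controlled by the Lipschitz
  constant common to all times, and a temporal one at a fixed \<open>x\<close>.\<close>

lemma continuous_on_strip:
  fixes h :: "real \<Rightarrow> real \<Rightarrow> real" and A :: "real set"
  assumes lip: "\<And>t x y. t \<in> A \<Longrightarrow> \<bar>h t x - h t y\<bar> \<le> L * \<bar>x - y\<bar>"
    and cont: "\<And>x. continuous_on A (\<lambda>t. h t x)"
  shows "continuous_on (A \<times> UNIV) (\<lambda>(t, x). h t x)"
  unfolding continuous_on_def
proof
  fix p :: "real \<times> real" assume "p \<in> A \<times> UNIV"
  then obtain t x where p: "p = (t, x)" and t: "t \<in> A" by auto
  let ?F = "at (t, x) within A \<times> UNIV"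
  have 1: "((\<lambda>p. h (fst p) x) \<longlongrightarrow> h t x) ?F"
  proof -
    have "((\<lambda>s. h s x) \<longlongrightarrow> h t x) (at t within A)" using cont t by (auto simp: continuous_on_def)
    then have "continuous (at t within A) (\<lambda>s. h s x)" by (simp add: continuous_within)
    then have "continuous (?F) (\<lambda>p. h (fst p) x)"
      by (intro continuous_within_compose2[of "(t, x)" _ fst "\<lambda>s. h s x"])
        (auto intro!: continuous_intros elim: continuous_within_subset)
    then show ?thesis by (simp add: continuous_within)
  qed
  have 2: "(snd \<longlongrightarrow> x) ?F" by (rule tendsto_eq_intros | simp)+
  have 3: "((\<lambda>p. \<bar>h (fst p) x - h t x\<bar> + L * \<bar>snd p - x\<bar>) \<longlongrightarrow> 0) ?F"
    using tendsto_add[OF tendsto_rabs[OF tendsto_diff[OF 1 tendsto_const[of "h t x"]]]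
        tendsto_mult[OF tendsto_const[of L] tendsto_rabs[OF tendsto_diff[OF 2 tendsto_const[of x]]]]]
    by simp
  have "norm ((case p of (s, y) \<Rightarrow> h s y) - h t x) \<le> \<bar>h (fst p) x - h t x\<bar> + L * \<bar>snd p - x\<bar>"
    if "p \<in> A \<times> UNIV" for p
    using lip[of "fst p" "snd p" x] that by (cases p) auto
  then have "\<forall>\<^sub>F p in ?F. norm ((case p of (s, y) \<Rightarrow> h s y) - h t x)
      \<le> \<bar>h (fst p) x - h t x\<bar> + L * \<bar>snd p - x\<bar>"
    unfolding eventually_at_filter by (intro always_eventually allI impI)
  from Lim_null_comparison[OF this 3] have "((\<lambda>p. (case p of (s, y) \<Rightarrow> h s y) - h t x) \<longlongrightarrow> 0) ?F"
    .
  then show "((\<lambda>(s, y). h s y) \<longlongrightarrow> (case p of (s, y) \<Rightarrow> h s y)) (at p within A \<times> UNIV)"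
    unfolding p
    by (simp add: Lim_null[of "\<lambda>p. (case p of (s, y) \<Rightarrow> h s y)"])
qed

text \<open>The mean over \<open>[x - 1 / (n + 1), x]\<close>; it looks only to the left so that it
  converges to the value of a left continuous function at every point.\<close>

definition lavg :: "nat \<Rightarrow> (real \<Rightarrow> real) \<Rightarrow> real \<Rightarrow> real" where
  "lavg n g x = real (Suc n) * integral {x - 1 / real (Suc n)..x} g"

lemma lavg_diff_const:
  assumes "g integrable_on {x - 1 / real (Suc n)..x}"
  shows "lavg n (\<lambda>y. g y - c) x = lavg n g x - c"
proof -
  have "integral {x - 1 / real (Suc n)..x} (\<lambda>y. g y - c) = integral {x - 1 / real (Suc n)..x} g - c / real (Suc n)"
    using assms by (subst Henstock_Kurzweil_Integration.integral_diff) auto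
  then show ?thesis by (simp add: lavg_def right_diff_distrib del: of_nat_Suc)
qed

lemma lavg_bound:
  assumes "g integrable_on {x - 1 / real (Suc n)..x}"
    and "\<And>y. x - 1 / real (Suc n) \<le> y \<Longrightarrow> y \<le> x \<Longrightarrow> \<bar>g y\<bar> \<le> B"
  shows "\<bar>lavg n g x\<bar> \<le> B"
proof -
  have "norm (integral {x - 1 / real (Suc n)..x} g) \<le> integral {x - 1 / real (Suc n)..x} (\<lambda>_. B)"
    using assms by (intro integral_norm_bound_integral) auto
  then have "\<bar>lavg n g x\<bar> \<le> real (Suc n) * ((1 / real (Suc n)) * B)"
    unfolding lavg_def abs_mult by (intro mult_mono) auto
  then show ?thesis by simp
qed

lemma lavg_tendsto:
  assumes int: "\<And>a b. g integrable_on {a..b}" and left: "(g \<longlongrightarrow> g x) (at_left x)"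
  shows "(\<lambda>n. lavg n g x) \<longlonglongrightarrow> g x"
proof (rule LIMSEQ_I)
  fix r :: real assume "r > 0"
  then have "\<forall>\<^sub>F y in at_left x. dist (g y) (g x) < r / 2"
    using left by (intro tendstoD) auto
  then obtain b where b: "b < x" "\<And>y. b < y \<Longrightarrow> y < x \<Longrightarrow> \<bar>g y - g x\<bar> < r / 2"
    by (auto simp: eventually_at_left[of "x - 1"] dist_real_def)
  obtain N where N: "inverse (real (Suc N)) < x - b" using reals_Archimedean[of "x - b"] b by auto
  have "norm (lavg n g x - g x) < r" if "n \<ge> N" for n
  proof -
    have "1 / real (Suc n) \<le> inverse (real (Suc N))" using that by (simp add: inverse_eq_divide frac_le)
    then have "\<bar>g y - g x\<bar> \<le> r / 2" if "x - 1 / real (Suc n) \<le> y" "y \<le> x" for y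
      using b(2)[of y] N that \<open>r > 0\<close> by (cases "y = x") auto
    then have "\<bar>lavg n (\<lambda>y. g y - g x) x\<bar> \<le> r / 2"
      by (intro lavg_bound Henstock_Kurzweil_Integration.integrable_diff int) auto
    then show ?thesis using lavg_diff_const[OF int, where n=n and x=x and c="g x"] \<open>r > 0\<close> by simp
  qed
  then show "\<exists>no. \<forall>n\<ge>no. norm (lavg n g x - g x) < r" by blast
qed

text \<open>Instantiated twice with the same \<open>M\<close>, for the solution and for the flux.
  The bound holds everywhere, not just almost everywhere, so that it applies along curves. Left
  continuity is demanded for positive times only, because at time 0 the datum fixes the slice merely
  up to null sets.\<close>

locale left_continuous_strip =
  fixes T M :: real and v :: "real \<Rightarrow> real \<Rightarrow> real"
  assumes T_pos: "0 < T"
    and slice_meas: "\<And>t. t \<in> {0..T} \<Longrightarrow> v t \<in> borel_measurable lebesgue"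
    and bound: "\<And>t x. t \<in> {0..T} \<Longrightarrow> \<bar>v t x\<bar> \<le> M"
    and L1_cont: "\<And>t R. t \<in> {0..T} \<Longrightarrow> R > 0 \<Longrightarrow>
      ((\<lambda>s. integral {-R..R} (\<lambda>x. \<bar>v s x - v t x\<bar>)) \<longlongrightarrow> 0) (at t within {0..T})"
    and left: "\<And>t x. t \<in> {0<..T} \<Longrightarrow> (v t \<longlongrightarrow> v t x) (at_left x)"
begin

lemma M_nonneg: "0 \<le> M"
  using bound[of 0 0] T_pos by auto

lemma slice_abs_integrable: "t \<in> {0..T} \<Longrightarrow> v t absolutely_integrable_on {a..b}"
  by (rule measurable_bounded_by_integrable_imp_absolutely_integrable[where g="\<lambda>_. M"])
    (auto intro!: measurable_restrict_space1 slice_meas bound)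

lemma slice_integrable: "t \<in> {0..T} \<Longrightarrow> v t integrable_on {a..b}"
  using slice_abs_integrable set_lebesgue_integral_eq_integral(1) by blast

lemma slice_integral_bound:
  assumes "t \<in> {0..T}" "a \<le> b"
  shows "\<bar>integral {a..b} (v t)\<bar> \<le> M * (b - a)"
proof -
  have "norm (integral {a..b} (v t)) \<le> integral {a..b} (\<lambda>_. M)"
    using assms by (intro integral_norm_bound_integral slice_integrable) (auto simp: bound)
  then show ?thesis using assms by (simp add: mult.commute)
qed

lemma slice_integral_continuous:
  shows "continuous_on {0..T} (\<lambda>t. integral {a..b} (v t))"
  unfolding continuous_on_def
proof
  fix t assume t: "t \<in> {0..T}"
  define R where "R = \<bar>a\<bar> + \<bar>b\<bar> + 1"
  have int: "(\<lambda>x. \<bar>v s x - v t x\<bar>) integrable_on {c..d}" if "s \<in> {0..T}" for s c d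
  proof -
    have "(\<lambda>x. v s x - v t x) absolutely_integrable_on {c..d}"
      by (intro set_integral_diff slice_abs_integrable that t)
    from set_integrable_abs[OF this] show ?thesis by (rule set_lebesgue_integral_eq_integral(1))
  qed
  have "((\<lambda>s. integral {a..b} (v s) - integral {a..b} (v t)) \<longlongrightarrow> 0) (at t within {0..T})"
  proof (rule Lim_null_comparison[OF _ L1_cont[OF t, of R]])
    show "R > 0" by (simp add: R_def)
    have "norm (integral {a..b} (v s) - integral {a..b} (v t)) \<le> integral {-R..R} (\<lambda>x. \<bar>v s x - v t x\<bar>)"
      if s: "s \<in> {0..T}" for s
    proof -
      have "norm (integral {a..b} (v s) - integral {a..b} (v t)) = norm (integral {a..b} (\<lambda>x. v s x - v t x))"
        using s t by (simp add: Henstock_Kurzweil_Integration.integral_diff slice_integrable)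
      also have "\<dots> \<le> integral {a..b} (\<lambda>x. \<bar>v s x - v t x\<bar>)"
        using s t by (intro integral_norm_bound_integral int Henstock_Kurzweil_Integration.integrable_diff slice_integrable) auto
      also have "\<dots> \<le> integral {-R..R} (\<lambda>x. \<bar>v s x - v t x\<bar>)"
        using s by (intro integral_subset_le int) (auto simp: R_def)
      finally show ?thesis .
    qed
    then show "\<forall>\<^sub>F s in at t within {0..T}. norm (integral {a..b} (v s) - integral {a..b} (v t))
        \<le> integral {-R..R} (\<lambda>x. \<bar>v s x - v t x\<bar>)"
      by (auto simp: eventually_at_filter)
  qed
  then show "((\<lambda>t. integral {a..b} (v t)) \<longlongrightarrow> integral {a..b} (v t)) (at t within {0..T})"
    by (simp add: Lim_null[of _ "integral {a..b} (v t)"])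
qed

lemma lavg_slice_bound: "t \<in> {0..T} \<Longrightarrow> \<bar>lavg n (v t) x\<bar> \<le> M"
  by (rule lavg_bound[OF slice_integrable bound])

text \<open>Shifting the window of integration from \<open>x\<close> to \<open>y\<close> changes the
  integral only by two strips of length \<open>\<bar>x - y\<bar>\<close> at its ends. The constant
  depends on \<open>n\<close> but not on \<open>t\<close>, which is what joint continuity
  requires.\<close>

lemma lavg_slice_lipschitz:
  assumes t: "t \<in> {0..T}"
  shows "\<bar>lavg n (v t) x - lavg n (v t) y\<bar> \<le> (2 * real (Suc n) * M) * \<bar>x - y\<bar>"
proof -
  have *: "\<bar>lavg n (v t) x - lavg n (v t) y\<bar> \<le> (2 * real (Suc n) * M) * \<bar>x - y\<bar>" if "x \<le> y" for x y
  proof -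
    define h where "h = 1 / real (Suc n)"
    have h: "h \<ge> 0" by (simp add: h_def)
    note comb = Henstock_Kurzweil_Integration.integral_combine[OF _ _ slice_integrable[OF t]]
    have "integral {x - h..y} (v t) = integral {x - h..x} (v t) + integral {x..y} (v t)"
      "integral {x - h..y} (v t) = integral {x - h..y - h} (v t) + integral {y - h..y} (v t)"
      using comb[of "x - h" x y] comb[of "x - h" "y - h" y] h that by auto
    then have "integral {x - h..x} (v t) - integral {y - h..y} (v t)
        = integral {x - h..y - h} (v t) - integral {x..y} (v t)" by simp
    moreover have "\<bar>integral {x - h..y - h} (v t)\<bar> \<le> M * (y - x)" "\<bar>integral {x..y} (v t)\<bar> \<le> M * (y - x)"
      using slice_integral_bound[OF t, of "x - h" "y - h"] slice_integral_bound[OF t, of x y] that by auto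
    ultimately have "\<bar>integral {x - h..x} (v t) - integral {y - h..y} (v t)\<bar> \<le> 2 * M * \<bar>x - y\<bar>"
      using that by (simp add: abs_if split: if_splits)
    from mult_left_mono[OF this, of "real (Suc n)"]
    have "real (Suc n) * \<bar>integral {x - h..x} (v t) - integral {y - h..y} (v t)\<bar> \<le> (2 * real (Suc n) * M) * \<bar>x - y\<bar>"
      by (simp add: mult_ac del: of_nat_Suc)
    then show ?thesis unfolding lavg_def h_def[symmetric] right_diff_distrib[symmetric] abs_mult
      by (simp del: of_nat_Suc)
  qed
  show ?thesis using *[of x y] *[of y x] by (cases "x \<le> y") (auto simp: abs_minus_commute)
qed

lemma lavg_slice_continuous: "continuous_on ({0..T} \<times> UNIV) (\<lambda>(t, x). lavg n (v t) x)"
  by (rule continuous_on_strip[OF lavg_slice_lipschitz])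
    (auto simp: lavg_def intro!: continuous_intros slice_integral_continuous)

lemma lavg_slice_tendsto: "t \<in> {0<..T} \<Longrightarrow> (\<lambda>n. lavg n (v t) x) \<longlonglongrightarrow> v t x"
  by (rule lavg_tendsto) (auto intro: slice_integrable left)

text \<open>Joint Borel measurability comes from left continuity of the slices: away from time 0 the
  function is a pointwise limit of the jointly continuous averages.\<close>

lemma strip_borel:
  "(\<lambda>p. indicator ({0<..T} \<times> UNIV) p * v (fst p) (snd p)) \<in> borel_measurable borel"
proof (rule borel_measurable_LIMSEQ_real)
  let ?I = "indicator ({0<..T} \<times> UNIV) :: real \<times> real \<Rightarrow> real"
  let ?J = "indicator ({0..T} \<times> UNIV) :: real \<times> real \<Rightarrow> real"
  have S: "{0<..T} \<times> (UNIV :: real set) \<in> sets borel" "{0..T} \<times> (UNIV :: real set) \<in> sets borel"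
    by (auto simp: borel_prod[symmetric])
  show "(\<lambda>p. ?I p * (?J p *\<^sub>R (case p of (t, x) \<Rightarrow> lavg n (v t) x))) \<in> borel_measurable borel" for n
    using borel_measurable_continuous_on_indicator[OF S(2) lavg_slice_continuous[of n]] S(1) by measurable
  show "(\<lambda>n. ?I p * (?J p *\<^sub>R (case p of (t, x) \<Rightarrow> lavg n (v t) x))) \<longlonglongrightarrow> ?I p * v (fst p) (snd p)" for p
    by (cases p) (auto simp: indicator_def intro: lavg_slice_tendsto)
qed

text \<open>A curve is a null set of the plane, so measurability on the strip alone would not give
  this. The averages are continuous along the curve and converge there at every positive
  time.\<close>

lemma path_borel:
  assumes "continuous_on {0..T} \<gamma>"
  shows "(\<lambda>t. indicator {0<..T} t * v t (\<gamma> t)) \<in> borel_measurable borel"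
proof (rule borel_measurable_LIMSEQ_real)
  have "continuous_on {0..T} ((\<lambda>(t, x). lavg n (v t) x) \<circ> (\<lambda>t. (t, \<gamma> t)))" for n
    by (intro continuous_on_compose continuous_intros assms)
      (auto intro: continuous_on_subset[OF lavg_slice_continuous])
  from borel_measurable_continuous_on_indicator[OF _ this]
  have m: "(\<lambda>t. indicator {0..T} t * lavg n (v t) (\<gamma> t)) \<in> borel_measurable borel" for n
    by simp
  show "(\<lambda>t. indicator {0<..T} t * (indicator {0..T} t * lavg n (v t) (\<gamma> t))) \<in> borel_measurable borel" for n
    using m by measurable
  show "(\<lambda>n. indicator {0<..T} t * (indicator {0..T} t * lavg n (v t) (\<gamma> t))) \<longlonglongrightarrow> indicator {0<..T} t * v t (\<gamma> t)" for t
    by (auto simp: indicator_def intro: lavg_slice_tendsto)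
qed

lemma path_abs_integrable:
  assumes "continuous_on {0..T} \<gamma>" "{a..b} \<subseteq> {0..T}"
  shows "(\<lambda>t. v t (\<gamma> t)) absolutely_integrable_on {a..b}"
proof -
  have "(\<lambda>t. indicator {0<..T} t * v t (\<gamma> t)) absolutely_integrable_on {a..b}"
    by (rule measurable_bounded_by_integrable_imp_absolutely_integrable[where g="\<lambda>_. M"])
      (use path_borel[OF assms(1)] bound M_nonneg in
        \<open>auto intro!: measurable_restrict_space1 measurable_completion simp: indicator_def\<close>)
  then show ?thesis
    by (rule absolutely_integrable_spike[of _ _ "{0}"]) (use assms(2) in \<open>auto simp: indicator_def\<close>)
qed

lemma slice_borel: "t \<in> {0<..T} \<Longrightarrow> v t \<in> borel_measurable borel"
proof -
  assume t: "t \<in> {0<..T}"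
  have "(\<lambda>x. (t, x)) \<in> borel \<rightarrow>\<^sub>M (borel :: (real \<times> real) measure)" by simp
  from measurable_compose[OF this strip_borel] t show ?thesis by simp
qed

lemma integrable_strip_product:
  assumes \<alpha>: "\<alpha> \<in> borel_measurable borel" "\<And>t. \<bar>\<alpha> t\<bar> \<le> A" "\<And>t. t \<notin> {0<..<T} \<Longrightarrow> \<alpha> t = 0"
    and \<beta>: "\<beta> \<in> borel_measurable borel" "\<And>x. \<bar>\<beta> x\<bar> \<le> B" "\<And>x. x \<notin> {a..b} \<Longrightarrow> \<beta> x = 0"
  shows "integrable lborel (\<lambda>p. \<alpha> (fst p) * \<beta> (snd p) * v (fst p) (snd p))"
proof (rule integrable_compact_support[where K="{0..T} \<times> {a..b}" and C="A * B * M"])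
  have "(\<lambda>p. \<alpha> (fst p) * \<beta> (snd p) * (indicator ({0<..T} \<times> UNIV) p * v (fst p) (snd p))) \<in> borel_measurable borel"
    by (intro borel_measurable_times strip_borel)
      (auto intro: measurable_compose[OF _ \<alpha>(1)] measurable_compose[OF _ \<beta>(1)] simp: borel_prod[symmetric])
  also have "(\<lambda>p. \<alpha> (fst p) * \<beta> (snd p) * (indicator ({0<..T} \<times> UNIV) p * v (fst p) (snd p)))
      = (\<lambda>p. \<alpha> (fst p) * \<beta> (snd p) * v (fst p) (snd p))"
    using \<alpha>(3) by (fastforce simp: indicator_def)
  finally show "\<dots> \<in> borel_measurable borel" .
  have "0 \<le> A" "0 \<le> B" using \<alpha>(2)[of 0] \<beta>(2)[of 0] by linarith+
  then show "p \<in> {0..T} \<times> {a..b} \<Longrightarrow> \<bar>\<alpha> (fst p) * \<beta> (snd p) * v (fst p) (snd p)\<bar> \<le> A * B * M" for p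
    using \<alpha>(2) \<beta>(2) bound M_nonneg unfolding abs_mult by (intro mult_mono) auto
  show "p \<notin> {0..T} \<times> {a..b} \<Longrightarrow> \<alpha> (fst p) * \<beta> (snd p) * v (fst p) (snd p) = 0" for p
    using \<alpha>(3)[of "fst p"] \<beta>(3)[of "snd p"] by (cases p) auto
qed (auto intro: compact_Times)

lemma Fubini_strip_product:
  assumes \<alpha>: "\<alpha> \<in> borel_measurable borel" "\<And>t. \<bar>\<alpha> t\<bar> \<le> A" "\<And>t. t \<notin> {0<..<T} \<Longrightarrow> \<alpha> t = 0"
    and \<beta>: "\<beta> \<in> borel_measurable borel" "\<And>x. \<bar>\<beta> x\<bar> \<le> B" "\<And>x. x \<notin> {a..b} \<Longrightarrow> \<beta> x = 0"
  shows "(LINT p|lborel. \<alpha> (fst p) * \<beta> (snd p) * v (fst p) (snd p))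
      = (LINT t|lborel. \<alpha> t * (LINT x|lborel. \<beta> x * v t x))" (is "?I = ?I1")
    and "(LINT p|lborel. \<alpha> (fst p) * \<beta> (snd p) * v (fst p) (snd p))
      = (LINT x|lborel. \<beta> x * (LINT t|lborel. \<alpha> t * v t x))" (is "?I = ?I2")
    and "integrable lborel (\<lambda>x. \<beta> x * (LINT t|lborel. \<alpha> t * v t x))"
proof -
  note i = integrable_strip_product[OF assms, unfolded lborel_prod[symmetric]]
  have "?I = (LINT t|lborel. LINT x|lborel. \<alpha> t * \<beta> x * v t x)"
    using lborel_pair.integral_fst'[OF i] by (simp add: lborel_prod)
  also have "\<dots> = ?I1" by (simp add: mult.assoc)
  finally show "?I = ?I1" .
  have "?I = (LINT x|lborel. LINT t|lborel. \<alpha> t * \<beta> x * v t x)"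
    using lborel_pair.integral_snd[of "\<lambda>t x. \<alpha> t * \<beta> x * v t x"] i by (simp add: lborel_prod case_prod_unfold)
  also have "\<dots> = ?I2" by (simp add: mult.assoc mult.left_commute[of "\<alpha> _"])
  finally show "?I = ?I2" .
  show "integrable lborel (\<lambda>x. \<beta> x * (LINT t|lborel. \<alpha> t * v t x))"
    using lborel_pair.integrable_snd[of "\<lambda>t x. \<alpha> t * \<beta> x * v t x"] i
    by (simp add: case_prod_unfold mult.assoc mult.left_commute[of "\<alpha> _"])
qed

text \<open>Applied to the flux, this turns the spatial average of a time integral into the time
  integral of an average, whose integrand is continuous in time.\<close>

lemma integral_swap_strip:
  assumes "0 \<le> s" "s \<le> t" "t \<le> T"
  shows "integral {a..b} (\<lambda>x. integral {s..t} (\<lambda>\<tau>. v \<tau> x)) = integral {s..t} (\<lambda>\<tau>. integral {a..b} (v \<tau>))"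
proof -
  \<comment> \<open>The open interval excludes time 0, where \<open>v\<close> is only Lebesgue
    measurable; the missing endpoints do not affect the integrals.\<close>
  let ?\<alpha> = "indicator {s<..<t} :: real \<Rightarrow> real" and ?\<beta> = "indicator {a..b} :: real \<Rightarrow> real"
  have tx: "(LINT t|lborel. ?\<alpha> t * v t x) = integral {s..t} (\<lambda>\<tau>. v \<tau> x)" for x
  proof -
    have "(LINT t|lborel. ?\<alpha> t * v t x) = (LINT \<tau>:{s<..<t}|lborel. indicator {0<..T} \<tau> * v \<tau> x)"
      unfolding set_lebesgue_integral_def using assms
      by (intro Bochner_Integration.integral_cong) (auto simp: indicator_def)
    also have "\<dots> = integral {s<..<t} (\<lambda>\<tau>. indicator {0<..T} \<tau> * v \<tau> x)"
    proof (rule set_borel_integral_eq_integral(2))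
      show "set_integrable lborel {s<..<t} (\<lambda>\<tau>. indicator {0<..T} \<tau> * v \<tau> x)"
        unfolding set_integrable_def
        by (rule integrable_compact_support[where K="{s..t}" and C=M])
          (use path_borel[of "\<lambda>_. x"] bound M_nonneg in \<open>auto simp: indicator_def\<close>)
    qed
    also have "\<dots> = integral {s<..<t} (\<lambda>\<tau>. v \<tau> x)"
      using assms by (intro Henstock_Kurzweil_Integration.integral_cong) (auto simp: indicator_def)
    also have "\<dots> = integral {s..t} (\<lambda>\<tau>. v \<tau> x)"
      by (simp add: integral_open_interval_real)
    finally show ?thesis .
  qed
  have xt: "(LINT x|lborel. ?\<beta> x * v \<tau> x) = integral {a..b} (v \<tau>)" if "\<tau> \<in> {0<..T}" for \<tau>
  proof -
    have "set_integrable lborel {a..b} (v \<tau>)"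
      unfolding set_integrable_def
      by (rule integrable_compact_support[where K="{a..b}" and C=M])
        (use slice_borel[OF that] bound that M_nonneg in \<open>auto simp: indicator_def\<close>)
    from set_borel_integral_eq_integral(2)[OF this] show ?thesis
      by (simp add: set_lebesgue_integral_def)
  qed
  have cont: "continuous_on {s..t} (\<lambda>\<tau>. integral {a..b} (v \<tau>))"
    using slice_integral_continuous by (rule continuous_on_subset) (use assms in auto)

  have "(LINT x|lborel. ?\<beta> x * (LINT t|lborel. ?\<alpha> t * v t x)) = (LINT t|lborel. ?\<alpha> t * (LINT x|lborel. ?\<beta> x * v t x))"
    using assms by (subst Fubini_strip_product(1)[symmetric, where A=1 and B=1 and a=a and b=b])
      (auto simp: indicator_def intro!: Fubini_strip_product(2)[symmetric, where A=1 and B=1 and a=a and b=b])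
  also have "\<dots> = (LINT \<tau>:{s<..<t}|lborel. integral {a..b} (v \<tau>))"
    unfolding set_lebesgue_integral_def
  proof (intro Bochner_Integration.integral_cong refl)
    show "?\<alpha> \<tau> * (LINT x|lborel. ?\<beta> x * v \<tau> x) = ?\<alpha> \<tau> *\<^sub>R integral {a..b} (v \<tau>)" for \<tau>
      using xt[of \<tau>] assms by (cases "\<tau> \<in> {s<..<t}") auto
  qed
  also have "\<dots> = integral {s<..<t} (\<lambda>\<tau>. integral {a..b} (v \<tau>))"
    by (intro set_borel_integral_eq_integral(2) set_integrable_subset[OF borel_integrable_atLeastAtMost'[OF cont]]) auto
  also have "\<dots> = integral {s..t} (\<lambda>\<tau>. integral {a..b} (v \<tau>))"
    by (simp add: integral_open_interval_real)
  finally have 1: "(LINT x|lborel. ?\<beta> x * integral {s..t} (\<lambda>\<tau>. v \<tau> x)) = integral {s..t} (\<lambda>\<tau>. integral {a..b} (v \<tau>))"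
    by (simp add: tx)
  have 2: "integrable lborel (\<lambda>x. ?\<beta> x * integral {s..t} (\<lambda>\<tau>. v \<tau> x))"
    unfolding tx[symmetric] using assms
    by (intro Fubini_strip_product(3)[where A=1 and B=1 and a=a and b=b]) (auto simp: indicator_def)
  show ?thesis
    using 1 set_borel_integral_eq_integral(2)[of "{a..b}" "\<lambda>x. integral {s..t} (\<lambda>\<tau>. v \<tau> x)"] 2
    by (simp add: set_integrable_def set_lebesgue_integral_def)
qed

end

section \<open>The conservation law\<close>

lemma (in left_continuous_strip) integrable_strip_mult:
  assumes g: "g \<in> borel_measurable borel" "\<And>p. \<bar>g p\<bar> \<le> C"
    and K: "compact K" "K \<subseteq> {0<..T} \<times> UNIV" "\<And>p. p \<notin> K \<Longrightarrow> g p = 0"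
  shows "integrable lborel (\<lambda>p. g p * v (fst p) (snd p))"
proof (rule integrable_compact_support[OF _ K(1), where C="C * M"])
  have "(\<lambda>p. g p * v (fst p) (snd p)) = (\<lambda>p. g p * (indicator ({0<..T} \<times> UNIV) p * v (fst p) (snd p)))"
  proof
    fix p show "g p * v (fst p) (snd p) = g p * (indicator ({0<..T} \<times> UNIV) p * v (fst p) (snd p))"
      using K(2) K(3)[of p] by (cases "p \<in> K") auto
  qed
  also have "\<dots> \<in> borel_measurable borel"
    by (intro borel_measurable_times g strip_borel)
  finally show "(\<lambda>p. g p * v (fst p) (snd p)) \<in> borel_measurable borel" .
  have "0 \<le> C" using g(2)[of undefined] by linarith
  then show "\<bar>g p * v (fst p) (snd p)\<bar> \<le> C * M" if "p \<in> K" for p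
    unfolding abs_mult using K(2) that by (intro mult_mono g bound) auto
qed (simp add: K)

section \<open>Bounds, measurability and products of test functions\<close>

lemma bounded_compact_support:
  fixes g :: "'a::euclidean_space \<Rightarrow> real"
  assumes "compact K" "continuous_on UNIV g" "\<And>p. p \<notin> K \<Longrightarrow> g p = 0"
  obtains C where "\<And>p. \<bar>g p\<bar> \<le> C"
proof -
  have "bounded (g ` K)"
    using assms by (intro compact_imp_bounded compact_continuous_image) (auto elim: continuous_on_subset)
  then obtain C where C: "\<And>p. p \<in> K \<Longrightarrow> \<bar>g p\<bar> \<le> C"
    unfolding bounded_iff by (metis imageI real_norm_def)
  have "\<bar>g p\<bar> \<le> max C 0" for p
    using C[of p] assms(3)[of p] by (cases "p \<in> K") auto
  then show thesis by (rule that)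
qed

lemma C1c_derivative_bounded:
  assumes "C1c_on \<Omega> \<phi>"
  obtains C where "\<And>p. \<bar>frechet_derivative \<phi> (at p) v\<bar> \<le> C"
proof -
  obtain K where K: "compact K" "\<And>p. p \<notin> K \<Longrightarrow> frechet_derivative \<phi> (at p) v = 0"
    using C1c_on_support[OF assms] by metis
  show thesis by (rule bounded_compact_support[OF K(1) C1c_on_continuous_derivative[OF assms] K(2) that])
qed

lemma C1c_bounded:
  assumes "C1c_on \<Omega> \<phi>"
  obtains C where "\<And>p. \<bar>\<phi> p\<bar> \<le> C"
proof -
  obtain K where K: "compact K" "\<And>p. p \<notin> K \<Longrightarrow> \<phi> p = 0"
    using C1c_on_support[OF assms] by metis
  show thesis by (rule bounded_compact_support[OF K(1) C1c_on_continuous[OF assms] K(2) that])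
qed

lemma C1c_on_borel: "C1c_on \<Omega> \<phi> \<Longrightarrow> \<phi> \<in> borel_measurable borel"
  by (intro borel_measurable_continuous_onI C1c_on_continuous)

lemma C1c_on_derivative_borel: "C1c_on \<Omega> \<phi> \<Longrightarrow> (\<lambda>p. frechet_derivative \<phi> (at p) v) \<in> borel_measurable borel"
  by (intro borel_measurable_continuous_onI C1c_on_continuous_derivative)

lemma C1c_product:
  assumes \<alpha>: "C1c_on A \<alpha>" and \<beta>: "C1c_on B \<beta>" and "open A" "open B"
  defines "\<phi> \<equiv> \<lambda>p :: real \<times> real. \<alpha> (fst p) * \<beta> (snd p)"
  shows "C1c_on (A \<times> B) \<phi>"
    and "frechet_derivative \<phi> (at (t, x)) (1, 0) = frechet_derivative \<alpha> (at t) 1 * \<beta> x"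
    and "frechet_derivative \<phi> (at (t, x)) (0, 1) = \<alpha> t * frechet_derivative \<beta> (at x) 1"
proof -
  let ?\<alpha>' = "\<lambda>t. frechet_derivative \<alpha> (at t)" and ?\<beta>' = "\<lambda>x. frechet_derivative \<beta> (at x)"
  have der: "(\<phi> has_derivative (\<lambda>h. \<alpha> (fst p) * ?\<beta>' (snd p) (snd h) + ?\<alpha>' (fst p) (fst h) * \<beta> (snd p))) (at p)" for p
    unfolding \<phi>_def
    by (intro has_derivative_mult has_derivative_compose[OF has_derivative_fst[OF has_derivative_ident] C1c_on_has_derivative[OF \<alpha>]]
        has_derivative_compose[OF has_derivative_snd[OF has_derivative_ident] C1c_on_has_derivative[OF \<beta>]])
  obtain K where K: "compact K" "K \<subseteq> A" "\<And>p. p \<notin> K \<Longrightarrow> \<alpha> p = 0" using C1c_on_support[OF \<alpha>] by metis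
  obtain L where L: "compact L" "L \<subseteq> B" "\<And>p. p \<notin> L \<Longrightarrow> \<beta> p = 0" using C1c_on_support[OF \<beta>] by metis
  show "C1c_on (A \<times> B) \<phi>"
  proof (rule C1c_onI[OF _ _ _ der])
    show "open (A \<times> B)" "compact (K \<times> L)" "K \<times> L \<subseteq> A \<times> B"
      using K L assms by (auto intro: open_Times compact_Times)
    show "\<phi> p = 0" if "p \<notin> K \<times> L" for p
      using that K(3) L(3) by (cases p) (auto simp: \<phi>_def)
    show "continuous_on (A \<times> B) (\<lambda>p. \<alpha> (fst p) * ?\<beta>' (snd p) (snd v) + ?\<alpha>' (fst p) (fst v) * \<beta> (snd p))" for v
      by (intro continuous_intros continuous_on_compose2[OF C1c_on_continuous[OF \<alpha>]]
          continuous_on_compose2[OF C1c_on_continuous[OF \<beta>]]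
          continuous_on_compose2[OF C1c_on_continuous_derivative[OF \<alpha>]]
          continuous_on_compose2[OF C1c_on_continuous_derivative[OF \<beta>]]) auto
  qed
  have z: "?\<alpha>' t 0 = 0" "?\<beta>' x 0 = 0"
    using C1c_on_has_derivative[OF \<alpha>] C1c_on_has_derivative[OF \<beta>] has_derivative_linear linear_0 by blast+
  show "frechet_derivative \<phi> (at (t, x)) (1, 0) = ?\<alpha>' t 1 * \<beta> x"
    "frechet_derivative \<phi> (at (t, x)) (0, 1) = \<alpha> t * ?\<beta>' x 1"
    by (simp_all add: frechet_derivative_at[OF der, symmetric] z)
qed

lemma integral_left_kernel: "(LINT x|lborel. left_kernel n a x) = 1"
proof -
  have "(LINT x|lborel. tent x) = real (Suc n) * (LINT x|lborel. tent ((1 - real (Suc n) * a) + real (Suc n) * x))"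
    using lborel_integral_real_affine[of "real (Suc n)" tent "1 - real (Suc n) * a"] by (simp del: of_nat_Suc)
  also have "\<dots> = (LINT x|lborel. left_kernel n a x)"
    by (simp add: left_kernel_def algebra_simps del: of_nat_Suc)
  finally show ?thesis by (simp add: integral_tent)
qed

locale entropy_strip =
  u: left_continuous_strip T M u + flux: left_continuous_strip T M "\<lambda>t x. f (u t x)"
  for T M :: real and u :: "real \<Rightarrow> real \<Rightarrow> real" and f :: "real \<Rightarrow> real" +
  assumes entropy: "\<And>k \<phi>. C1c_on ({0<..<T} \<times> UNIV) \<phi> \<Longrightarrow> (\<And>p. \<phi> p \<ge> 0) \<Longrightarrow>
        (LINT p:{0<..<T} \<times> UNIV|lebesgue.
            \<bar>u (fst p) (snd p) - k\<bar> * frechet_derivative \<phi> (at p) (1, 0)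
            + sgn (u (fst p) (snd p) - k) * (f (u (fst p) (snd p)) - f k)
                * frechet_derivative \<phi> (at p) (0, 1)) \<ge> 0"
begin

abbreviation "\<Omega> \<equiv> {0<..<T} \<times> (UNIV :: real set)"

lemma open_\<Omega>: "open \<Omega>"
  by (intro open_Times) auto

lemma integrable_weak:
  assumes \<phi>: "C1c_on \<Omega> \<phi>"
  shows "integrable lborel (\<lambda>p. frechet_derivative \<phi> (at p) w * u (fst p) (snd p))"
    and "integrable lborel (\<lambda>p. frechet_derivative \<phi> (at p) w * f (u (fst p) (snd p)))"
    and "integrable lborel (\<lambda>p. frechet_derivative \<phi> (at p) w)"
proof -
  obtain K where K: "compact K" "K \<subseteq> \<Omega>" "\<And>p v. p \<notin> K \<Longrightarrow> frechet_derivative \<phi> (at p) v = 0"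
    using C1c_on_support[OF \<phi>] by metis
  obtain C where C: "\<And>p. \<bar>frechet_derivative \<phi> (at p) w\<bar> \<le> C"
    using C1c_derivative_bounded[OF \<phi>] by metis
  have K': "K \<subseteq> {0<..T} \<times> UNIV" using K(2) by auto
  show "integrable lborel (\<lambda>p. frechet_derivative \<phi> (at p) w * u (fst p) (snd p))"
    by (rule u.integrable_strip_mult[OF C1c_on_derivative_borel[OF \<phi>] C K(1) K' K(3)])
  show "integrable lborel (\<lambda>p. frechet_derivative \<phi> (at p) w * f (u (fst p) (snd p)))"
    by (rule flux.integrable_strip_mult[OF C1c_on_derivative_borel[OF \<phi>] C K(1) K' K(3)])
  show "integrable lborel (\<lambda>p. frechet_derivative \<phi> (at p) w)"
    by (rule integrable_compact_support[OF C1c_on_derivative_borel[OF \<phi>] K(1) C K(3)])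
qed

lemma integral_derivative_\<Omega>:
  assumes \<phi>: "C1c_on \<Omega> \<phi>"
  shows "(LINT p|lborel. frechet_derivative \<phi> (at p) w) = 0"
proof -
  obtain K where K: "K \<subseteq> \<Omega>" "\<And>p v. p \<notin> K \<Longrightarrow> frechet_derivative \<phi> (at p) v = 0"
    using C1c_on_support[OF \<phi>] by metis
  have "frechet_derivative \<phi> (at p) w = 0" if "p \<notin> \<Omega>" for p
    using K(2)[of p w] K(1) that by (metis subsetD)
  from set_integral_lebesgue_eq_lborel[OF C1c_on_derivative_borel[OF \<phi>] this]
  show ?thesis using integral_derivative_C1c[OF \<phi>, of w] by simp
qed

text \<open>The constants \<open>k = \<plusminus>(M + 1)\<close> lie outside the range of \<open>u\<close>, so that the two entropy
  inequalities become the two halves of the weak formulation.\<close>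

lemma weak_formulation:
  assumes \<phi>: "C1c_on \<Omega> \<phi>" "\<And>p. \<phi> p \<ge> 0"
  shows "(LINT p|lborel. frechet_derivative \<phi> (at p) (1, 0) * u (fst p) (snd p)
      + frechet_derivative \<phi> (at p) (0, 1) * f (u (fst p) (snd p))) = 0"
proof -
  let ?t = "\<lambda>p. frechet_derivative \<phi> (at p) (1, 0)" and ?x = "\<lambda>p. frechet_derivative \<phi> (at p) (0, 1)"
  let ?I = "LINT p|lborel. ?t p * u (fst p) (snd p) + ?x p * f (u (fst p) (snd p))"
  obtain K where K: "K \<subseteq> \<Omega>" "\<And>p v. p \<notin> K \<Longrightarrow> frechet_derivative \<phi> (at p) v = 0"
    using C1c_on_support[OF \<phi>(1)] by metis
  note i = integrable_weak[OF \<phi>(1)]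
  note iv = integral_derivative_\<Omega>[OF \<phi>(1)]
  have key: "0 \<le> - \<sigma> * ?I" if k: "\<bar>k\<bar> = M + 1" "\<sigma> = sgn k" "\<bar>\<sigma>\<bar> = 1" for k \<sigma>
  proof -
    let ?e = "\<lambda>p. \<sigma> * (k * ?t p + f k * ?x p - (?t p * u (fst p) (snd p) + ?x p * f (u (fst p) (snd p))))"
    have "(LINT p:\<Omega>|lebesgue. \<bar>u (fst p) (snd p) - k\<bar> * ?t p
        + sgn (u (fst p) (snd p) - k) * (f (u (fst p) (snd p)) - f k) * ?x p) = (LINT p:\<Omega>|lebesgue. ?e p)"
      unfolding set_lebesgue_integral_def
    proof (intro Bochner_Integration.integral_cong refl)
      fix p
      show "indicator \<Omega> p *\<^sub>R (\<bar>u (fst p) (snd p) - k\<bar> * ?t p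
          + sgn (u (fst p) (snd p) - k) * (f (u (fst p) (snd p)) - f k) * ?x p) = indicator \<Omega> p *\<^sub>R ?e p"
      proof (cases "p \<in> \<Omega>")
        case True
        then have "\<bar>u (fst p) (snd p)\<bar> \<le> M" by (intro u.bound) auto
        then have "\<bar>u (fst p) (snd p) - k\<bar> = \<sigma> * (k - u (fst p) (snd p))" "sgn (u (fst p) (snd p) - k) = - \<sigma>"
          using k by (auto simp: sgn_if abs_if split: if_splits)
        note eq = this
        show ?thesis unfolding eq by (simp add: algebra_simps)
      qed simp
    qed
    also have "\<dots> = (LINT p|lborel. ?e p)"
    proof (rule set_integral_lebesgue_eq_lborel)
      have "integrable lborel ?e"
        by (intro integrable_mult_right Bochner_Integration.integrable_diff Bochner_Integration.integrable_add i)
      from borel_measurable_integrable[OF this]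
      show "?e \<in> borel_measurable borel" by (simp only: measurable_lborel2)
      show "?e p = 0" if "p \<notin> \<Omega>" for p
      proof -
        have "p \<notin> K" using K(1) that by blast
        then show ?thesis by (simp add: K(2))
      qed
    qed
    also have "\<dots> = - \<sigma> * ?I"
      using i iv by simp (simp add: distrib_left right_diff_distrib)
    finally show ?thesis using entropy[OF \<phi>, of k] by simp
  qed
  have M: "\<bar>M + 1\<bar> = M + 1" "\<bar>- (M + 1)\<bar> = M + 1" "1 = sgn (M + 1)" "- 1 = sgn (- (M + 1))"
    using u.M_nonneg by (auto simp: sgn_if)
  have "0 \<le> - 1 * ?I" "0 \<le> - (- 1) * ?I"
    by (rule key[OF M(1,3)], simp, rule key[OF M(2,4)], simp)
  then show ?thesis by linarith
qed

text \<open>The test functions \<open>\<alpha> t * bump n a b x\<close> turn, in the limit, into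
  \<open>\<alpha>\<close> times the indicator of \<open>{a..<b}\<close>, while their
  \<open>x\<close>-derivatives produce the left values of the flux at \<open>a\<close> and
  \<open>b\<close>. Left continuity yields the identity for all \<open>a\<close> and
  \<open>b\<close>, not just for almost all of them.\<close>

lemma weak_balance:
  assumes \<alpha>: "C1c_on {0<..<T} \<alpha>" "\<And>t. \<alpha> t \<ge> 0" and ab: "a \<le> b"
  shows "(LINT t:{0<..<T}|lebesgue. integral {a..b} (u t) * frechet_derivative \<alpha> (at t) 1)
      = - (LINT t:{0<..<T}|lebesgue. (f (u t a) - f (u t b)) * \<alpha> t)"
proof -
  let ?\<alpha>' = "\<lambda>t. frechet_derivative \<alpha> (at t) 1"
  let ?b = "\<lambda>n. bump n a b" and ?b' = "\<lambda>n x. left_kernel n a x - left_kernel n b x"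
  obtain K where K: "compact K" "K \<subseteq> {0<..<T}" "\<And>p. p \<notin> K \<Longrightarrow> \<alpha> p = 0" "\<And>p v. p \<notin> K \<Longrightarrow> frechet_derivative \<alpha> (at p) v = 0"
    using C1c_on_support[OF \<alpha>(1)] by metis
  obtain C' where C': "\<And>t. \<bar>?\<alpha>' t\<bar> \<le> C'" using C1c_derivative_bounded[OF \<alpha>(1)] by metis
  obtain C where C: "\<And>t. \<bar>\<alpha> t\<bar> \<le> C" using C1c_bounded[OF \<alpha>(1)] by metis
  have \<alpha>z: "\<alpha> t = 0" "?\<alpha>' t = 0" if "t \<notin> {0<..<T}" for t using K that by blast+
  note \<alpha>m = C1c_on_borel[OF \<alpha>(1)] and \<alpha>'m = C1c_on_derivative_borel[OF \<alpha>(1), of 1]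
  have \<beta>: "C1c_on UNIV (?b n)" "frechet_derivative (?b n) (at x) 1 = ?b' n x" for n x
    using C1c_bump[OF ab] frechet_derivative_bump by auto
  \<comment> \<open>All transition layers have width at most 1, so one window contains the supports
    for every \<open>n\<close>.\<close>
  have z: "?b n x = 0" "?b' n x = 0" if "x \<notin> {a - 1..b}" for n x
  proof -
    have "1 / real (Suc n) \<le> 1" by simp
    then have "x \<notin> {a - 1 / real (Suc n)..b}" "x \<notin> {a - 1 / real (Suc n)..a}" "x \<notin> {b - 1 / real (Suc n)..b}"
      using that ab unfolding atLeastAtMost_iff by linarith+
    then show "?b n x = 0" "?b' n x = 0" using bump_eq_0 left_kernel_eq_0 ab by auto
  qed
  have b'C: "\<bar>?b' n x\<bar> \<le> 2 * real (Suc n)" for n x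
    using left_kernel_nonneg[of n a x] left_kernel_nonneg[of n b x] left_kernel_le[of n a x] left_kernel_le[of n b x]
    by linarith
  have b'm: "?b' n \<in> borel_measurable borel" for n by measurable
  define A where "A n t = (LINT x|lborel. ?b n x * u t x)" for n t
  define B where "B n t = (LINT x|lborel. ?b' n x * f (u t x))" for n t
  \<comment> \<open>The weak formulation after integration in \<open>x\<close>: its integral over
    time is zero for each \<open>n\<close>, so that only the limit in \<open>n\<close> under the
    time integral remains.\<close>
  define h where "h n t = ?\<alpha>' t * A n t + \<alpha> t * B n t" for n t
  have int_h: "integrable lborel (\<lambda>t. ?\<alpha>' t * A n t)" "integrable lborel (\<lambda>t. \<alpha> t * B n t)" for n
  proof -
    have "integrable lborel (\<lambda>p. ?\<alpha>' (fst p) * ?b n (snd p) * u (fst p) (snd p))"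
      by (rule u.integrable_strip_product[OF \<alpha>'m C' \<alpha>z(2) bump_borel bump_le z(1)])
    from lborel_pair.integrable_fst'[OF this[unfolded lborel_prod[symmetric]]]
    show "integrable lborel (\<lambda>t. ?\<alpha>' t * A n t)" by (simp add: A_def mult.assoc)
    have "integrable lborel (\<lambda>p. \<alpha> (fst p) * ?b' n (snd p) * f (u (fst p) (snd p)))"
      by (rule flux.integrable_strip_product[OF \<alpha>m C \<alpha>z(1) b'm b'C z(2)])
    from lborel_pair.integrable_fst'[OF this[unfolded lborel_prod[symmetric]]]
    show "integrable lborel (\<lambda>t. \<alpha> t * B n t)" by (simp add: B_def mult.assoc)
  qed
  have h0: "(LINT t|lborel. h n t) = 0" for n
  proof -
    let ?\<phi> = "\<lambda>p. \<alpha> (fst p) * ?b n (snd p)"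
    have \<phi>: "C1c_on \<Omega> ?\<phi>" using C1c_product(1)[OF \<alpha>(1) \<beta>(1)] by simp
    have D: "frechet_derivative ?\<phi> (at p) (1, 0) = ?\<alpha>' (fst p) * ?b n (snd p)"
      "frechet_derivative ?\<phi> (at p) (0, 1) = \<alpha> (fst p) * ?b' n (snd p)" for p
      using C1c_product(2,3)[OF \<alpha>(1) \<beta>(1)[of n], of "fst p" "snd p"] \<beta>(2) by auto
    have "0 = (LINT p|lborel. ?\<alpha>' (fst p) * ?b n (snd p) * u (fst p) (snd p))
        + (LINT p|lborel. \<alpha> (fst p) * ?b' n (snd p) * f (u (fst p) (snd p)))"
      using weak_formulation[OF \<phi>, unfolded D] \<alpha>(2) bump_nonneg[OF ab]
        integrable_weak(1)[OF \<phi>, of "(1, 0)", unfolded D] integrable_weak(2)[OF \<phi>, of "(0, 1)", unfolded D]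
      by simp
    also have "(LINT p|lborel. ?\<alpha>' (fst p) * ?b n (snd p) * u (fst p) (snd p)) = (LINT t|lborel. ?\<alpha>' t * A n t)"
      unfolding A_def by (rule u.Fubini_strip_product(1)[OF \<alpha>'m C' \<alpha>z(2) bump_borel bump_le z(1)])
    also have "(LINT p|lborel. \<alpha> (fst p) * ?b' n (snd p) * f (u (fst p) (snd p))) = (LINT t|lborel. \<alpha> t * B n t)"
      unfolding B_def by (rule flux.Fubini_strip_product(1)[OF \<alpha>m C \<alpha>z(1) b'm b'C z(2)])
    finally show ?thesis unfolding h_def using int_h by simp
  qed
  have A_lim: "(\<lambda>n. A n t) \<longlonglongrightarrow> integral {a..b} (u t)" and A_bd: "\<bar>A n t\<bar> \<le> M * (b - a + 1)"
    if t: "t \<in> {0<..<T}" for t n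
  proof -
    have um: "u t \<in> borel_measurable borel" using u.slice_borel t by simp
    have ub: "\<bar>u t x\<bar> \<le> M" for x using u.bound t by simp
    have w: "integrable lborel (\<lambda>x. M * indicator {a - 1..b} x)"
      by (rule integrable_indicator_compact) simp
    have dom: "norm (?b n x * u t x) \<le> M * indicator {a - 1..b} x" for n x
      using z(1)[of x n] mult_mono[OF bump_le[of n a b x] ub[of x]] by (cases "x \<in> {a - 1..b}") (auto simp: abs_mult)
    have "(\<lambda>n. A n t) \<longlonglongrightarrow> (LINT x|lborel. indicator {a..<b} x * u t x)"
      unfolding A_def
      by (rule integral_dominated_convergence[OF _ _ w])
        (use um dom in \<open>auto intro!: tendsto_intros bump_tendsto ab\<close>)
    also have "(LINT x|lborel. indicator {a..<b} x * u t x) = (LINT x:{a..<b}|lborel. u t x)"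
      by (simp add: set_lebesgue_integral_def)
    also have "\<dots> = integral {a..<b} (u t)"
    proof (rule set_borel_integral_eq_integral(2))
      show "set_integrable lborel {a..<b} (u t)"
        unfolding set_integrable_def
        by (rule integrable_compact_support[where K="{a..b}" and C=M])
          (use um ub u.M_nonneg in \<open>auto simp: indicator_def\<close>)
    qed
    also have "\<dots> = integral {a..b} (u t)"
      by (rule integral_spike_set; rule negligible_subset[of "{b}"]; auto)
    finally show "(\<lambda>n. A n t) \<longlonglongrightarrow> integral {a..b} (u t)" .
    have "norm (A n t) \<le> (LINT x|lborel. M * indicator {a - 1..b} x)"
      unfolding A_def
    proof (rule Bochner_Integration.integral_norm_bound_integral[OF _ w dom])
      show "integrable lborel (\<lambda>x. ?b n x * u t x)"
        by (rule Bochner_Integration.integrable_bound[OF w])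
          (use um in \<open>auto intro!: AE_I2 order_trans[OF dom[unfolded real_norm_def] abs_ge_self]\<close>)
    qed
    also have "\<dots> = M * (b - a + 1)" using ab by simp
    finally show "\<bar>A n t\<bar> \<le> M * (b - a + 1)" by simp
  qed
  \<comment> \<open>The pointwise bound \<open>b'C\<close> grows with \<open>n\<close> and only
    provides integrability. The uniform bound \<open>2 * M\<close> comes from the unit mass of each
    of the two kernels.\<close>
  have B_lim: "(\<lambda>n. B n t) \<longlonglongrightarrow> f (u t a) - f (u t b)" and B_bd: "\<bar>B n t\<bar> \<le> 2 * M"
    if t: "t \<in> {0<..<T}" for t n
  proof -
    have fm: "(\<lambda>x. f (u t x)) \<in> borel_measurable borel" using flux.slice_borel t by simp
    have fb: "\<bar>f (u t x)\<bar> \<le> M" for x using flux.bound t by simp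
    have ki: "integrable lborel (\<lambda>x. left_kernel n c x * f (u t x))" for n c
      by (rule integrable_compact_support[where K="{c - 1 / real (Suc n)..c}" and C="2 * real (Suc n) * M"])
        (use fm left_kernel_eq_0 left_kernel_le left_kernel_nonneg fb u.M_nonneg in \<open>auto simp: abs_mult intro!: mult_mono\<close>)
    have B: "B n t = (LINT x|lborel. left_kernel n a x * f (u t x)) - (LINT x|lborel. left_kernel n b x * f (u t x))" for n
      unfolding B_def left_diff_distrib using ki by simp
    show "(\<lambda>n. B n t) \<longlonglongrightarrow> f (u t a) - f (u t b)"
      unfolding B using t
      by (intro tendsto_diff left_kernel_tendsto[OF fm fb] flux.left) auto
    have "\<bar>LINT x|lborel. left_kernel n c x * f (u t x)\<bar> \<le> M" for c
    proof -
      have kk: "integrable lborel (left_kernel n c)"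
        by (rule integrable_compact_support[where K="{c - 1 / real (Suc n)..c}" and C="2 * real (Suc n)"])
          (use left_kernel_eq_0 left_kernel_le left_kernel_nonneg in auto)
      have "norm (LINT x|lborel. left_kernel n c x * f (u t x)) \<le> (LINT x|lborel. M * left_kernel n c x)"
      proof (rule Bochner_Integration.integral_norm_bound_integral[OF ki])
        show "norm (left_kernel n c x * f (u t x)) \<le> M * left_kernel n c x" for x
          using mult_left_mono[OF fb[of x] left_kernel_nonneg[of n c x]]
          by (simp add: abs_mult left_kernel_nonneg mult.commute)
      qed (use kk in simp)
      also have "\<dots> = M" by (simp add: integral_left_kernel)
      finally show ?thesis by simp
    qed
    from this[of a] this[of b] show "\<bar>B n t\<bar> \<le> 2 * M" unfolding B by linarith
  qed
  define G where "G t = ?\<alpha>' t * integral {a..b} (u t) + \<alpha> t * (f (u t a) - f (u t b))" for t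
  have h_lim: "(\<lambda>n. h n t) \<longlonglongrightarrow> G t" for t
    unfolding h_def G_def using A_lim[of t] B_lim[of t] \<alpha>z[of t]
    by (cases "t \<in> {0<..<T}") (auto intro!: tendsto_intros)
  have hm: "h n \<in> borel_measurable borel" for n
    using int_h[of n] unfolding h_def[abs_def] by (intro borel_measurable_add) auto
  have Gm: "G \<in> borel_measurable borel"
    by (rule borel_measurable_LIMSEQ_real[OF h_lim hm])
  have dom: "\<bar>h n t\<bar> \<le> (C' * (M * (b - a + 1)) + C * (2 * M)) * indicator {0..T} t" for n t
  proof (cases "t \<in> {0<..<T}")
    case True
    have "\<bar>h n t\<bar> \<le> \<bar>?\<alpha>' t\<bar> * \<bar>A n t\<bar> + \<bar>\<alpha> t\<bar> * \<bar>B n t\<bar>"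
      unfolding h_def abs_mult[symmetric] by (rule abs_triangle_ineq)
    also have "\<dots> \<le> C' * (M * (b - a + 1)) + C * (2 * M)"
      using C'[of t] C[of t] A_bd[OF True, of n] B_bd[OF True, of n] by (intro add_mono mult_mono) auto
    finally show ?thesis using True by simp
  next
    case False
    have "0 \<le> C'" "0 \<le> C" using C'[of 0] C[of 0] by linarith+
    then show ?thesis using False \<alpha>z[of t] u.M_nonneg ab by (simp add: h_def)
  qed
  have w: "integrable lborel (\<lambda>t. (C' * (M * (b - a + 1)) + C * (2 * M)) * indicator {0..T} t)"
    by (rule integrable_indicator_compact) simp
  have "(\<lambda>n. LINT t|lborel. h n t) \<longlonglongrightarrow> (LINT t|lborel. G t)"
    by (rule integral_dominated_convergence[OF _ _ w]) (use Gm hm dom h_lim in auto)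
  then have G0: "(LINT t|lborel. G t) = 0" by (simp add: h0 LIMSEQ_const_iff)
  have G_on: "set_integrable lebesgue {0<..<T} (\<lambda>t. (f (u t a) - f (u t b)) * \<alpha> t)"
  proof -
    have "(\<lambda>t. f (u t a) - f (u t b)) absolutely_integrable_on {0..T}"
      by (intro set_integral_diff flux.path_abs_integrable) auto
    then have "set_integrable lebesgue {0<..<T} (\<lambda>t. f (u t a) - f (u t b))"
      by (rule set_integrable_subset) auto
    then have i: "integrable lebesgue (\<lambda>t. indicator {0<..<T} t *\<^sub>R (f (u t a) - f (u t b)))" (is "integrable lebesgue ?g")
      by (simp add: set_integrable_def)
    have "integrable lebesgue (\<lambda>t. \<alpha> t * ?g t)"
    proof (rule Bochner_Integration.integrable_bound[OF integrable_mult_right[OF i, of C]])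
      show "(\<lambda>t. \<alpha> t * ?g t) \<in> borel_measurable lebesgue"
        by (rule borel_measurable_times[OF measurable_completion borel_measurable_integrable[OF i]]) (use \<alpha>m in simp)
      show "AE t in lebesgue. norm (\<alpha> t * ?g t) \<le> norm (C * ?g t)"
        using C by (intro AE_I2) (auto simp: abs_mult intro!: mult_right_mono order_trans[OF C])
    qed
    then show ?thesis by (simp add: set_integrable_def mult_ac)
  qed
  have J_on: "set_integrable lebesgue {0<..<T} (\<lambda>t. integral {a..b} (u t) * ?\<alpha>' t)"
  proof -
    have "set_integrable lebesgue {0..T} (\<lambda>t. integral {a..b} (u t) * ?\<alpha>' t)"
      by (intro absolutely_integrable_continuous_real continuous_intros u.slice_integral_continuous
          continuous_on_subset[OF C1c_on_continuous_derivative[OF \<alpha>(1)]]) auto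
    then show ?thesis by (rule set_integrable_subset) auto
  qed
  have "(LINT t:{0<..<T}|lebesgue. integral {a..b} (u t) * ?\<alpha>' t) + (LINT t:{0<..<T}|lebesgue. (f (u t a) - f (u t b)) * \<alpha> t)
      = (LINT t:{0<..<T}|lebesgue. G t)"
    using set_integral_add(2)[OF J_on G_on] by (simp add: G_def mult_ac)
  also have "\<dots> = (LINT t|lborel. G t)"
    by (rule set_integral_lebesgue_eq_lborel[OF Gm]) (auto simp: G_def \<alpha>z)
  finally show ?thesis using G0 by simp
qed

end

lemma lavg_has_real_derivative:
  assumes g: "continuous_on UNIV g"
  shows "(lavg n g has_real_derivative real (Suc n) * (g x - g (x - 1 / real (Suc n)))) (at x)"
proof -
  define h where "h = 1 / real (Suc n)"
  have h: "0 \<le> h" by (simp add: h_def)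
  \<comment> \<open>A base point left of \<open>y - h\<close> for all \<open>y\<close> near
    \<open>x\<close>, so that the mean is a difference of two primitives with a common lower
    limit.\<close>
  define a where "a = x - h - 1"
  have gi: "g integrable_on {c..d}" for c d
    by (intro integrable_continuous_real continuous_on_subset[OF g]) auto
  have I: "((\<lambda>y. integral {a..y} g) has_real_derivative g z) (at z)" if "a < z" for z
    using integral_has_real_derivative[OF continuous_on_subset[OF g], of a "z + 1" z] that
    by (simp add: at_within_Icc_at)
  have "((\<lambda>y. integral {a..y} g - integral {a..y - h} g) has_real_derivative g x - g (x - h)) (at x)"
  proof (rule DERIV_diff)
    show "((\<lambda>y. integral {a..y} g) has_real_derivative g x) (at x)"
      using h by (intro I) (simp add: a_def)
    have "((\<lambda>y. integral {a..y} g) has_real_derivative g (x - h)) (at (x - h))"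
      by (intro I) (simp add: a_def)
    moreover have "((\<lambda>y. y - h) has_real_derivative 1) (at x)"
      by (auto intro!: derivative_eq_intros)
    ultimately show "((\<lambda>y. integral {a..y - h} g) has_real_derivative g (x - h)) (at x)"
      using DERIV_chain2[where g="\<lambda>y. y - h" and Db=1] by fastforce
  qed
  then have "((\<lambda>y. real (Suc n) * (integral {a..y} g - integral {a..y - h} g))
      has_real_derivative real (Suc n) * (g x - g (x - h))) (at x)"
    by (rule DERIV_cmult)
  then show ?thesis unfolding h_def[symmetric]
  proof (rule has_field_derivative_transform_within_open[of _ _ _ "{x - 1<..}"])
    show "real (Suc n) * (integral {a..y} g - integral {a..y - h} g) = lavg n g y" if "y \<in> {x - 1<..}" for y
      using Henstock_Kurzweil_Integration.integral_combine[OF _ _ gi, of a "y - h" y] h that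
      by (simp add: lavg_def h_def[symmetric] a_def del: of_nat_Suc)
  qed auto
qed

context entropy_strip
begin

text \<open>By \<open>weak_balance\<close> the mass between \<open>a\<close> and \<open>b\<close>
  has the flux difference as weak time derivative. It is continuous in time by the L^1 continuity of
  the slices, hence the identity reaches the times 0 and \<open>T\<close>.\<close>

lemma balance:
  assumes "0 \<le> s" "s \<le> t" "t \<le> T" "a \<le> b"
  shows "integral {a..b} (u t) - integral {a..b} (u s)
      = integral {s..t} (\<lambda>\<tau>. f (u \<tau> a)) - integral {s..t} (\<lambda>\<tau>. f (u \<tau> b))"
proof -
  have ai: "(\<lambda>\<tau>. f (u \<tau> x)) absolutely_integrable_on {c..d}" if "{c..d} \<subseteq> {0..T}" for x c d
    by (intro flux.path_abs_integrable that) auto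
  have "set_integrable lebesgue {0<..<T} (\<lambda>\<tau>. f (u \<tau> a) - f (u \<tau> b))"
    by (rule set_integrable_subset[OF set_integral_diff(1)[OF ai ai], of 0 T]) auto
  from weak_derivative_imp_integral[OF u.slice_integral_continuous this weak_balance[OF _ _ assms(4)] assms(1-3)]
  have "integral {a..b} (u t) - integral {a..b} (u s) = integral {s..t} (\<lambda>\<tau>. f (u \<tau> a) - f (u \<tau> b))" .
  also have "\<dots> = integral {s..t} (\<lambda>\<tau>. f (u \<tau> a)) - integral {s..t} (\<lambda>\<tau>. f (u \<tau> b))"
    using assms by (intro Henstock_Kurzweil_Integration.integral_diff set_lebesgue_integral_eq_integral(1) ai) auto
  finally show ?thesis .
qed

section \<open>The potential and its differentiable averages\<close>

definition W :: "real \<Rightarrow> real \<Rightarrow> real" where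
  "W t x = (if 0 \<le> x then integral {0..x} (u t) else - integral {x..0} (u t)) - integral {0..t} (\<lambda>\<tau>. f (u \<tau> 0))"

lemma W_space:
  assumes t: "t \<in> {0..T}" and "x \<le> y"
  shows "W t y - W t x = integral {x..y} (u t)"
proof -
  note c = Henstock_Kurzweil_Integration.integral_combine[OF _ _ u.slice_integrable[OF t]]
  consider "0 \<le> x" | "x < 0" "0 \<le> y" | "x < 0" "y < 0" using assms by linarith
  then show ?thesis
  proof cases
    case 1 then show ?thesis using c[of 0 x y] assms by (simp add: W_def)
  next
    case 2 then show ?thesis using c[of x 0 y] assms by (simp add: W_def)
  next
    case 3 then show ?thesis using c[of x y 0] assms by (simp add: W_def)
  qed
qed

lemma flux_integrable: "{a..b} \<subseteq> {0..T} \<Longrightarrow> (\<lambda>\<tau>. f (u \<tau> x)) integrable_on {a..b}"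
  by (intro set_lebesgue_integral_eq_integral(1) flux.path_abs_integrable) auto

text \<open>Moving the foot of the potential from 0 to \<open>x\<close> exchanges the flux at 0 for
  the flux at \<open>x\<close>; this is \<open>balance\<close> on \<open>[0, x]\<close> or
  \<open>[x, 0]\<close>, according to the sign of \<open>x\<close>.\<close>

lemma W_time:
  assumes "0 \<le> s" "s \<le> t" "t \<le> T"
  shows "W t x - W s x = - integral {s..t} (\<lambda>\<tau>. f (u \<tau> x))"
proof -
  have "integral {0..s} (\<lambda>\<tau>. f (u \<tau> 0)) + integral {s..t} (\<lambda>\<tau>. f (u \<tau> 0)) = integral {0..t} (\<lambda>\<tau>. f (u \<tau> 0))"
    using assms by (intro Henstock_Kurzweil_Integration.integral_combine flux_integrable) auto
  then show ?thesis
    using balance[OF assms, of 0 x] balance[OF assms, of x 0] by (cases "0 \<le> x") (simp_all add: W_def)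
qed

lemma W_lipschitz_space:
  assumes t: "t \<in> {0..T}"
  shows "\<bar>W t x - W t y\<bar> \<le> M * \<bar>x - y\<bar>"
proof (cases "x \<le> y")
  case True
  then show ?thesis
    using W_space[OF t True] u.slice_integral_bound[OF t True] by (simp add: abs_minus_commute[of "W t x"])
next
  case False
  then show ?thesis
    using W_space[OF t, of y x] u.slice_integral_bound[OF t, of y x] by simp
qed

lemma W_lipschitz_time:
  assumes "s \<in> {0..T}" "t \<in> {0..T}"
  shows "\<bar>W t x - W s x\<bar> \<le> M * \<bar>t - s\<bar>"
proof -
  have *: "\<bar>W t x - W s x\<bar> \<le> M * \<bar>t - s\<bar>" if st: "0 \<le> s" "s \<le> t" "t \<le> T" for s t
  proof -
    have "norm (integral {s..t} (\<lambda>\<tau>. f (u \<tau> x))) \<le> integral {s..t} (\<lambda>_. M)"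
      using st by (intro integral_norm_bound_integral flux_integrable) (auto intro!: flux.bound)
    then show ?thesis using W_time[OF st, of x] st by (simp add: mult.commute)
  qed
  show ?thesis using *[of s t] *[of t s] assms
    by (cases "s \<le> t") (auto simp: abs_minus_commute)
qed

lemma W_continuous_time: "continuous_on {0..T} (\<lambda>t. W t x)"
  by (rule lipschitz_on_continuous_on[OF lipschitz_onI[of _ _ M]])
    (auto simp: dist_real_def u.M_nonneg intro: W_lipschitz_time)

lemma W_continuous: "continuous_on ({0..T} \<times> UNIV) (\<lambda>(t, x). W t x)"
  by (rule continuous_on_strip[OF W_lipschitz_space W_continuous_time])

lemma W_slice_continuous: "t \<in> {0..T} \<Longrightarrow> continuous_on S (W t)"
  by (rule continuous_on_subset[OF lipschitz_on_continuous_on[OF lipschitz_onI[of UNIV _ M]]])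
    (auto simp: dist_real_def u.M_nonneg intro: W_lipschitz_space)

lemma W_slice_integrable: "t \<in> {0..T} \<Longrightarrow> W t integrable_on {a..b}"
  by (intro integrable_continuous_real W_slice_continuous)

definition Wn :: "nat \<Rightarrow> real \<Rightarrow> real \<Rightarrow> real" where
  "Wn n t x = lavg n (W t) x"

lemma Wn_near:
  assumes t: "t \<in> {0..T}"
  shows "\<bar>Wn n t x - W t x\<bar> \<le> M / real (Suc n)"
proof -
  have "\<bar>lavg n (\<lambda>y. W t y - W t x) x\<bar> \<le> M / real (Suc n)"
  proof (rule lavg_bound)
    show "\<bar>W t y - W t x\<bar> \<le> M / real (Suc n)" if "x - 1 / real (Suc n) \<le> y" "y \<le> x" for y
    proof -
      have "\<bar>W t y - W t x\<bar> \<le> M * (1 / real (Suc n))"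
        using W_lipschitz_space[OF t, of y x] that u.M_nonneg by (elim order_trans) (intro mult_left_mono, auto)
      then show ?thesis by simp
    qed
  qed (intro Henstock_Kurzweil_Integration.integrable_diff W_slice_integrable t integrable_const_ivl)
  then show ?thesis unfolding Wn_def lavg_diff_const[OF W_slice_integrable[OF t]] .
qed

lemma Wn_tendsto: "t \<in> {0..T} \<Longrightarrow> (\<lambda>n. Wn n t x) \<longlonglongrightarrow> W t x"
proof -
  assume t: "t \<in> {0..T}"
  have "(\<lambda>n. M * inverse (real (Suc n))) \<longlonglongrightarrow> M * 0"
    by (intro tendsto_mult tendsto_const LIMSEQ_inverse_real_of_nat)
  then have "(\<lambda>n. M / real (Suc n)) \<longlonglongrightarrow> 0" by (simp add: divide_inverse)
  then have "(\<lambda>n. Wn n t x - W t x) \<longlonglongrightarrow> 0"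
    by (rule Lim_null_comparison[rotated]) (use Wn_near[OF t] in auto)
  then show ?thesis by (simp add: Lim_null[of _ "W t x"])
qed

lemma Wn_deriv_space:
  assumes t: "t \<in> {0..T}"
  shows "(Wn n t has_real_derivative lavg n (u t) x) (at x)"
proof -
  have "real (Suc n) * (W t x - W t (x - 1 / real (Suc n))) = lavg n (u t) x"
    using W_space[OF t, of "x - 1 / real (Suc n)" x] by (simp add: lavg_def del: of_nat_Suc)
  then show ?thesis
    using lavg_has_real_derivative[OF W_slice_continuous[OF t], of n x] by (simp add: Wn_def[abs_def] del: of_nat_Suc)
qed

text \<open>The flux at a fixed \<open>x\<close> may jump in time, but its spatial average is
  continuous in time. Averaging \<open>W_time\<close> and exchanging the integrals therefore
  prepares the fundamental theorem of calculus.\<close>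

lemma Wn_time:
  assumes t: "t \<in> {0..T}"
  shows "Wn n t x = Wn n 0 x - integral {0..t} (\<lambda>\<tau>. lavg n (\<lambda>y. f (u \<tau> y)) x)"
proof -
  let ?I = "{x - 1 / real (Suc n)..x}"
  have 0: "0 \<in> {0..T}" using t by auto
  have "integral ?I (W t) - integral ?I (W 0) = integral ?I (\<lambda>y. W t y - W 0 y)"
    by (rule Henstock_Kurzweil_Integration.integral_diff[symmetric]) (intro W_slice_integrable t 0)+
  also have "\<dots> = - integral ?I (\<lambda>y. integral {0..t} (\<lambda>\<tau>. f (u \<tau> y)))"
    using t by (simp add: W_time)
  also have "\<dots> = - integral {0..t} (\<lambda>\<tau>. integral ?I (\<lambda>y. f (u \<tau> y)))"
    using t by (subst flux.integral_swap_strip) auto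
  finally have "integral ?I (W t) = integral ?I (W 0) - integral {0..t} (\<lambda>\<tau>. integral ?I (\<lambda>y. f (u \<tau> y)))"
    by simp
  then have "real (Suc n) * integral ?I (W t) = real (Suc n) * integral ?I (W 0)
      - real (Suc n) * integral {0..t} (\<lambda>\<tau>. integral ?I (\<lambda>y. f (u \<tau> y)))"
    by (simp only: right_diff_distrib)
  then show ?thesis by (simp add: Wn_def lavg_def del: of_nat_Suc)
qed

lemma Wn_deriv_time:
  assumes t: "t \<in> {0<..<T}"
  shows "((\<lambda>t. Wn n t x) has_real_derivative - lavg n (\<lambda>y. f (u t y)) x) (at t)"
proof -
  have "continuous_on {0..T} (\<lambda>\<tau>. lavg n (\<lambda>y. f (u \<tau> y)) x)"
    unfolding lavg_def by (intro continuous_intros flux.slice_integral_continuous)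
  from integral_has_real_derivative[OF this, of t] t
  have "((\<lambda>t. integral {0..t} (\<lambda>\<tau>. lavg n (\<lambda>y. f (u \<tau> y)) x)) has_real_derivative lavg n (\<lambda>y. f (u t y)) x) (at t)"
    by (simp add: at_within_Icc_at)
  then have "((\<lambda>t. Wn n 0 x - integral {0..t} (\<lambda>\<tau>. lavg n (\<lambda>y. f (u \<tau> y)) x)) has_real_derivative - lavg n (\<lambda>y. f (u t y)) x) (at t)"
    by (auto intro!: derivative_eq_intros)
  then show ?thesis
    by (rule has_field_derivative_transform_within_open[of _ _ _ "{0<..<T}"]) (use t in \<open>auto simp: Wn_time[symmetric]\<close>)
qed

lemma Wn_has_derivative:
  assumes p: "p \<in> \<Omega>"
  shows "((\<lambda>p. Wn n (fst p) (snd p)) has_derivative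
      (\<lambda>h. - lavg n (\<lambda>y. f (u (fst p) y)) (snd p) * fst h + lavg n (u (fst p)) (snd p) * snd h)) (at p)"
proof -
  obtain t x where [simp]: "p = (t, x)" by (cases p)
  have t: "t \<in> {0<..<T}" using p by simp
  \<comment> \<open>The partials combine to a total derivative because the one in \<open>x\<close>
    is jointly continuous on the strip.\<close>
  have "((\<lambda>(t, x). Wn n t x) has_derivative
      (\<lambda>(h, k). (- lavg n (\<lambda>y. f (u t y)) x) * h + blinfun_mult_right (lavg n (u t) x) k)) (at (t, x) within \<Omega>)"
  proof (rule has_derivative_partialsI)
    show "((\<lambda>t. Wn n t x) has_derivative (*) (- lavg n (\<lambda>y. f (u t y)) x)) (at t within {0<..<T})"
      using Wn_deriv_time[OF t, of n x] by (simp add: has_field_derivative_def has_derivative_at_withinI)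
    show "(Wn n s has_derivative blinfun_mult_right (lavg n (u s) y)) (at y within UNIV)" if "s \<in> {0<..<T}" for s y
      using Wn_deriv_space[of s n y] that by (simp add: has_field_derivative_def)
    have "continuous_on \<Omega> (\<lambda>(t, x). lavg n (u t) x)"
      by (rule continuous_on_subset[OF u.lavg_slice_continuous]) auto
    then have "continuous_on \<Omega> (\<lambda>p. blinfun_mult_right (case p of (t, x) \<Rightarrow> lavg n (u t) x))"
      by (rule bounded_linear.continuous_on[OF bounded_linear_blinfun_mult_right])
    then show "continuous (at (t, x) within \<Omega>) (\<lambda>(t, x). blinfun_mult_right (lavg n (u t) x))"
      using p by (auto simp: continuous_on_eq_continuous_within case_prod_unfold)
  qed auto
  then show ?thesis
    using at_within_open[OF p open_\<Omega>] by (simp add: case_prod_unfold)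
qed

lemma lavg_continuous_\<Omega>:
  "continuous_on \<Omega> (\<lambda>p. lavg n (u (fst p)) (snd p))"
  "continuous_on \<Omega> (\<lambda>p. lavg n (\<lambda>y. f (u (fst p) y)) (snd p))"
  using continuous_on_subset[OF u.lavg_slice_continuous, of \<Omega> n]
    continuous_on_subset[OF flux.lavg_slice_continuous, of \<Omega> n] Sigma_mono[of "{0<..<T}" "{0..T}" "\<lambda>_. UNIV" "\<lambda>_. UNIV"]
  by (force simp: case_prod_unfold)+

lemma Wn_continuous_\<Omega>: "continuous_on \<Omega> (\<lambda>p. Wn n (fst p) (snd p))"
  by (intro continuous_at_imp_continuous_on ballI has_derivative_continuous[OF Wn_has_derivative])

end

section \<open>The potential\<close>

text \<open>A vanishing derivative means \<open>F (c s) - F (c t) = o(norm (c s - c t))\<close>, and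
  the Lipschitz bound turns this into \<open>o(\<bar>s - t\<bar>)\<close>.\<close>

lemma has_derivative_0_compose_lipschitz:
  fixes c :: "real \<Rightarrow> 'a::real_normed_vector" and F :: "'a \<Rightarrow> real"
  assumes F: "(F has_derivative (\<lambda>_. 0)) (at (c t))"
    and c: "\<forall>\<^sub>F s in at t. norm (c s - c t) \<le> L * \<bar>s - t\<bar>"
  shows "((\<lambda>s. F (c s)) has_real_derivative 0) (at t)"
proof -
  define L' where "L' = max L 1"
  have L': "L' > 0" by (simp add: L'_def)
  have "\<exists>d>0. \<forall>s. norm (s - t) < d \<longrightarrow> norm (F (c s) - F (c t) - 0) \<le> e * norm (s - t)" if e: "e > 0" for e
  proof -
    have "e / L' > 0" using e L' by simp
    then obtain d where d: "d > 0" "\<And>y. norm (y - c t) < d \<Longrightarrow> \<bar>F y - F (c t)\<bar> \<le> (e / L') * norm (y - c t)"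
      using F[unfolded has_derivative_at_alt, THEN conjunct2, rule_format, of "e / L'"] by auto
    obtain r where r: "r > 0" "\<And>s. s \<noteq> t \<Longrightarrow> \<bar>s - t\<bar> < r \<Longrightarrow> norm (c s - c t) \<le> L * \<bar>s - t\<bar>"
      using c unfolding eventually_at dist_real_def by auto
    have "\<bar>F (c s) - F (c t)\<bar> \<le> e * \<bar>s - t\<bar>" if s: "\<bar>s - t\<bar> < min r (d / L')" for s
    proof (cases "s = t")
      case False
      have "L * \<bar>s - t\<bar> \<le> L' * \<bar>s - t\<bar>" by (intro mult_right_mono) (auto simp: L'_def)
      then have n: "norm (c s - c t) \<le> L' * \<bar>s - t\<bar>" using r(2)[of s] False s by (meson min_less_iff_conj order_trans)
      also have "\<dots> < d" using s L' by (simp add: field_simps)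
      finally have "\<bar>F (c s) - F (c t)\<bar> \<le> (e / L') * norm (c s - c t)" by (rule d(2))
      also have "\<dots> \<le> (e / L') * (L' * \<bar>s - t\<bar>)" using n e L' by (intro mult_left_mono) auto
      finally show ?thesis using L' by simp
    qed simp
    then show ?thesis using r(1) d(1) L' by (intro exI[of _ "min r (d / L')"]) auto
  qed
  then have "((\<lambda>s. F (c s)) has_derivative (\<lambda>_. 0)) (at t)"
    unfolding has_derivative_at_alt by simp
  moreover have "(*) (0::real) = (\<lambda>_. 0)" by auto
  ultimately show ?thesis by (simp only: has_field_derivative_def)
qed

text \<open>At a fixed \<open>t\<close>, subtracting from \<open>H\<close> its linear part leaves a function with vanishing derivative, and
  the rest of the integrand is continuous at \<open>t\<close> with value 0; hence no differentiability of
  \<open>\<gamma>\<close> is needed.\<close>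

lemma integral_chain_rule_lipschitz:
  fixes H :: "real \<times> real \<Rightarrow> real" and \<gamma> g p q :: "real \<Rightarrow> real"
  assumes "a \<le> b"
    and \<gamma>: "\<And>s t. a \<le> s \<Longrightarrow> s \<le> t \<Longrightarrow> t \<le> b \<Longrightarrow> \<gamma> t - \<gamma> s = integral {s..t} g"
    and g: "g absolutely_integrable_on {a..b}" "\<And>t. t \<in> {a..b} \<Longrightarrow> \<bar>g t\<bar> \<le> G"
    and H: "\<And>t. t \<in> {a<..<b} \<Longrightarrow> (H has_derivative (\<lambda>h. p t * fst h + q t * snd h)) (at (t, \<gamma> t))"
    and contH: "continuous_on {a..b} (\<lambda>t. H (t, \<gamma> t))"
    and p: "continuous_on {a..b} p" and q: "continuous_on {a..b} q"
  shows "H (b, \<gamma> b) - H (a, \<gamma> a) = integral {a..b} (\<lambda>t. p t + q t * g t)"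
proof (cases "a < b")
  case False
  then have "a = b" using assms(1) by simp
  then show ?thesis by simp
next
  case ab: True
  have qg: "(\<lambda>t. q' t * g t) absolutely_integrable_on {a..b}" if "continuous_on {a..b} q'" for q'
  proof (rule absolutely_integrable_bounded_measurable_product_real[OF _ _ _ g(1)])
    show "q' \<in> borel_measurable (lebesgue_on {a..b})"
      by (rule continuous_imp_measurable_on_sets_lebesgue[OF that]) auto
    show "bounded (q' ` {a..b})"
      by (intro compact_imp_bounded compact_continuous_image that) auto
  qed auto
  have int: "(\<lambda>t. p' t + q' t * g t) integrable_on {a..b}" if "continuous_on {a..b} p'" "continuous_on {a..b} q'" for p' q'
    by (intro Henstock_Kurzweil_Integration.integrable_add integrable_continuous_real that set_lebesgue_integral_eq_integral(1)[OF qg])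
  have gi: "g integrable_on {c..d}" if "a \<le> c" "d \<le> b" for c d
    using integrable_subinterval_real[OF set_lebesgue_integral_eq_integral(1)[OF g(1)]] that by auto
  have lip: "\<bar>\<gamma> t - \<gamma> s\<bar> \<le> G * \<bar>t - s\<bar>" if "s \<in> {a..b}" "t \<in> {a..b}" for s t
  proof -
    have *: "\<bar>\<gamma> t - \<gamma> s\<bar> \<le> G * \<bar>t - s\<bar>" if st: "a \<le> s" "s \<le> t" "t \<le> b" for s t
    proof -
      have "norm (integral {s..t} g) \<le> integral {s..t} (\<lambda>_. G)"
        using st by (intro integral_norm_bound_integral gi) (auto intro!: g(2))
      then show ?thesis using \<gamma>[OF st] st by (simp add: mult.commute)
    qed
    show ?thesis using *[of s t] *[of t s] that by (cases "s \<le> t") (auto simp: abs_minus_commute)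
  qed
  define E where "E t = H (t, \<gamma> t) - integral {a..t} (\<lambda>\<tau>. p \<tau> + q \<tau> * g \<tau>)" for t
  have "(E has_real_derivative 0) (at t)" if t: "a < t" "t < b" for t
  proof -
    have t': "t \<in> {a..b}" using t by simp
    define F where "F h = H h - (p t * fst h + q t * snd h)" for h :: "real \<times> real"
    have "(F has_derivative (\<lambda>h. (p t * fst h + q t * snd h) - (p t * fst h + q t * snd h))) (at (t, \<gamma> t))"
      unfolding F_def by (intro has_derivative_diff H derivative_intros) (use t in auto)
    then have "(F has_derivative (\<lambda>_. 0)) (at (t, \<gamma> t))" by simp
    moreover have "\<forall>\<^sub>F s in at t. norm ((s, \<gamma> s) - (t, \<gamma> t)) \<le> (1 + G) * \<bar>s - t\<bar>"
    proof (rule eventually_mono[OF eventually_at_in_open'[of "{a<..<b}" t]])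
      fix s assume "s \<in> {a<..<b}"
      then have "\<bar>\<gamma> s - \<gamma> t\<bar> \<le> G * \<bar>s - t\<bar>" using lip[of t s] t by auto
      moreover have "norm ((s, \<gamma> s) - (t, \<gamma> t)) \<le> \<bar>s - t\<bar> + \<bar>\<gamma> s - \<gamma> t\<bar>"
        using norm_Pair_le[of "s - t" "\<gamma> s - \<gamma> t"] by simp
      ultimately show "norm ((s, \<gamma> s) - (t, \<gamma> t)) \<le> (1 + G) * \<bar>s - t\<bar>" by (simp add: algebra_simps)
    qed (use t in auto)
    ultimately have F: "((\<lambda>s. F (s, \<gamma> s)) has_real_derivative 0) (at t)"
      by (rule has_derivative_0_compose_lipschitz)
    define k where "k \<tau> = (p \<tau> - p t) + (q \<tau> - q t) * g \<tau>" for \<tau>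
    have ki: "k integrable_on {a..b}"
      unfolding k_def by (intro int continuous_intros p q)
    have "continuous (at t within {a..b}) k"
      unfolding continuous_within
    proof -
      have "((\<lambda>\<tau>. \<bar>p \<tau> - p t\<bar> + \<bar>q \<tau> - q t\<bar> * G) \<longlongrightarrow> \<bar>p t - p t\<bar> + \<bar>q t - q t\<bar> * G) (at t within {a..b})"
        using p q t' by (intro tendsto_intros) (auto simp: continuous_on_def)
      then have lim0: "((\<lambda>\<tau>. \<bar>p \<tau> - p t\<bar> + \<bar>q \<tau> - q t\<bar> * G) \<longlongrightarrow> 0) (at t within {a..b})" by simp
      have kG: "norm (k \<tau>) \<le> \<bar>p \<tau> - p t\<bar> + \<bar>q \<tau> - q t\<bar> * G" if "\<tau> \<in> {a..b}" for \<tau>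
      proof -
        have "\<bar>(q \<tau> - q t) * g \<tau>\<bar> \<le> \<bar>q \<tau> - q t\<bar> * G"
          unfolding abs_mult by (intro mult_left_mono g(2) that) auto
        then show ?thesis unfolding k_def real_norm_def by linarith
      qed
      have "\<forall>\<^sub>F \<tau> in at t within {a..b}. norm (k \<tau>) \<le> \<bar>p \<tau> - p t\<bar> + \<bar>q \<tau> - q t\<bar> * G"
        unfolding eventually_at_filter by (intro always_eventually allI impI kG)
      from Lim_null_comparison[OF this lim0] have "(k \<longlongrightarrow> 0) (at t within {a..b})" .
      then show "(k \<longlongrightarrow> k t) (at t within {a..b})" by (simp add: k_def)
    qed
    with integral_has_vector_derivative_continuous_at[OF ki, of t "{}"] t'
    have K: "((\<lambda>s. integral {a..s} k) has_real_derivative 0) (at t)"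
      using t by (simp add: k_def has_real_derivative_iff_has_vector_derivative at_within_Icc_at)
    have "((\<lambda>s. F (s, \<gamma> s) - integral {a..s} k + (p t * a + q t * \<gamma> a)) has_real_derivative 0 - 0 + 0) (at t)"
      by (intro derivative_intros F K)
    then have "((\<lambda>s. F (s, \<gamma> s) - integral {a..s} k + (p t * a + q t * \<gamma> a)) has_real_derivative 0) (at t)" by simp
    then show ?thesis
    proof (rule has_field_derivative_transform_within_open[of _ _ _ "{a<..<b}"])
      fix s assume s: "s \<in> {a<..<b}"
      have sub: "{a..s} \<subseteq> {a..b}" using s by auto
      have "integral {a..s} k = integral {a..s} (\<lambda>\<tau>. (p \<tau> + q \<tau> * g \<tau>) - (p t + q t * g \<tau>))"
        by (intro Henstock_Kurzweil_Integration.integral_cong) (simp add: k_def algebra_simps)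
      also have "\<dots> = integral {a..s} (\<lambda>\<tau>. p \<tau> + q \<tau> * g \<tau>) - integral {a..s} (\<lambda>\<tau>. p t + q t * g \<tau>)"
        by (intro Henstock_Kurzweil_Integration.integral_diff integrable_subinterval_real[OF int sub] p q continuous_intros)
      also have "integral {a..s} (\<lambda>\<tau>. p t + q t * g \<tau>) = p t * (s - a) + q t * (\<gamma> s - \<gamma> a)"
        using s gi[of a s] \<gamma>[of a s]
        by (subst Henstock_Kurzweil_Integration.integral_add) (auto intro!: integrable_on_mult_right)
      finally show "F (s, \<gamma> s) - integral {a..s} k + (p t * a + q t * \<gamma> a) = E s"
        by (simp add: F_def E_def algebra_simps)
    qed (use t in auto)
  qed
  moreover have "continuous_on {a..b} E"
    unfolding E_def by (intro continuous_intros contH indefinite_integral_continuous_1 int p q)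
  ultimately have "E b = E a"
    using DERIV_isconst2[OF ab, of E b] assms(1) by auto
  then show ?thesis by (simp add: E_def)
qed

text \<open>Besides the limit of the integrals it yields integrability of the limit function, so
  integrands involving \<open>u\<close> inherit their measurability from differentiable
  approximations.\<close>

lemma tendsto_integral_compact_support:
  fixes k :: "nat \<Rightarrow> 'a::euclidean_space \<Rightarrow> real"
  assumes K: "compact K" "\<And>n p. p \<notin> K \<Longrightarrow> k n p = 0"
    and k: "\<And>n. k n \<in> borel_measurable borel" "\<And>n p. \<bar>k n p\<bar> \<le> C" "\<And>p. (\<lambda>n. k n p) \<longlonglongrightarrow> l p"
  shows "(\<lambda>n. LINT p|lborel. k n p) \<longlonglongrightarrow> (LINT p|lborel. l p)"
    and "integrable lborel l"
proof -
  have w: "integrable lborel (\<lambda>p. C * indicator K p)"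
    by (rule integrable_indicator_compact[OF K(1)])
  have dom: "AE p in lborel. norm (k n p) \<le> C * indicator K p" for n
    using k(2) K(2) by (intro AE_I2) (auto simp: indicator_def)
  have lm: "l \<in> borel_measurable borel" by (rule borel_measurable_LIMSEQ_real[OF k(3,1)])
  show "(\<lambda>n. LINT p|lborel. k n p) \<longlonglongrightarrow> (LINT p|lborel. l p)"
    by (rule integral_dominated_convergence[OF _ _ w _ dom]) (use k lm in auto)
  show "integrable lborel l"
    by (rule integrable_dominated_convergence[where s=k, OF _ _ w _ dom]) (use k lm in auto)
qed

context entropy_strip
begin

text \<open>The chain rule is exact for the averages, and their gradients converge at every point of
  the curve with positive time. So the identity survives even where \<open>\<gamma>\<close> follows
  a discontinuity of \<open>u\<close>.\<close>

lemma W_path: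
  assumes \<gamma>: "\<And>s t. 0 \<le> s \<Longrightarrow> s \<le> t \<Longrightarrow> t \<le> T \<Longrightarrow> \<gamma> t - \<gamma> s = integral {s..t} g"
    and g: "g absolutely_integrable_on {0..T}" "\<And>t. t \<in> {0..T} \<Longrightarrow> \<bar>g t\<bar> \<le> G"
    and cont: "continuous_on {0..T} \<gamma>" and t: "t \<in> {0..T}"
  shows "W t (\<gamma> t) - W 0 (\<gamma> 0) = integral {0..t} (\<lambda>\<tau>. g \<tau> * u \<tau> (\<gamma> \<tau>) - f (u \<tau> (\<gamma> \<tau>)))"
proof -
  have 0: "0 \<in> {0..T}" using t by auto
  have sub: "{0..t} \<subseteq> {0..T}" using t by auto
  note cont_t = continuous_on_subset[OF cont sub]
  have pc: "continuous_on {0..t} (\<lambda>\<tau>. h \<tau> (\<gamma> \<tau>))" if "continuous_on ({0..T} \<times> UNIV) (\<lambda>(t, x). h t x)" for h :: "real \<Rightarrow> real \<Rightarrow> real"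
  proof -
    have "continuous_on {0..t} (\<lambda>\<tau>. (\<tau>, \<gamma> \<tau>))" by (intro continuous_intros cont_t)
    moreover have "(\<lambda>\<tau>. (\<tau>, \<gamma> \<tau>)) ` {0..t} \<subseteq> {0..T} \<times> UNIV" using sub by blast
    ultimately show ?thesis using continuous_on_compose2[OF that] by force
  qed
  have eq: "Wn n t (\<gamma> t) - Wn n 0 (\<gamma> 0)
      = integral {0..t} (\<lambda>\<tau>. - lavg n (\<lambda>y. f (u \<tau> y)) (\<gamma> \<tau>) + lavg n (u \<tau>) (\<gamma> \<tau>) * g \<tau>)" for n
  proof -
    have "continuous_on {0..t} (\<lambda>\<tau>. Wn n \<tau> (\<gamma> \<tau>))"
    proof (rule pc, rule continuous_on_strip)
      show "continuous_on {0..T} (\<lambda>t. Wn n t x)" for x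
      proof (rule continuous_on_eq)
        show "continuous_on {0..T} (\<lambda>t. Wn n 0 x - integral {0..t} (\<lambda>\<tau>. lavg n (\<lambda>y. f (u \<tau> y)) x))"
          unfolding lavg_def
          by (intro continuous_intros indefinite_integral_continuous_1 integrable_continuous_real flux.slice_integral_continuous)
      qed (simp add: Wn_time[symmetric])
      show "\<bar>Wn n s x - Wn n s y\<bar> \<le> M * \<bar>x - y\<bar>" if s: "s \<in> {0..T}" for s x y
        using field_differentiable_bound[of UNIV "Wn n s" "lavg n (u s)" M x y]
          Wn_deriv_space[OF s] u.lavg_slice_bound[OF s] by auto
    qed
    moreover have "g absolutely_integrable_on {0..t}"
      by (rule set_integrable_subset[OF g(1) _ sub]) auto
    moreover have "((\<lambda>p. Wn n (fst p) (snd p)) has_derivative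
        (\<lambda>h. - lavg n (\<lambda>y. f (u \<tau> y)) (\<gamma> \<tau>) * fst h + lavg n (u \<tau>) (\<gamma> \<tau>) * snd h)) (at (\<tau>, \<gamma> \<tau>))"
      if "\<tau> \<in> {0<..<t}" for \<tau>
      using Wn_has_derivative[of "(\<tau>, \<gamma> \<tau>)" n] that t by simp
    ultimately have "(\<lambda>p. Wn n (fst p) (snd p)) (t, \<gamma> t) - (\<lambda>p. Wn n (fst p) (snd p)) (0, \<gamma> 0)
        = integral {0..t} (\<lambda>\<tau>. - lavg n (\<lambda>y. f (u \<tau> y)) (\<gamma> \<tau>) + lavg n (u \<tau>) (\<gamma> \<tau>) * g \<tau>)"
      using t by (intro integral_chain_rule_lipschitz[where G=G and g=g and \<gamma>=\<gamma>] \<gamma> g(2) continuous_on_minus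
          pc[OF u.lavg_slice_continuous] pc[OF flux.lavg_slice_continuous]) auto
    then show ?thesis by simp
  qed
  have gi: "(\<lambda>\<tau>. - lavg n (\<lambda>y. f (u \<tau> y)) (\<gamma> \<tau>) + lavg n (u \<tau>) (\<gamma> \<tau>) * g \<tau>) integrable_on {0..t}" for n
  proof -
    have "(\<lambda>\<tau>. lavg n (u \<tau>) (\<gamma> \<tau>) * g \<tau>) absolutely_integrable_on {0..t}"
    proof (rule absolutely_integrable_bounded_measurable_product_real)
      note c = pc[OF u.lavg_slice_continuous]
      show "(\<lambda>\<tau>. lavg n (u \<tau>) (\<gamma> \<tau>)) \<in> borel_measurable (lebesgue_on {0..t})"
        by (rule continuous_imp_measurable_on_sets_lebesgue[OF c]) auto
      show "bounded ((\<lambda>\<tau>. lavg n (u \<tau>) (\<gamma> \<tau>)) ` {0..t})"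
        by (intro compact_imp_bounded compact_continuous_image c) auto
      show "g absolutely_integrable_on {0..t}"
        by (rule set_integrable_subset[OF g(1) _ sub]) auto
    qed auto
    then show ?thesis
      by (intro Henstock_Kurzweil_Integration.integrable_add integrable_neg integrable_continuous_real
          pc[OF flux.lavg_slice_continuous] set_lebesgue_integral_eq_integral(1))
  qed
  \<comment> \<open>At \<open>\<tau> = 0\<close> the averages have no known limit; the integrand is
    set to 0 there, which changes no integral. The constant \<open>M + M * G\<close>
    dominates.\<close>
  have lim: "(\<lambda>n. integral {0..t} (\<lambda>\<tau>. - lavg n (\<lambda>y. f (u \<tau> y)) (\<gamma> \<tau>) + lavg n (u \<tau>) (\<gamma> \<tau>) * g \<tau>))
      \<longlonglongrightarrow> integral {0..t} (\<lambda>\<tau>. if \<tau> = 0 then 0 else g \<tau> * u \<tau> (\<gamma> \<tau>) - f (u \<tau> (\<gamma> \<tau>)))"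
  proof -
    let ?k = "\<lambda>n \<tau>. if \<tau> = 0 then 0 else - lavg n (\<lambda>y. f (u \<tau> y)) (\<gamma> \<tau>) + lavg n (u \<tau>) (\<gamma> \<tau>) * g \<tau>"
    have "(\<lambda>n. integral {0..t} (?k n)) \<longlonglongrightarrow> integral {0..t} (\<lambda>\<tau>. if \<tau> = 0 then 0 else g \<tau> * u \<tau> (\<gamma> \<tau>) - f (u \<tau> (\<gamma> \<tau>)))"
    proof (rule dominated_convergence(2)[where h="\<lambda>_. M + M * G"])
      show "?k n integrable_on {0..t}" for n
        by (rule integrable_spike[OF gi[of n], of "{0}"]) auto
      show "norm (?k n \<tau>) \<le> M + M * G" if "\<tau> \<in> {0..t}" for n \<tau>
      proof -
        have \<tau>: "\<tau> \<in> {0..T}" using that sub by auto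
        have "\<bar>lavg n (u \<tau>) (\<gamma> \<tau>) * g \<tau>\<bar> \<le> M * G"
          unfolding abs_mult by (intro mult_mono u.lavg_slice_bound g(2) \<tau> u.M_nonneg) auto
        moreover have "\<bar>lavg n (\<lambda>y. f (u \<tau> y)) (\<gamma> \<tau>)\<bar> \<le> M" by (rule flux.lavg_slice_bound[OF \<tau>])
        moreover have "0 \<le> M + M * G" using calculation by linarith
        ultimately show ?thesis by (auto simp: abs_le_iff)
      qed
      show "(\<lambda>n. ?k n \<tau>) \<longlonglongrightarrow> (if \<tau> = 0 then 0 else g \<tau> * u \<tau> (\<gamma> \<tau>) - f (u \<tau> (\<gamma> \<tau>)))" if "\<tau> \<in> {0..t}" for \<tau>
      proof (cases "\<tau> = 0")
        case False
        then have \<tau>: "\<tau> \<in> {0<..T}" using that t by auto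
        have "(\<lambda>n. - lavg n (\<lambda>y. f (u \<tau> y)) (\<gamma> \<tau>) + lavg n (u \<tau>) (\<gamma> \<tau>) * g \<tau>) \<longlonglongrightarrow> - f (u \<tau> (\<gamma> \<tau>)) + u \<tau> (\<gamma> \<tau>) * g \<tau>"
          by (intro tendsto_intros u.lavg_slice_tendsto[OF \<tau>] flux.lavg_slice_tendsto[OF \<tau>])
        then show ?thesis using False by (simp add: algebra_simps)
      qed simp
    qed auto
    moreover have "integral {0..t} (?k n) = integral {0..t} (\<lambda>\<tau>. - lavg n (\<lambda>y. f (u \<tau> y)) (\<gamma> \<tau>) + lavg n (u \<tau>) (\<gamma> \<tau>) * g \<tau>)" for n
      by (rule integral_spike[of "{0}"]) auto
    ultimately show ?thesis by simp
  qed
  have spike: "integral {0..t} (\<lambda>\<tau>. if \<tau> = 0 then 0 else g \<tau> * u \<tau> (\<gamma> \<tau>) - f (u \<tau> (\<gamma> \<tau>)))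
      = integral {0..t} (\<lambda>\<tau>. g \<tau> * u \<tau> (\<gamma> \<tau>) - f (u \<tau> (\<gamma> \<tau>)))"
    by (rule integral_spike[of "{0}"]) auto
  have "(\<lambda>n. Wn n t (\<gamma> t) - Wn n 0 (\<gamma> 0)) \<longlonglongrightarrow> W t (\<gamma> t) - W 0 (\<gamma> 0)"
    by (intro tendsto_diff Wn_tendsto t 0)
  from LIMSEQ_unique[OF this[unfolded eq] lim[unfolded spike]] show ?thesis .
qed

text \<open>Integration by parts is the chain rule for the product
  \<open>\<phi> (fst p) * snd p\<close> along the path \<open>W t x + c\<close>, parametrised by
  \<open>x\<close>: that path is the integral of the bounded function \<open>u t\<close>. This
  covers \<open>t = 0\<close> too.\<close>

lemma W_weak_derivative_slice:
  assumes t: "t \<in> {0..T}" and \<phi>: "C1c_on UNIV \<phi>"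
  shows "(LINT x:UNIV|lebesgue. (W t x + c) * frechet_derivative \<phi> (at x) 1) = - (LINT x:UNIV|lebesgue. u t x * \<phi> x)"
proof -
  define w where "w x = W t x + c" for x
  have w_cont: "continuous_on S w" for S
    unfolding w_def by (intro continuous_intros W_slice_continuous t)
  let ?\<phi>' = "\<lambda>x. frechet_derivative \<phi> (at x) 1"
  obtain K where K: "compact K" "\<And>p. p \<notin> K \<Longrightarrow> \<phi> p = 0" "\<And>p v. p \<notin> K \<Longrightarrow> frechet_derivative \<phi> (at p) v = 0"
    using C1c_on_support[OF \<phi>] by metis
  obtain R0 where R0: "\<And>x. x \<in> K \<Longrightarrow> \<bar>x\<bar> \<le> R0"
    using compact_imp_bounded[OF K(1)] unfolding bounded_iff real_norm_def by metis
  \<comment> \<open>The extra 1 places \<open>-R\<close> and \<open>R\<close> outside the support of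
    \<open>\<phi>\<close>, so that the boundary terms vanish.\<close>
  define R where "R = max 0 R0 + 1"
  have z: "\<phi> x = 0" "?\<phi>' x = 0" if "x \<notin> {-R<..<R}" for x
  proof -
    have "x \<notin> K" using R0[of x] that by (auto simp: R_def)
    then show "\<phi> x = 0" "?\<phi>' x = 0" using K by auto
  qed
  have \<phi>': "continuous_on S ?\<phi>'" "continuous_on S \<phi>" for S
    using C1c_on_continuous_derivative[OF \<phi>] C1c_on_continuous[OF \<phi>] continuous_on_subset by blast+
  have uphi: "(\<lambda>x. u t x * \<phi> x) absolutely_integrable_on {-R..R}"
  proof -
    have "(\<lambda>x. \<phi> x * u t x) absolutely_integrable_on {-R..R}"
      by (intro absolutely_integrable_bounded_measurable_product_real u.slice_abs_integrable t
          continuous_imp_measurable_on_sets_lebesgue \<phi>' compact_imp_bounded compact_continuous_image) auto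
    then show ?thesis by (simp add: mult.commute)
  qed
  have Wphi: "(\<lambda>x. w x * ?\<phi>' x) absolutely_integrable_on {-R..R}"
    by (intro absolutely_integrable_continuous_real continuous_intros \<phi>' w_cont)
  have "\<phi> R * w R - \<phi> (-R) * w (-R) = integral {-R..R} (\<lambda>x. w x * ?\<phi>' x + \<phi> x * u t x)"
  proof -
    have "((\<lambda>p. \<phi> (fst p) * snd p) has_derivative (\<lambda>h. (w x * ?\<phi>' x) * fst h + \<phi> x * snd h)) (at (x, w x))" for x
    proof -
      define d where "d = ?\<phi>' x"
      have lin: "frechet_derivative \<phi> (at x) = (*) d"
      proof
        fix s show "frechet_derivative \<phi> (at x) s = d * s"
          using linear_scale[OF has_derivative_linear[OF C1c_on_has_derivative[OF \<phi>]], of x s 1]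
          unfolding d_def by (simp only: real_scaleR_def mult_1_right mult_1_left mult.commute)
      qed
      have "((\<lambda>p. \<phi> (fst p)) has_derivative (\<lambda>h. frechet_derivative \<phi> (at x) (fst h))) (at (x, w x))"
        using has_derivative_compose[OF has_derivative_fst[OF has_derivative_ident], of \<phi> _ "(x, w x)" UNIV]
          C1c_on_has_derivative[OF \<phi>, of x] by simp
      from has_derivative_mult[OF this has_derivative_snd[OF has_derivative_ident]]
      show ?thesis by (simp add: d_def[symmetric] lin algebra_simps del: mult_1_right)
    qed
    then have "(\<lambda>p. \<phi> (fst p) * snd p) (R, w R) - (\<lambda>p. \<phi> (fst p) * snd p) (-R, w (-R))
        = integral {-R..R} (\<lambda>x. w x * ?\<phi>' x + \<phi> x * u t x)"
    proof (intro integral_chain_rule_lipschitz[where G=M] u.slice_abs_integrable[OF t] u.bound[OF t])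
      show "- R \<le> R" by (simp add: R_def)
      show "w y - w x = integral {x..y} (u t)" if "x \<le> y" for x y
        using W_space[OF t that] by (simp add: w_def)
      show "continuous_on {-R..R} (\<lambda>x. (\<lambda>p. \<phi> (fst p) * snd p) (x, w x))"
        unfolding fst_conv snd_conv by (intro continuous_intros \<phi>' w_cont)
      show "continuous_on {-R..R} (\<lambda>x. w x * ?\<phi>' x)" "continuous_on {-R..R} \<phi>"
        by (intro continuous_intros \<phi>' w_cont)+
    qed
    then show ?thesis by simp
  qed
  also have "\<phi> R * w R - \<phi> (-R) * w (-R) = 0" using z by simp
  also have "integral {-R..R} (\<lambda>x. w x * ?\<phi>' x + \<phi> x * u t x)
      = integral {-R..R} (\<lambda>x. w x * ?\<phi>' x) + integral {-R..R} (\<lambda>x. u t x * \<phi> x)"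
    using uphi Wphi by (subst Henstock_Kurzweil_Integration.integral_add)
      (auto simp: mult.commute dest: set_lebesgue_integral_eq_integral(1))
  finally have eq: "integral {-R..R} (\<lambda>x. w x * ?\<phi>' x) = - integral {-R..R} (\<lambda>x. u t x * \<phi> x)" by simp
  have res: "(LINT x:UNIV|lebesgue. k x) = integral {-R..R} k"
    if "k absolutely_integrable_on {-R..R}" "\<And>x. x \<notin> {-R<..<R} \<Longrightarrow> k x = 0" for k :: "real \<Rightarrow> real"
  proof -
    have "indicator UNIV x *\<^sub>R k x = indicator {-R..R} x *\<^sub>R k x" for x
      using that(2)[of x] by (cases "x \<in> {-R<..<R}") auto
    then have "(LINT x:UNIV|lebesgue. k x) = (LINT x:{-R..R}|lebesgue. k x)"
      unfolding set_lebesgue_integral_def by (simp only:)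
    then show ?thesis using set_lebesgue_integral_eq_integral(2)[OF that(1)] by simp
  qed
  show ?thesis using res[OF Wphi] res[OF uphi] z eq by (simp add: w_def)
qed

lemma W_bound: "t \<in> {0..T} \<Longrightarrow> \<bar>W t x\<bar> \<le> \<bar>W 0 0\<bar> + M * T + M * \<bar>x\<bar>"
proof -
  assume t: "t \<in> {0..T}"
  have "\<bar>W t x - W t 0\<bar> \<le> M * \<bar>x\<bar>" using W_lipschitz_space[OF t, of x 0] by simp
  moreover have "\<bar>W t 0 - W 0 0\<bar> \<le> M * \<bar>t\<bar>" using W_lipschitz_time[of 0 t 0] t by simp
  moreover have "M * \<bar>t\<bar> \<le> M * T" using t u.M_nonneg by (intro mult_left_mono) auto
  ultimately show ?thesis by linarith
qed

text \<open>The product of \<open>Wn n\<close> with \<open>\<phi>\<close> is itself a test function,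
  so its derivative integrates to zero; the limit in \<open>n\<close> is the claim. The constant
  \<open>c\<close> drops out because derivatives of \<open>\<phi>\<close> integrate to zero as
  well.\<close>

lemma W_weak_derivative:
  assumes \<phi>: "C1c_on \<Omega> \<phi>"
  shows "(LINT p:\<Omega>|lebesgue. (W (fst p) (snd p) + c) * frechet_derivative \<phi> (at p) v)
    = - (LINT p:\<Omega>|lebesgue. (- f (u (fst p) (snd p)) * fst v + u (fst p) (snd p) * snd v) * \<phi> p)"
proof -
  let ?D = "\<lambda>p. frechet_derivative \<phi> (at p) v"
  obtain K where K: "compact K" "K \<subseteq> \<Omega>" "\<And>p. p \<notin> K \<Longrightarrow> \<phi> p = 0" "\<And>p v. p \<notin> K \<Longrightarrow> frechet_derivative \<phi> (at p) v = 0"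
    using C1c_on_support[OF \<phi>] by metis
  obtain C where C: "\<And>p. \<bar>\<phi> p\<bar> \<le> C" using C1c_bounded[OF \<phi>] by metis
  obtain C' where C': "\<And>p. \<bar>?D p\<bar> \<le> C'" using C1c_derivative_bounded[OF \<phi>] by metis
  have C0: "0 \<le> C" "0 \<le> C'" using C[of undefined] C'[of undefined] by linarith+
  obtain R where R: "R > 0" "\<And>p. p \<in> K \<Longrightarrow> norm p \<le> R"
    using compact_imp_bounded[OF K(1)] unfolding bounded_pos by metis
  \<comment> \<open>A bound for \<open>Wn n\<close> on \<open>K\<close>, uniform in
    \<open>n\<close>: the growth bound of \<open>W\<close> for \<open>\<bar>x\<bar> \<le> R\<close>,
    plus the averaging error, which is at most \<open>M\<close>.\<close>
  define B where "B = \<bar>W 0 0\<bar> + M * T + M * R + M"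
  let ?g = "\<lambda>n p. - lavg n (\<lambda>y. f (u (fst p) y)) (snd p) * fst v + lavg n (u (fst p)) (snd p) * snd v"
  let ?gl = "\<lambda>p. - f (u (fst p) (snd p)) * fst v + u (fst p) (snd p) * snd v"
  define \<psi> where "\<psi> n p = Wn n (fst p) (snd p) * \<phi> p" for n p
  have der: "(\<psi> n has_derivative (\<lambda>h. Wn n (fst p) (snd p) * frechet_derivative \<phi> (at p) h
      + (- lavg n (\<lambda>y. f (u (fst p) y)) (snd p) * fst h + lavg n (u (fst p)) (snd p) * snd h) * \<phi> p)) (at p)"
    if "p \<in> \<Omega>" for n p
    unfolding \<psi>_def by (intro has_derivative_mult Wn_has_derivative that C1c_on_has_derivative[OF \<phi>])
  have \<psi>: "C1c_on \<Omega> (\<psi> n)" for n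
  proof (rule C1c_onI[OF open_\<Omega> K(1,2) der])
    show "continuous_on \<Omega> (\<lambda>p. Wn n (fst p) (snd p) * frechet_derivative \<phi> (at p) h
      + (- lavg n (\<lambda>y. f (u (fst p) y)) (snd p) * fst h + lavg n (u (fst p)) (snd p) * snd h) * \<phi> p)" for h
      by (intro continuous_intros lavg_continuous_\<Omega> Wn_continuous_\<Omega>
          continuous_on_subset[OF C1c_on_continuous[OF \<phi>]] continuous_on_subset[OF C1c_on_continuous_derivative[OF \<phi>]]) auto
  qed (auto simp: \<psi>_def K)
  have D\<psi>: "frechet_derivative (\<psi> n) (at p) v = Wn n (fst p) (snd p) * ?D p + ?g n p * \<phi> p" if "p \<in> \<Omega>" for n p
    using frechet_derivative_at[OF der[OF that], symmetric] by simp
  let ?k = "\<lambda>n p. frechet_derivative (\<psi> n) (at p) v" and ?l = "\<lambda>p. W (fst p) (snd p) * ?D p + ?gl p * \<phi> p"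
  have kz: "?k n p = 0" if "p \<notin> K" for n p
  proof -
    have "(\<psi> n has_derivative (\<lambda>_. 0)) (at p)"
      by (rule has_derivative_transform_within_open[OF has_derivative_const[of 0], of "- K"])
        (use that K(1,3) in \<open>auto simp: \<psi>_def compact_imp_closed\<close>)
    from frechet_derivative_at[OF this, symmetric] show ?thesis by simp
  qed
  have kb: "\<bar>?k n p\<bar> \<le> B * C' + (M * \<bar>fst v\<bar> + M * \<bar>snd v\<bar>) * C" for n p
    proof (cases "p \<in> K")
      case True
      then have p: "p \<in> \<Omega>" "fst p \<in> {0..T}" using K(2) by auto
      have "\<bar>snd p\<bar> \<le> R" using R(2)[OF True] norm_snd_le[where x="fst p" and y="snd p"] by simp
      then have "M * \<bar>snd p\<bar> \<le> M * R" using u.M_nonneg by (rule mult_left_mono)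
      moreover have "M / real (Suc n) \<le> M" using divide_left_mono[of 1 "real (Suc n)" M] u.M_nonneg by simp
      ultimately have "\<bar>Wn n (fst p) (snd p)\<bar> \<le> B"
        using Wn_near[OF p(2), of n "snd p"] W_bound[OF p(2), of "snd p"] unfolding B_def by linarith
      then have 1: "\<bar>Wn n (fst p) (snd p) * ?D p\<bar> \<le> B * C'"
        unfolding abs_mult using C' by (intro mult_mono) auto
      have "\<bar>?g n p\<bar> \<le> \<bar>lavg n (\<lambda>y. f (u (fst p) y)) (snd p)\<bar> * \<bar>fst v\<bar> + \<bar>lavg n (u (fst p)) (snd p)\<bar> * \<bar>snd v\<bar>"
        unfolding abs_mult[symmetric] by linarith
      also have "\<dots> \<le> M * \<bar>fst v\<bar> + M * \<bar>snd v\<bar>"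
        by (intro add_mono mult_right_mono flux.lavg_slice_bound u.lavg_slice_bound p) auto
      finally have 2: "\<bar>?g n p * \<phi> p\<bar> \<le> (M * \<bar>fst v\<bar> + M * \<bar>snd v\<bar>) * C"
        unfolding abs_mult using C u.M_nonneg by (intro mult_mono) auto
      show ?thesis unfolding D\<psi>[OF p(1)] using 1 2 by linarith
    next
      case False
      have "0 \<le> B" using R(1) u.M_nonneg u.T_pos by (simp add: B_def)
      then show ?thesis using C0 u.M_nonneg by (simp add: kz[OF False])
    qed
  have kl: "(\<lambda>n. ?k n p) \<longlonglongrightarrow> ?l p" for p
    proof (cases "p \<in> K")
      case True
      then have p: "p \<in> \<Omega>" "fst p \<in> {0<..T}" "fst p \<in> {0..T}" using K(2) by auto
      show ?thesis unfolding D\<psi>[OF p(1)]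
        by (intro tendsto_intros Wn_tendsto u.lavg_slice_tendsto flux.lavg_slice_tendsto p)
    qed (simp add: kz K)
  note lim = tendsto_integral_compact_support[OF K(1) kz C1c_on_derivative_borel[OF \<psi>] kb kl]
  have 0: "(LINT p|lborel. ?l p) = 0"
    using lim(1) integral_derivative_\<Omega>[OF \<psi>] by (simp add: LIMSEQ_const_iff)
  have K': "K \<subseteq> {0<..T} \<times> UNIV" using K(2) by auto
  have gi: "integrable lborel (\<lambda>p. ?gl p * \<phi> p)"
  proof -
    have "integrable lborel (\<lambda>p. \<phi> p * u (fst p) (snd p))" "integrable lborel (\<lambda>p. \<phi> p * f (u (fst p) (snd p)))"
      using u.integrable_strip_mult[OF C1c_on_borel[OF \<phi>] C K(1) K' K(3)]
        flux.integrable_strip_mult[OF C1c_on_borel[OF \<phi>] C K(1) K' K(3)] by auto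
    then have "integrable lborel (\<lambda>p. - fst v * (\<phi> p * f (u (fst p) (snd p))) + snd v * (\<phi> p * u (fst p) (snd p)))"
      by (intro Bochner_Integration.integrable_add integrable_mult_right)
    then show ?thesis by (simp add: algebra_simps)
  qed
  \<comment> \<open>Obtained by subtraction: the full limit integrand is integrable as a dominated
    limit, and so is its flux part.\<close>
  have Wi: "integrable lborel (\<lambda>p. W (fst p) (snd p) * ?D p)"
    using Bochner_Integration.integrable_diff[OF lim(2) gi] by simp
  have Wci: "integrable lborel (\<lambda>p. (W (fst p) (snd p) + c) * ?D p)"
    using Bochner_Integration.integrable_add[OF Wi integrable_mult_right[OF integrable_weak(3)[OF \<phi>, of v], of c]]
    by (simp add: distrib_right)
  have "(LINT p|lborel. (W (fst p) (snd p) + c) * ?D p) = (LINT p|lborel. W (fst p) (snd p) * ?D p)"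
    using Wi integrable_mult_right[OF integrable_weak(3)[OF \<phi>, of v], of c] integral_derivative_\<Omega>[OF \<phi>, of v]
    by (simp add: distrib_right)
  also have "\<dots> = - (LINT p|lborel. ?gl p * \<phi> p)"
    using 0 gi Wi by (simp del: minus_mult_left)
  finally have "(LINT p|lborel. (W (fst p) (snd p) + c) * ?D p) = - (LINT p|lborel. ?gl p * \<phi> p)" .
  moreover have "(LINT p:\<Omega>|lebesgue. (W (fst p) (snd p) + c) * ?D p) = (LINT p|lborel. (W (fst p) (snd p) + c) * ?D p)"
  proof (rule set_integral_lebesgue_eq_lborel)
    show "(W (fst p) (snd p) + c) * ?D p = 0" if "p \<notin> \<Omega>" for p using K(2) K(4)[of p v] that by auto
  qed (use Wci in simp)
  moreover have "(LINT p:\<Omega>|lebesgue. ?gl p * \<phi> p) = (LINT p|lborel. ?gl p * \<phi> p)"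
  proof (rule set_integral_lebesgue_eq_lborel)
    show "?gl p * \<phi> p = 0" if "p \<notin> \<Omega>" for p using K(2) K(3)[of p] that by auto
  qed (use gi in simp)
  ultimately show ?thesis by simp
qed

end

section \<open>Viscosity inequalities\<close>

context entropy_strip
begin

text \<open>Testing the entropy inequality for \<open>k = p\<close> with \<open>(\<delta> - w)\<^sub>+\<^sup>2\<close>, where \<open>w\<close> is the strictly
  touching function: writing \<open>m\<close> for \<open>2 (\<delta> - w)\<^sub>+\<close> and \<open>A\<close> for \<open>\<sigma> (q + f p)\<close>, the inequality says
  \<open>A \<integral> m \<bar>u - p\<bar> \<ge> o(1) \<integral> m\<close>, while \<open>\<integral> \<partial>\<^sub>t (\<delta> - w)\<^sub>+\<^sup>2 = 0\<close> says
  \<open>\<integral> m (A + \<sigma> (f u - f p)) = o(1) \<integral> m\<close>. Together they exclude \<open>A < 0\<close>. The case \<open>\<sigma> = 1\<close> is a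
  touching from below, \<open>\<sigma> = -1\<close> one from above.\<close>

lemma touching_inequality:
  assumes lip: "\<And>R. \<exists>L. \<forall>x y. \<bar>x\<bar> \<le> R \<longrightarrow> \<bar>y\<bar> \<le> R \<longrightarrow> \<bar>f x - f y\<bar> \<le> L * \<bar>x - y\<bar>"
    and t0: "t0 \<in> {0<..<T}" and \<sigma>: "\<bar>\<sigma>\<bar> = 1" and "0 \<le> \<Lambda>"
    and touch: "\<And>t x. t \<in> {0..T} \<Longrightarrow>
      - \<Lambda> * ((t - t0)\<^sup>2 + (x - x0)\<^sup>2) \<le> \<sigma> * (W t x - W t0 x0 - q * (t - t0) - p * (x - x0))"
  shows "0 \<le> \<sigma> * (q + f p)"
proof (rule ccontr)
  assume "\<not> 0 \<le> \<sigma> * (q + f p)"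
  define a where "a = - (\<sigma> * (q + f p))"
  have a: "a > 0" using \<open>\<not> 0 \<le> \<sigma> * (q + f p)\<close> by (simp add: a_def)
  obtain L0 where L0: "\<And>x y. \<bar>x\<bar> \<le> max M \<bar>p\<bar> \<Longrightarrow> \<bar>y\<bar> \<le> max M \<bar>p\<bar> \<Longrightarrow> \<bar>f x - f y\<bar> \<le> L0 * \<bar>x - y\<bar>"
    using lip by metis
  define L where "L = max L0 0"
  have Lnn: "0 \<le> L" by (simp add: L_def)
  have L: "\<bar>f v - f p\<bar> \<le> L * \<bar>v - p\<bar>" if "\<bar>v\<bar> \<le> M" for v
  proof -
    have "\<bar>f v - f p\<bar> \<le> L0 * \<bar>v - p\<bar>" using that by (intro L0) auto
    also have "\<dots> \<le> L * \<bar>v - p\<bar>" by (intro mult_right_mono) (auto simp: L_def)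
    finally show ?thesis .
  qed
  define C where "C = (M + \<bar>p\<bar>) + L * (M + \<bar>p\<bar>)"
  have C: "\<bar>v - p\<bar> + \<bar>f v - f p\<bar> \<le> C" if "\<bar>v\<bar> \<le> M" for v
  proof -
    have "\<bar>v - p\<bar> \<le> M + \<bar>p\<bar>" using that by linarith
    then have "L * \<bar>v - p\<bar> \<le> L * (M + \<bar>p\<bar>)" using Lnn by (rule mult_left_mono)
    then show ?thesis unfolding C_def using L[OF that] \<open>\<bar>v - p\<bar> \<le> M + \<bar>p\<bar>\<close> by linarith
  qed
  have Cnn: "0 \<le> C" using C[of 0] u.M_nonneg by linarith
  \<comment> \<open>Where the weight is positive, the gradient of the quadratic penalty has
    components of size at most \<open>\<epsilon> = 2 * (\<Lambda> + 1) * \<rho>\<close>. The second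
    entry of the minimum keeps \<open>a\<^sup>2 - (L * C + a) * \<epsilon>\<close> positive, and
    dividing by 3 leaves room for a square of half-width \<open>2 * \<rho>\<close> inside the
    strip.\<close>
  define \<rho> where "\<rho> = min (min t0 (T - t0)) (a\<^sup>2 / (2 * (\<Lambda> + 1) * (L * C + a))) / 3"
  have den: "0 < 2 * (\<Lambda> + 1) * (L * C + a)"
    using a Lnn Cnn \<open>0 \<le> \<Lambda>\<close> by (intro mult_pos_pos add_nonneg_pos mult_nonneg_nonneg) auto
  have \<rho>: "0 < \<rho>" using t0 a den by (simp add: \<rho>_def)
  have \<rho>_int: "2 * \<rho> < t0" "2 * \<rho> < T - t0" using t0 \<rho> unfolding \<rho>_def by (auto simp: min_def)
  define \<epsilon> where "\<epsilon> = 2 * (\<Lambda> + 1) * \<rho>"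
  have "3 * \<rho> \<le> a\<^sup>2 / (2 * (\<Lambda> + 1) * (L * C + a))" unfolding \<rho>_def by simp
  then have "\<rho> < a\<^sup>2 / (2 * (\<Lambda> + 1) * (L * C + a))" using \<rho> by linarith
  then have "\<rho> * (2 * (\<Lambda> + 1) * (L * C + a)) < a\<^sup>2" using den by (simp add: pos_less_divide_eq)
  then have \<kappa>: "0 < a\<^sup>2 - (L * C + a) * \<epsilon>" by (simp add: \<epsilon>_def mult_ac)
  \<comment> \<open>Since \<open>N z \<le> w z\<close>, the region \<open>w z < \<delta>\<close>
    lies within distance \<open>\<rho>\<close> of the touching point.\<close>
  define \<delta> where "\<delta> = \<rho>\<^sup>2"
  have \<delta>: "0 < \<delta>" using \<rho> by (simp add: \<delta>_def)
  define N where "N z = (fst z - t0)\<^sup>2 + (snd z - x0)\<^sup>2" for z :: "real \<times> real"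
  have N_small: "\<bar>fst z - t0\<bar> \<le> r" "\<bar>snd z - x0\<bar> \<le> r" if "N z \<le> r\<^sup>2" "0 \<le> r" for z r
  proof -
    have "(fst z - t0)\<^sup>2 \<le> r\<^sup>2" "(snd z - x0)\<^sup>2 \<le> r\<^sup>2"
      using that(1) zero_le_power2[of "fst z - t0"] zero_le_power2[of "snd z - x0"] unfolding N_def by linarith+
    then show "\<bar>fst z - t0\<bar> \<le> r" "\<bar>snd z - x0\<bar> \<le> r"
      using that(2) by (simp_all add: abs_le_square_iff[symmetric])
  qed
  \<comment> \<open>The coefficient \<open>\<Lambda> + 1\<close> exceeds the given
    \<open>\<Lambda>\<close> by 1, so a full \<open>N z\<close> remains as a margin and the minimum
    becomes strict. The argument \<open>v\<close> admits both the potential and its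
    averages.\<close>
  define g where "g v z = \<sigma> * (v z - W t0 x0 - q * (fst z - t0) - p * (snd z - x0)) + (\<Lambda> + 1) * N z"
    for v :: "real \<times> real \<Rightarrow> real" and z
  define w where "w = g (\<lambda>z. W (fst z) (snd z))"
  define wn where "wn n = g (\<lambda>z. Wn n (fst z) (snd z))" for n
  have w_ge: "N z \<le> w z" if "fst z \<in> {0..T}" for z
    using touch[OF that, of "snd z"] by (simp add: w_def g_def N_def algebra_simps)
  have w0: "w (t0, x0) = 0" by (simp add: w_def g_def N_def)
  have wn_near: "\<bar>wn n z - w z\<bar> \<le> M / real (Suc n)" if "fst z \<in> {0..T}" for n z
  proof -
    have "wn n z - w z = \<sigma> * (Wn n (fst z) (snd z) - W (fst z) (snd z))"
      by (simp add: wn_def w_def g_def algebra_simps)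
    then show ?thesis using Wn_near[OF that, of n "snd z"] \<sigma> by (simp add: abs_mult)
  qed
  \<comment> \<open>From \<open>n0\<close> on the averages differ from \<open>w\<close> by at most
    \<open>\<delta>\<close>. So \<open>wn n z < \<delta>\<close> forces
    \<open>w z < 2 * \<delta>\<close>, hence \<open>N z \<le> (2 * \<rho>)\<^sup>2\<close>: all test
    functions are supported in the one square \<open>S\<close>.\<close>
  obtain n0 where n0: "M / real (Suc n) \<le> \<delta>" if "n \<ge> n0" for n
  proof -
    obtain m where m: "inverse (real (Suc m)) < \<delta> / (M + 1)" using reals_Archimedean[of "\<delta> / (M + 1)"] \<delta> u.M_nonneg by auto
    have "M / real (Suc n) \<le> \<delta>" if "n \<ge> m" for n
    proof -
      have "M / real (Suc n) \<le> (M + 1) * inverse (real (Suc m))"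
        using that u.M_nonneg by (auto simp: divide_inverse intro!: mult_mono le_imp_inverse_le)
      also have "\<dots> \<le> (M + 1) * (\<delta> / (M + 1))" using m u.M_nonneg by (intro mult_left_mono) auto
      finally show ?thesis using u.M_nonneg by simp
    qed
    then show thesis by (rule that)
  qed
  define S where "S = {t0 - 2 * \<rho>..t0 + 2 * \<rho>} \<times> {x0 - 2 * \<rho>..x0 + 2 * \<rho>}"
  have S: "compact S" "S \<subseteq> \<Omega>" using \<rho>_int by (auto simp: S_def intro: compact_Times)
  have inS: "z \<in> S" if "fst z \<in> {0..T}" "w z < 2 * \<delta>" for z
  proof -
    have "N z \<le> (2 * \<rho>)\<^sup>2" using w_ge[OF that(1)] that(2) \<rho> by (simp add: \<delta>_def power_mult_distrib) (smt (verit) zero_le_power2)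
    from N_small[OF this] \<rho> show ?thesis by (cases z) (auto simp: S_def abs_le_iff)
  qed
  define m where "m v z = 2 * max 0 (\<delta> - v z)" for v :: "real \<times> real \<Rightarrow> real" and z
  \<comment> \<open>The derivative at \<open>z\<close>, in direction \<open>(x, y)\<close>, of the
    test function built from the average with index \<open>h\<close>. One formula for all directions
    serves the derivative, its limit and its bound.\<close>
  define X where "X h x y z = - (m (wn h) z * (\<sigma> * (- lavg h (\<lambda>y. f (u (fst z) y)) (snd z) * x + lavg h (u (fst z)) (snd z) * y - q * x - p * y)
      + (\<Lambda> + 1) * (2 * (fst z - t0) * x + 2 * (snd z - x0) * y)))" for h :: nat and x y z
  define \<eta> where "\<eta> n z = (if z \<in> \<Omega> then (max 0 (\<delta> - wn n z))\<^sup>2 else 0)" for n z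
  have der: "(\<eta> n has_derivative (\<lambda>h. X n (fst h) (snd h) z)) (at z)" if z: "z \<in> \<Omega>" for n z
  proof -
    have "(wn n has_derivative (\<lambda>h. \<sigma> * ((- lavg n (\<lambda>y. f (u (fst z) y)) (snd z) * fst h + lavg n (u (fst z)) (snd z) * snd h) - 0 - q * fst h - p * snd h)
        + (\<Lambda> + 1) * (2 * (fst z - t0) * fst h + 2 * (snd z - x0) * snd h))) (at z)"
      unfolding wn_def g_def[abs_def] N_def
      by (intro has_derivative_add has_derivative_diff has_derivative_mult_right has_derivative_const Wn_has_derivative z)
        (auto intro!: derivative_eq_intros simp: power2_eq_square)
    from has_derivative_compose[OF has_derivative_diff[OF has_derivative_const this] DERIV_max0_square[unfolded has_field_derivative_def], of \<delta>]
    have "((\<lambda>z. (max 0 (\<delta> - wn n z))\<^sup>2) has_derivative (\<lambda>h. X n (fst h) (snd h) z)) (at z)"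
      by (rule has_derivative_eq_rhs) (simp add: X_def m_def fun_eq_iff algebra_simps)
    then show ?thesis
      by (rule has_derivative_transform_within_open[OF _ open_\<Omega> z]) (simp add: \<eta>_def)
  qed
  have wn_cont: "continuous_on \<Omega> (wn n)" for n
    unfolding wn_def g_def[abs_def] N_def by (intro continuous_intros Wn_continuous_\<Omega>)
  have w_cont: "continuous_on \<Omega> w"
  proof -
    have "continuous_on \<Omega> (\<lambda>z. W (fst z) (snd z))"
      using continuous_on_subset[OF W_continuous, of \<Omega>] by (force simp: case_prod_unfold)
    then show ?thesis unfolding w_def g_def[abs_def] N_def by (intro continuous_intros)
  qed
  have wn_S: "z \<in> S" if "z \<in> \<Omega>" "wn n z < \<delta>" "n \<ge> n0" for z n
  proof (rule inS)
    show "fst z \<in> {0..T}" using that by auto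
    then show "w z < 2 * \<delta>" using wn_near[of z n] n0[OF that(3)] that(2) by linarith
  qed
  have \<eta>0: "\<eta> n z = 0" if "z \<notin> S" "n \<ge> n0" for z n
  proof (cases "z \<in> \<Omega>")
    case True
    then have "\<delta> \<le> wn n z" using wn_S[OF True _ that(2)] that(1) by (meson not_le)
    then show ?thesis by (simp add: \<eta>_def)
  qed (simp add: \<eta>_def)
  have \<eta>: "C1c_on \<Omega> (\<eta> n)" if n: "n \<ge> n0" for n
  proof (rule C1c_onI[OF open_\<Omega> S der])
    show "continuous_on \<Omega> (\<lambda>z. X n (fst v) (snd v) z)" for v
      unfolding X_def m_def by (intro continuous_intros lavg_continuous_\<Omega> wn_cont)
    show "\<eta> n z = 0" if "z \<notin> S" for z by (rule \<eta>0[OF that n])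
  qed
  let ?U = "\<lambda>z. u (fst z) (snd z)"
  have D\<eta>: "frechet_derivative (\<eta> n) (at z) v = (if z \<in> S then X n (fst v) (snd v) z else 0)" if n: "n \<ge> n0" for n z v
  proof (cases "z \<in> S")
    case True
    then have "z \<in> \<Omega>" using S by blast
    from frechet_derivative_at[OF der[OF this, of n], symmetric] True show ?thesis by simp
  next
    case False
    have "(\<eta> n has_derivative (\<lambda>_. 0)) (at z)"
    proof (rule has_derivative_transform_within_open[OF has_derivative_const[of 0]])
      show "open (- S)" using S(1) by (simp add: compact_imp_closed open_Compl)
      show "0 = \<eta> n y" if "y \<in> - S" for y
        using \<eta>0[of y n] that n by simp
    qed (use False in auto)
    from frechet_derivative_at[OF this, symmetric] False show ?thesis by simp
  qed
  define Xt where "Xt z = m w z * (\<sigma> * (f (?U z) + q) - 2 * (\<Lambda> + 1) * (fst z - t0))" for z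
  define Xx where "Xx z = m w z * (\<sigma> * (p - ?U z) - 2 * (\<Lambda> + 1) * (snd z - x0))" for z
  have m_lim: "(\<lambda>n. m (wn n) z) \<longlonglongrightarrow> m w z" if "z \<in> S" for z
  proof -
    have "fst z \<in> {0..T}" using that S by auto
    then show ?thesis unfolding m_def wn_def w_def g_def
      by (intro tendsto_intros Wn_tendsto)
  qed
  have X_lim: "(\<lambda>n. X n 1 0 z) \<longlonglongrightarrow> Xt z" "(\<lambda>n. X n 0 1 z) \<longlonglongrightarrow> Xx z" if "z \<in> S" for z
  proof -
    have z: "fst z \<in> {0<..T}" using that S by auto
    have "(\<lambda>n. X n x y z) \<longlonglongrightarrow> - (m w z * (\<sigma> * (- f (?U z) * x + ?U z * y - q * x - p * y)
      + (\<Lambda> + 1) * (2 * (fst z - t0) * x + 2 * (snd z - x0) * y)))" for x y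
      unfolding X_def by (intro tendsto_intros m_lim that u.lavg_slice_tendsto flux.lavg_slice_tendsto z)
    from this[of 1 0] this[of 0 1]
    show "(\<lambda>n. X n 1 0 z) \<longlonglongrightarrow> Xt z" "(\<lambda>n. X n 0 1 z) \<longlonglongrightarrow> Xx z"
      by (simp_all add: Xt_def Xx_def algebra_simps)
  qed
  \<comment> \<open>On \<open>S\<close> the weight is at most \<open>4 * \<delta>\<close>, because
    \<open>wn n z \<ge> - \<delta>\<close>; the factor \<open>4 * \<rho>\<close> is twice the
    half-width of \<open>S\<close>.\<close>
  define B where "B = 4 * \<delta> * (M + \<bar>q\<bar> + \<bar>p\<bar> + (\<Lambda> + 1) * (4 * \<rho>))"
  have X_bd: "\<bar>X n x y z\<bar> \<le> B" if z: "z \<in> S" and n: "n \<ge> n0" and xy: "(x, y) \<in> {(1, 0), (0, 1)}" for n z x y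
  proof -
    have zT: "fst z \<in> {0..T}" using z S by auto
    have "- \<delta> \<le> wn n z" using wn_near[OF zT, of n] n0[OF n] w_ge[OF zT] by (auto simp: N_def) (smt (verit) zero_le_power2)
    then have 1: "\<bar>m (wn n) z\<bar> \<le> 4 * \<delta>" using \<delta> by (auto simp: m_def)
    have 2: "\<bar>\<sigma> * v\<bar> = \<bar>v\<bar>" for v using \<sigma> by (simp add: abs_mult)
    have 3: "\<bar>- lavg n (\<lambda>y. f (u (fst z) y)) (snd z) * x + lavg n (u (fst z)) (snd z) * y - q * x - p * y\<bar> \<le> M + \<bar>q\<bar> + \<bar>p\<bar>"
      using xy u.lavg_slice_bound[OF zT, of n "snd z"] flux.lavg_slice_bound[OF zT, of n "snd z"] by auto
    have "\<bar>2 * (fst z - t0) * x + 2 * (snd z - x0) * y\<bar> \<le> 4 * \<rho>"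
      using z xy by (auto simp: S_def)
    then have 4: "\<bar>(\<Lambda> + 1) * (2 * (fst z - t0) * x + 2 * (snd z - x0) * y)\<bar> \<le> (\<Lambda> + 1) * (4 * \<rho>)"
      unfolding abs_mult[of "\<Lambda> + 1"] using \<open>0 \<le> \<Lambda>\<close> by (intro mult_mono) auto
    show ?thesis
      unfolding X_def abs_minus_cancel abs_mult[of "m _ _"] B_def
      using 1 3[folded 2[of "- lavg n (\<lambda>y. f (u (fst z) y)) (snd z) * x + lavg n (u (fst z)) (snd z) * y - q * x - p * y"]] 4
      by (intro mult_mono) (auto simp: \<delta>)
  qed
  have Bnn: "0 \<le> B" using \<delta> \<rho> u.M_nonneg \<open>0 \<le> \<Lambda>\<close> unfolding B_def by (intro mult_nonneg_nonneg add_nonneg_nonneg) auto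
  define l1 where "l1 z = (if z \<in> S then \<bar>?U z - p\<bar> * Xt z + sgn (?U z - p) * (f (?U z) - f p) * Xx z else 0)" for z
  define l2 where "l2 z = (if z \<in> S then Xt z else 0)" for z
  let ?t = "\<lambda>n z. frechet_derivative (\<eta> (n + n0)) (at z) (1, 0)" and ?x = "\<lambda>n z. frechet_derivative (\<eta> (n + n0)) (at z) (0, 1)"
  have n': "n0 \<le> n + n0" for n by simp
  note C1 = \<eta>[OF n'] and D = D\<eta>[OF n']
  define e where "e n z = \<bar>?U z - p\<bar> * ?t n z + sgn (?U z - p) * (f (?U z) - f p) * ?x n z" for n z
  have US: "\<bar>?U z\<bar> \<le> M" if "z \<in> S" for z using that S by (intro u.bound) auto
  have e_m: "e n \<in> borel_measurable borel" for n
  proof -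
    \<comment> \<open>On \<open>S\<close> the indicator is 1, and off \<open>S\<close> both
      derivatives vanish. Inserting it changes nothing but makes every factor Borel on the whole
      plane.\<close>
    let ?I = "indicator ({0<..T} \<times> UNIV) :: real \<times> real \<Rightarrow> real"
    have "(\<lambda>z. \<bar>?I z * ?U z - p\<bar> * ?t n z + sgn (?I z * ?U z - p) * (?I z * f (?U z) - f p) * ?x n z) \<in> borel_measurable borel"
      using u.strip_borel flux.strip_borel C1c_on_derivative_borel[OF C1[of n]] by measurable
    also have "(\<lambda>z. \<bar>?I z * ?U z - p\<bar> * ?t n z + sgn (?I z * ?U z - p) * (?I z * f (?U z) - f p) * ?x n z) = e n"
    proof
      fix z
      show "\<bar>?I z * ?U z - p\<bar> * ?t n z + sgn (?I z * ?U z - p) * (?I z * f (?U z) - f p) * ?x n z = e n z"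
      proof (cases "z \<in> S")
        case True
        then have "?I z = 1" using S(2) by auto
        then show ?thesis by (simp add: e_def)
      qed (simp add: e_def D)
    qed
    finally show ?thesis .
  qed
  have lim1: "(\<lambda>n. LINT z|lborel. e n z) \<longlonglongrightarrow> (LINT z|lborel. l1 z)" and i1: "integrable lborel l1"
  proof -
    have "e n z = 0" if "z \<notin> S" for n z using that by (simp add: e_def D)
    moreover have "\<bar>e n z\<bar> \<le> C * B" for n z
    proof (cases "z \<in> S")
      case True
      have "e n z = \<bar>?U z - p\<bar> * X (n + n0) 1 0 z + sgn (?U z - p) * (f (?U z) - f p) * X (n + n0) 0 1 z"
        using True by (simp add: e_def D)
      then have "\<bar>e n z\<bar> \<le> \<bar>\<bar>?U z - p\<bar> * X (n + n0) 1 0 z\<bar> + \<bar>sgn (?U z - p) * (f (?U z) - f p) * X (n + n0) 0 1 z\<bar>"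
        by (simp only: abs_triangle_ineq)
      also have "\<dots> = \<bar>?U z - p\<bar> * \<bar>X (n + n0) 1 0 z\<bar> + \<bar>sgn (?U z - p)\<bar> * \<bar>f (?U z) - f p\<bar> * \<bar>X (n + n0) 0 1 z\<bar>"
        by (simp only: abs_mult abs_idempotent)
      also have "\<dots> \<le> \<bar>?U z - p\<bar> * B + 1 * \<bar>f (?U z) - f p\<bar> * B"
        using Bnn by (intro add_mono mult_mono X_bd True n') (auto simp: sgn_if)
      also have "\<dots> = (\<bar>?U z - p\<bar> + \<bar>f (?U z) - f p\<bar>) * B" by (simp add: algebra_simps)
      also have "\<dots> \<le> C * B" using C[OF US[OF True]] Bnn by (rule mult_right_mono)
      finally show ?thesis .
    qed (simp add: e_def D Bnn Cnn)
    moreover have "(\<lambda>n. e n z) \<longlonglongrightarrow> l1 z" for z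
      using LIMSEQ_ignore_initial_segment[OF X_lim(1), of z n0] LIMSEQ_ignore_initial_segment[OF X_lim(2), of z n0]
      by (cases "z \<in> S") (auto simp: e_def D l1_def intro!: tendsto_intros)
    ultimately show "(\<lambda>n. LINT z|lborel. e n z) \<longlonglongrightarrow> (LINT z|lborel. l1 z)" "integrable lborel l1"
      using tendsto_integral_compact_support[OF S(1), of e "C * B" l1] e_m by blast+
  qed
  have lim2: "(\<lambda>n. LINT z|lborel. ?t n z) \<longlonglongrightarrow> (LINT z|lborel. l2 z)" and i2: "integrable lborel l2"
  proof -
    have "(\<lambda>n. ?t n z) \<longlonglongrightarrow> l2 z" for z
      using LIMSEQ_ignore_initial_segment[OF X_lim(1), of z n0] by (cases "z \<in> S") (auto simp: D l2_def)
    moreover have "\<bar>?t n z\<bar> \<le> B" for n z using X_bd[OF _ n'] Bnn by (simp add: D)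
    moreover have "?t n z = 0" if "z \<notin> S" for n z using that by (simp add: D)
    ultimately show "(\<lambda>n. LINT z|lborel. ?t n z) \<longlonglongrightarrow> (LINT z|lborel. l2 z)" "integrable lborel l2"
      using tendsto_integral_compact_support[OF S(1), of ?t B l2] C1c_on_derivative_borel[OF C1] by blast+
  qed
  have I2: "(LINT z|lborel. l2 z) = 0"
    using lim2 integral_derivative_\<Omega>[OF C1] by (simp add: LIMSEQ_const_iff)
  have I1: "0 \<le> (LINT z|lborel. l1 z)"
  proof (rule LIMSEQ_le_const[OF lim1], intro exI allI impI)
    fix n
    have "(LINT z:\<Omega>|lebesgue. e n z) = (LINT z|lborel. e n z)"
    proof (rule set_integral_lebesgue_eq_lborel[OF e_m])
      show "e n z = 0" if "z \<notin> \<Omega>" for z using that S(2) by (auto simp: e_def D)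
    qed
    then show "0 \<le> (LINT z|lborel. e n z)"
      using entropy[OF C1[of n], of p] unfolding e_def by (auto simp: \<eta>_def)
  qed
  define \<mu> where "\<mu> z = indicator \<Omega> z * m w z" for z
  have \<mu>_S: "\<mu> z = 0" if "z \<notin> S" for z
    using inS[of z] that \<delta> by (auto simp: \<mu>_def m_def indicator_def max_def)
  have \<mu>_nn: "0 \<le> \<mu> z" for z by (simp add: \<mu>_def m_def)
  have \<mu>_m: "\<mu> \<in> borel_measurable borel"
  proof -
    have "continuous_on \<Omega> (m w)" unfolding m_def by (intro continuous_intros w_cont)
    from borel_measurable_continuous_on_indicator[OF _ this] show ?thesis
      using open_\<Omega> by (simp add: \<mu>_def[abs_def])
  qed
  have \<mu>_le: "\<mu> z \<le> 2 * \<delta>" for z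
  proof (cases "z \<in> \<Omega>")
    case True
    then have "0 \<le> w z" using w_ge[of z] by (auto simp: N_def intro: order_trans[rotated])
    then show ?thesis using \<delta> by (auto simp: \<mu>_def m_def indicator_def)
  qed (use \<delta> in \<open>simp add: \<mu>_def\<close>)
  have \<mu>_i: "integrable lborel \<mu>"
    by (rule integrable_compact_support[OF \<mu>_m S(1), of "2 * \<delta>"]) (use \<mu>_nn \<mu>_le \<mu>_S in auto)
  \<comment> \<open>The weights \<open>L\<close> and \<open>a\<close> are chosen to cancel
    \<open>\<bar>v - p\<bar>\<close>: the entropy part contributes at most
    \<open>- a * \<bar>v - p\<bar>\<close> and the time derivative at most
    \<open>L * \<bar>v - p\<bar> - a\<close>, up to errors of order \<open>\<epsilon>\<close>. What
    remains is \<open>- a\<^sup>2\<close> plus \<open>(L * C + a) * \<epsilon>\<close>.\<close>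
  have pt: "L * l1 z + a * l2 z \<le> - (a\<^sup>2 - (L * C + a) * \<epsilon>) * \<mu> z" for z
  proof (cases "z \<in> S")
    case False
    then show ?thesis by (simp add: l1_def l2_def \<mu>_S)
  next
    case True
    then have z: "z \<in> \<Omega>" "fst z \<in> {0..T}" using S by auto
    define v where "v = ?U z"
    have v: "\<bar>v\<bar> \<le> M" using US[OF True] by (simp add: v_def)
    define P where "P = - (2 * (\<Lambda> + 1) * (fst z - t0))"
    define Q where "Q = - (2 * (\<Lambda> + 1) * (snd z - x0))"
    have mz: "\<mu> z = m w z" using z by (simp add: \<mu>_def)
    show ?thesis
    proof (cases "w z < \<delta>")
      case False
      then have "m w z = 0" by (simp add: m_def)
      then show ?thesis by (simp add: l1_def l2_def Xt_def Xx_def mz)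
    next
      case w: True
      have "N z \<le> \<rho>\<^sup>2" using w_ge[OF z(2)] w by (simp add: \<delta>_def)
      note Ns = N_small[OF this less_imp_le[OF \<rho>]]
      have PQ: "\<bar>P\<bar> \<le> \<epsilon>" "\<bar>Q\<bar> \<le> \<epsilon>"
        unfolding P_def Q_def \<epsilon>_def abs_minus_cancel abs_mult[of "2 * (\<Lambda> + 1)"] using Ns \<open>0 \<le> \<Lambda>\<close>
        by (auto intro!: mult_left_mono)
      have s: "sgn (v - p) * (p - v) = - \<bar>v - p\<bar>" by (simp add: sgn_if)
      \<comment> \<open>This is where the choice \<open>k = p\<close> pays off: as
        \<open>sgn (v - p) * (p - v)\<close> equals \<open>- \<bar>v - p\<bar>\<close>, the two
        occurrences of \<open>f v\<close> cancel and only
        \<open>\<sigma> * (q + f p) * \<bar>v - p\<bar>\<close> is left besides the penalty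
        terms.\<close>
      have "\<bar>v - p\<bar> * (\<sigma> * (f v + q) + P) + sgn (v - p) * (f v - f p) * (\<sigma> * (p - v) + Q)
          = \<sigma> * (f v + q) * \<bar>v - p\<bar> + \<sigma> * (f v - f p) * (sgn (v - p) * (p - v)) + (\<bar>v - p\<bar> * P + sgn (v - p) * (f v - f p) * Q)"
        by (simp add: algebra_simps)
      also have "\<dots> = - a * \<bar>v - p\<bar> + (\<bar>v - p\<bar> * P + sgn (v - p) * (f v - f p) * Q)"
        unfolding s a_def by (simp add: algebra_simps)
      also have "\<bar>v - p\<bar> * P + sgn (v - p) * (f v - f p) * Q \<le> \<bar>v - p\<bar> * \<epsilon> + \<bar>f v - f p\<bar> * \<epsilon>"
      proof (rule add_mono)
        show "\<bar>v - p\<bar> * P \<le> \<bar>v - p\<bar> * \<epsilon>" using PQ by (intro mult_left_mono) auto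
        have "sgn (v - p) * (f v - f p) * Q \<le> \<bar>sgn (v - p)\<bar> * \<bar>f v - f p\<bar> * \<bar>Q\<bar>"
          unfolding abs_mult[symmetric] by (rule abs_ge_self)
        also have "\<dots> \<le> 1 * \<bar>f v - f p\<bar> * \<epsilon>" using PQ by (intro mult_mono) (auto simp: sgn_if)
        finally show "sgn (v - p) * (f v - f p) * Q \<le> \<bar>f v - f p\<bar> * \<epsilon>" by simp
      qed
      also have "\<bar>v - p\<bar> * \<epsilon> + \<bar>f v - f p\<bar> * \<epsilon> \<le> C * \<epsilon>"
        unfolding distrib_right[symmetric] using C[OF v] PQ by (intro mult_right_mono) auto
      finally have 1: "\<bar>v - p\<bar> * (\<sigma> * (f v + q) + P) + sgn (v - p) * (f v - f p) * (\<sigma> * (p - v) + Q) \<le> - a * \<bar>v - p\<bar> + C * \<epsilon>"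
        by simp
      have "\<sigma> * (f v + q) + P = \<sigma> * (f v - f p) - a + P" by (simp add: a_def algebra_simps)
      also have "\<dots> \<le> L * \<bar>v - p\<bar> - a + \<epsilon>"
      proof -
        have "\<sigma> * (f v - f p) \<le> \<bar>f v - f p\<bar>" using abs_ge_self[of "\<sigma> * (f v - f p)"] \<sigma> by (simp add: abs_mult)
        then show ?thesis using L[OF v] PQ(1) by linarith
      qed
      finally have 2: "\<sigma> * (f v + q) + P \<le> L * \<bar>v - p\<bar> - a + \<epsilon>" .
      have "L * (\<bar>v - p\<bar> * (\<sigma> * (f v + q) + P) + sgn (v - p) * (f v - f p) * (\<sigma> * (p - v) + Q)) + a * (\<sigma> * (f v + q) + P)
          \<le> L * (- a * \<bar>v - p\<bar> + C * \<epsilon>) + a * (L * \<bar>v - p\<bar> - a + \<epsilon>)"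
        by (rule add_mono[OF mult_left_mono[OF 1 Lnn] mult_left_mono[OF 2 less_imp_le[OF a]]])
      also have "\<dots> = - (a\<^sup>2 - (L * C + a) * \<epsilon>)" by (simp add: algebra_simps power2_eq_square)
      finally have fin: "(L * (\<bar>v - p\<bar> * (\<sigma> * (f v + q) + P) + sgn (v - p) * (f v - f p) * (\<sigma> * (p - v) + Q)) + a * (\<sigma> * (f v + q) + P)) * \<mu> z
          \<le> - (a\<^sup>2 - (L * C + a) * \<epsilon>) * \<mu> z"
        by (rule mult_right_mono[OF _ \<mu>_nn])
      have Xs: "Xt z = \<mu> z * (\<sigma> * (f v + q) + P)" "Xx z = \<mu> z * (\<sigma> * (p - v) + Q)"
        by (simp_all add: Xt_def Xx_def P_def Q_def mz v_def)
      have "L * l1 z + a * l2 z = (L * (\<bar>v - p\<bar> * (\<sigma> * (f v + q) + P) + sgn (v - p) * (f v - f p) * (\<sigma> * (p - v) + Q))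
          + a * (\<sigma> * (f v + q) + P)) * \<mu> z"
        unfolding l1_def l2_def Xs v_def[symmetric] using True by (simp only: if_True) (simp add: algebra_simps)
      with fin show ?thesis by simp
    qed
  qed
  have "0 \<le> L * (LINT z|lborel. l1 z) + a * (LINT z|lborel. l2 z)" using I1 I2 Lnn by simp
  also have "\<dots> = (LINT z|lborel. L * l1 z + a * l2 z)" using i1 i2 by simp
  also have "\<dots> \<le> (LINT z|lborel. - (a\<^sup>2 - (L * C + a) * \<epsilon>) * \<mu> z)"
    by (intro integral_mono pt Bochner_Integration.integrable_add integrable_mult_right i1 i2 \<mu>_i)
  also have "\<dots> = - (a\<^sup>2 - (L * C + a) * \<epsilon>) * (LINT z|lborel. \<mu> z)" by simp
  finally have "(a\<^sup>2 - (L * C + a) * \<epsilon>) * (LINT z|lborel. \<mu> z) \<le> 0" by (simp only: mult_minus_left neg_0_le_iff_le)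
  then have "(LINT z|lborel. \<mu> z) \<le> 0" using mult_pos_pos[OF \<kappa>] by (meson not_le)
  moreover have "0 \<le> (LINT z|lborel. \<mu> z)" using \<mu>_nn by (intro integral_nonneg_AE) auto
  ultimately have "(LINT z|lborel. \<mu> z) = 0" by simp
  then have AE: "AE z in lborel. \<mu> z = 0"
    using integral_nonneg_eq_0_iff_AE[OF \<mu>_i] \<mu>_nn by auto
  \<comment> \<open>The weight is positive on \<open>Z\<close>, an open neighbourhood of the
    touching point, and yet zero almost everywhere.\<close>
  define Z where "Z = w -` {..<\<delta>} \<inter> \<Omega>"
  have "open Z" unfolding Z_def
    using continuous_on_open_vimage[OF open_\<Omega>, of w] w_cont by auto
  moreover have "(t0, x0) \<in> Z" using w0 \<delta> t0 by (simp add: Z_def)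
  moreover have "negligible Z"
  proof -
    have "AE z in lebesgue. z \<notin> Z"
      using AE_completion[OF AE] by (rule AE_mp) (auto simp: Z_def \<mu>_def m_def)
    moreover have "Z \<in> sets lebesgue" using \<open>open Z\<close> by (simp add: borel_open)
    ultimately show ?thesis by (simp add: negligible_iff_null_sets AE_iff_null_sets)
  qed
  ultimately show False using open_not_negligible by blast
qed

end

section \<open>From smooth touching functions to quadratic bounds\<close>

lemma differentiable_imp_lipschitz_at:
  fixes g :: "'a::real_normed_vector \<Rightarrow> real"
  assumes "g differentiable (at z)"
  obtains K r where "0 \<le> K" "0 < r" "\<And>y. norm (y - z) < r \<Longrightarrow> \<bar>g y - g z\<bar> \<le> K * norm (y - z)"
proof -
  obtain D where D: "(g has_derivative D) (at z)" using assms by (auto simp: differentiable_def)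
  then interpret D: bounded_linear D by (rule has_derivative_bounded_linear)
  obtain B where B: "0 \<le> B" "\<And>h. norm (D h) \<le> norm h * B" using D.nonneg_bounded by blast
  obtain r where r: "0 < r" "\<And>y. norm (y - z) < r \<Longrightarrow> norm (g y - g z - D (y - z)) \<le> 1 * norm (y - z)"
    using D[unfolded has_derivative_at_alt, THEN conjunct2, rule_format, of 1] by auto
  have "\<bar>g y - g z\<bar> \<le> (B + 1) * norm (y - z)" if "norm (y - z) < r" for y
    using r(2)[OF that] B(2)[of "y - z"] by (simp add: algebra_simps)
  then show thesis using that[of "B + 1" r] B(1) r(1) by auto
qed

text \<open>The mean value theorem along the segment expresses the remainder through increments of
  the two first partials. These are bounded linearly in the distance, since both partials are
  differentiable at the base point.\<close>

lemma Ck2_quadratic_remainder: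
  fixes \<phi> :: "real \<times> real \<Rightarrow> real"
  assumes "open \<Omega>" and \<phi>: "Ck_on 2 \<Omega> \<phi>" and z: "(t0, x0) \<in> \<Omega>"
  defines "q \<equiv> frechet_derivative \<phi> (at (t0, x0)) (1, 0)" and "p \<equiv> frechet_derivative \<phi> (at (t0, x0)) (0, 1)"
  obtains K r where "0 \<le> K" "0 < r"
    "\<And>t x. norm (t - t0, x - x0) < r \<Longrightarrow>
      \<bar>\<phi> (t, x) - \<phi> (t0, x0) - q * (t - t0) - p * (x - x0)\<bar> \<le> K * ((t - t0)\<^sup>2 + (x - x0)\<^sup>2)"
proof -
  let ?D = "\<lambda>y. frechet_derivative \<phi> (at y)"
  have \<phi>1: "\<phi> differentiable (at y)" if "y \<in> \<Omega>" for y
    using \<phi> that by (simp add: numeral_2_eq_2)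
  have \<phi>2: "(\<lambda>y. ?D y v) differentiable (at (t0, x0))" for v
    using \<phi> z by (simp add: numeral_2_eq_2 del: split_paired_All)
  obtain r1 where r1: "0 < r1" "ball (t0, x0) r1 \<subseteq> \<Omega>" using \<open>open \<Omega>\<close> z openE by blast
  obtain K2 r2 where 2: "0 \<le> K2" "0 < r2" "\<And>y. norm (y - (t0, x0)) < r2 \<Longrightarrow> \<bar>?D y (1, 0) - q\<bar> \<le> K2 * norm (y - (t0, x0))"
    using differentiable_imp_lipschitz_at[OF \<phi>2[of "(1, 0)"]] unfolding q_def by metis
  obtain K3 r3 where 3: "0 \<le> K3" "0 < r3" "\<And>y. norm (y - (t0, x0)) < r3 \<Longrightarrow> \<bar>?D y (0, 1) - p\<bar> \<le> K3 * norm (y - (t0, x0))"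
    using differentiable_imp_lipschitz_at[OF \<phi>2[of "(0, 1)"]] unfolding p_def by metis
  show thesis
  proof (rule that[of "K2 + K3" "min r1 (min r2 r3)"])
    fix t x assume *: "norm (t - t0, x - x0) < min r1 (min r2 r3)"
    let ?h = "(t - t0, x - x0)" and ?y = "\<lambda>s. (t0, x0) + s *\<^sub>R (t - t0, x - x0)"
    have near: "norm (?y s - (t0, x0)) \<le> norm ?h" if "0 \<le> s" "s \<le> 1" for s
    proof -
      have "norm (?y s - (t0, x0)) = \<bar>s\<bar> * norm ?h"
        unfolding add_diff_cancel_left' by (rule norm_scaleR)
      also have "\<dots> \<le> 1 * norm ?h" using that by (intro mult_right_mono) auto
      finally show ?thesis by simp
    qed
    have in_\<Omega>: "y \<in> \<Omega>" if "norm (y - (t0, x0)) \<le> norm ?h" for y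
    proof -
      have "dist y (t0, x0) < r1" using that * unfolding dist_norm by linarith
      then show ?thesis using r1(2) by (auto simp: dist_commute)
    qed
    have "\<exists>s. 0 < s \<and> s < 1 \<and> \<phi> (?y 1) - \<phi> (?y 0) = (1 - 0) * ?D (?y s) ?h"
    proof (rule MVT2)
      fix s :: real assume s: "0 \<le> s" "s \<le> 1"
      have "?y s \<in> \<Omega>" using near[OF s] by (rule in_\<Omega>)
      then have d: "(\<phi> has_derivative ?D (?y s)) (at (?y s))"
        using \<phi>1 frechet_derivative_works by blast
      have "((\<lambda>s. \<phi> (?y s)) has_derivative (\<lambda>r. ?D (?y s) (r *\<^sub>R ?h))) (at s)"
        by (rule has_derivative_compose[where f="\<lambda>s. ?y s", OF _ d]) (auto intro!: derivative_eq_intros)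
      moreover have "?D (?y s) (r *\<^sub>R ?h) = ?D (?y s) ?h * r" for r
        using linear_scale[OF has_derivative_linear[OF d], of r ?h] by (simp only: real_scaleR_def mult.commute)
      ultimately show "((\<lambda>s. \<phi> (?y s)) has_real_derivative ?D (?y s) ?h) (at s)"
        by (simp only: has_field_derivative_def)
    qed simp
    then obtain s where s: "0 < s" "s < 1" and eq: "\<phi> (?y 1) - \<phi> (?y 0) = ?D (?y s) ?h" by auto
    note near_s = near[OF less_imp_le[OF s(1)] less_imp_le[OF s(2)]]
    have "?y s \<in> \<Omega>" using near_s by (rule in_\<Omega>)
    then have lin: "linear (?D (?y s))" using \<phi>1 frechet_derivative_works has_derivative_linear by blast
    have "?h = (t - t0) *\<^sub>R (1, 0) + (x - x0) *\<^sub>R (0, 1)" by simp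
    then have split: "?D (?y s) ?h = (t - t0) * ?D (?y s) (1, 0) + (x - x0) * ?D (?y s) (0, 1)"
      using linear_add[OF lin] linear_scale[OF lin] by (metis real_scaleR_def)
    have y1: "?y 1 = (t, x)" and y0: "?y 0 = (t0, x0)" by simp_all
    have "\<phi> (t, x) - \<phi> (t0, x0) - q * (t - t0) - p * (x - x0)
        = (t - t0) * (?D (?y s) (1, 0) - q) + (x - x0) * (?D (?y s) (0, 1) - p)"
      using eq unfolding split y1 y0 by (simp add: algebra_simps)
    also have "\<bar>\<dots>\<bar> \<le> \<bar>t - t0\<bar> * \<bar>?D (?y s) (1, 0) - q\<bar> + \<bar>x - x0\<bar> * \<bar>?D (?y s) (0, 1) - p\<bar>"
      unfolding abs_mult[symmetric] by (rule abs_triangle_ineq)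
    also have "\<dots> \<le> norm ?h * (K2 * norm ?h) + norm ?h * (K3 * norm ?h)"
    proof (intro add_mono mult_mono)
      show "\<bar>t - t0\<bar> \<le> norm ?h" using norm_fst_le[of "t - t0" "x - x0"] by simp
      show "\<bar>x - x0\<bar> \<le> norm ?h" using norm_snd_le[of "x - x0" "t - t0"] by simp
      show "\<bar>?D (?y s) (1, 0) - q\<bar> \<le> K2 * norm ?h"
        using 2(3)[of "?y s"] near_s * mult_left_mono[OF near_s 2(1)] by linarith
      show "\<bar>?D (?y s) (0, 1) - p\<bar> \<le> K3 * norm ?h"
        using 3(3)[of "?y s"] near_s * mult_left_mono[OF near_s 3(1)] by linarith
    qed auto
    also have "\<dots> = (K2 + K3) * (norm ?h)\<^sup>2" by (simp add: algebra_simps power2_eq_square)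
    also have "(norm ?h)\<^sup>2 = (t - t0)\<^sup>2 + (x - x0)\<^sup>2" by (simp add: norm_Pair)
    finally show "\<bar>\<phi> (t, x) - \<phi> (t0, x0) - q * (t - t0) - p * (x - x0)\<bar> \<le> (K2 + K3) * ((t - t0)\<^sup>2 + (x - x0)\<^sup>2)" .
  qed (use 2 3 r1 in auto)
qed

text \<open>\<open>touching_inequality\<close> asks for a quadratic bound on the whole strip, while
  the touching is local. Near the point the bound is the second-order remainder of
  \<open>\<phi>\<close>; far away a quadratic beats the linear growth of the Lipschitz
  potential.\<close>

lemma (in entropy_strip) touching_smooth:
  assumes lip: "\<And>R. \<exists>L. \<forall>x y. \<bar>x\<bar> \<le> R \<longrightarrow> \<bar>y\<bar> \<le> R \<longrightarrow> \<bar>f x - f y\<bar> \<le> L * \<bar>x - y\<bar>"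
    and \<phi>: "Ck_on 2 \<Omega> \<phi>" and t0: "t0 \<in> {0<..<T}" and \<sigma>: "\<bar>\<sigma>\<bar> = 1"
    and touch: "\<forall>\<^sub>F (t, x) in nhds (t0, x0). \<sigma> * (W t0 x0 - \<phi> (t0, x0)) \<le> \<sigma> * (W t x - \<phi> (t, x))"
  shows "0 \<le> \<sigma> * (frechet_derivative \<phi> (at (t0, x0)) (1, 0) + f (frechet_derivative \<phi> (at (t0, x0)) (0, 1)))"
proof -
  define q where "q = frechet_derivative \<phi> (at (t0, x0)) (1, 0)"
  define p where "p = frechet_derivative \<phi> (at (t0, x0)) (0, 1)"
  have z: "(t0, x0) \<in> \<Omega>" using t0 by simp
  obtain K r1 where K: "0 \<le> K" "0 < r1" "\<And>t x. norm (t - t0, x - x0) < r1 \<Longrightarrow>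
      \<bar>\<phi> (t, x) - \<phi> (t0, x0) - q * (t - t0) - p * (x - x0)\<bar> \<le> K * ((t - t0)\<^sup>2 + (x - x0)\<^sup>2)"
    using Ck2_quadratic_remainder[OF open_\<Omega> \<phi> z] unfolding q_def p_def by blast
  obtain r2 where r2: "0 < r2" "\<And>t x. norm (t - t0, x - x0) < r2 \<Longrightarrow>
      \<sigma> * (W t0 x0 - \<phi> (t0, x0)) \<le> \<sigma> * (W t x - \<phi> (t, x))"
    using touch unfolding eventually_nhds_metric dist_norm by (auto simp: split_paired_all)
  define r where "r = min r1 r2"
  have r: "0 < r" using K(2) r2(1) by (simp add: r_def)
  \<comment> \<open>\<open>K\<close> serves distances \<open>s < r\<close>. For
    \<open>s \<ge> r\<close> the deviation from the affine function is at most
    \<open>(2 * M + \<bar>q\<bar> + \<bar>p\<bar>) * s\<close>, and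
    \<open>s \<le> s\<^sup>2 / r\<close>.\<close>
  define \<Lambda> where "\<Lambda> = K + (2 * M + \<bar>q\<bar> + \<bar>p\<bar>) / r"
  have \<Lambda>: "0 \<le> \<Lambda>" using K(1) u.M_nonneg r by (simp add: \<Lambda>_def)
  have \<sigma>_le: "- \<bar>v\<bar> \<le> \<sigma> * v" for v using abs_ge_minus_self[of "\<sigma> * v"] \<sigma> by (simp add: abs_mult)
  have "- \<Lambda> * ((t - t0)\<^sup>2 + (x - x0)\<^sup>2) \<le> \<sigma> * (W t x - W t0 x0 - q * (t - t0) - p * (x - x0))"
    if t: "t \<in> {0..T}" for t x
  proof -
    define s where "s = norm (t - t0, x - x0)"
    have s2: "(t - t0)\<^sup>2 + (x - x0)\<^sup>2 = s\<^sup>2" by (simp add: s_def norm_Pair)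
    have s: "\<bar>t - t0\<bar> \<le> s" "\<bar>x - x0\<bar> \<le> s"
      using norm_fst_le[of "t - t0" "x - x0"] norm_snd_le[of "x - x0" "t - t0"] by (auto simp: s_def)
    show ?thesis
    proof (cases "s < r")
      case True
      define R where "R = \<phi> (t, x) - \<phi> (t0, x0) - q * (t - t0) - p * (x - x0)"
      have "\<bar>R\<bar> \<le> K * s\<^sup>2" using K(3)[of t x] True unfolding R_def s2 by (simp add: s_def r_def)
      moreover have "K * s\<^sup>2 \<le> \<Lambda> * s\<^sup>2" using u.M_nonneg r by (intro mult_right_mono) (auto simp: \<Lambda>_def)
      moreover have "\<sigma> * (W t x - W t0 x0 - q * (t - t0) - p * (x - x0))
          = (\<sigma> * (W t x - \<phi> (t, x)) - \<sigma> * (W t0 x0 - \<phi> (t0, x0))) + \<sigma> * R"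
        by (simp add: R_def algebra_simps)
      ultimately show ?thesis
        using r2(2)[of t x] True \<sigma>_le[of R] unfolding s2 by (simp add: s_def r_def)
    next
      case False
      define D where "D = W t x - W t0 x0 - q * (t - t0) - p * (x - x0)"
      have "\<bar>W t x - W t x0\<bar> \<le> M * \<bar>x - x0\<bar>" by (rule W_lipschitz_space[OF t])
      moreover have "\<bar>W t x0 - W t0 x0\<bar> \<le> M * \<bar>t - t0\<bar>" using t t0 by (intro W_lipschitz_time) auto
      ultimately have "\<bar>D\<bar> \<le> M * \<bar>x - x0\<bar> + M * \<bar>t - t0\<bar> + \<bar>q\<bar> * \<bar>t - t0\<bar> + \<bar>p\<bar> * \<bar>x - x0\<bar>"
        unfolding D_def abs_mult[symmetric] by linarith
      also have "\<dots> \<le> M * s + M * s + \<bar>q\<bar> * s + \<bar>p\<bar> * s"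
        using s u.M_nonneg by (intro add_mono mult_left_mono) auto
      also have "\<dots> = ((2 * M + \<bar>q\<bar> + \<bar>p\<bar>) / r) * (r * s)" using r by (simp add: field_simps)
      also have "\<dots> \<le> ((2 * M + \<bar>q\<bar> + \<bar>p\<bar>) / r) * (s * s)"
        using False r u.M_nonneg by (intro mult_left_mono mult_right_mono) auto
      also have "\<dots> \<le> \<Lambda> * s\<^sup>2"
        unfolding power2_eq_square using K(1) by (intro mult_right_mono) (auto simp: \<Lambda>_def)
      finally show ?thesis using \<sigma>_le[of D] unfolding s2 D_def[symmetric] by linarith
    qed
  qed
  from touching_inequality[OF lip t0 \<sigma> \<Lambda> this] show ?thesis
    unfolding q_def p_def .
qed

section \<open>Regularity of the potential\<close>

lemma absolutely_integrable_bounded: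
  fixes w :: "'a::euclidean_space \<Rightarrow> real"
  assumes "w \<in> borel_measurable (lebesgue_on K)" "K \<in> lmeasurable" "\<And>x. x \<in> K \<Longrightarrow> \<bar>w x\<bar> \<le> B"
  shows "w absolutely_integrable_on K"
  by (rule measurable_bounded_by_integrable_imp_absolutely_integrable[where g="\<lambda>_. B"])
    (use assms in \<open>auto simp: integrable_on_const fmeasurableD\<close>)

lemma absolutely_integrable_on_compact:
  fixes w :: "'a::euclidean_space \<Rightarrow> real"
  assumes "compact K" "continuous_on K w"
  shows "w absolutely_integrable_on K" and "Linf_on K w"
proof -
  have m: "w \<in> borel_measurable (lebesgue_on K)"
    using assms by (intro continuous_imp_measurable_on_sets_lebesgue lmeasurable_compact fmeasurableD)
  have "bounded (w ` K)" by (intro compact_imp_bounded compact_continuous_image assms)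
  then obtain B where B: "\<And>x. x \<in> K \<Longrightarrow> \<bar>w x\<bar> \<le> B" unfolding bounded_iff by auto
  show "w absolutely_integrable_on K"
    using m B assms(1) by (intro absolutely_integrable_bounded lmeasurable_compact) auto
  show "Linf_on K w" unfolding Linf_on_def using m B by (auto intro!: exI[of _ B])
qed

text \<open>For differences \<open>d\<close> bounded by \<open>2 * M\<close> one has
  \<open>\<bar>d\<bar> powr p \<le> (2 * M) powr (p - 1) * \<bar>d\<bar>\<close>, so L^1 continuity
  of a bounded function implies continuity for every finite exponent.\<close>

lemma (in entropy_strip) C0_Lp_loc_bounded:
  assumes "1 \<le> p"
  shows "C0_Lp_loc p T u"
  unfolding C0_Lp_loc_def
proof (intro ballI conjI allI impI)
  fix t R :: real assume t: "t \<in> {0..T}"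
  show "u t \<in> borel_measurable lebesgue" by (rule u.slice_meas[OF t])
  assume R: "0 < R"
  \<comment> \<open>The factor \<open>c\<close> treats two cases together: 0 for the integrability
    of a slice, 1 for the difference of two slices.\<close>
  have ai: "(\<lambda>x. \<bar>u s x - c * u t x\<bar> powr p) absolutely_integrable_on {-R..R}" if "s \<in> {0..T}" "\<bar>c\<bar> \<le> 1" for s c
  proof (rule absolutely_integrable_bounded[where B="(2 * M) powr p"])
    show "(\<lambda>x. \<bar>u s x - c * u t x\<bar> powr p) \<in> borel_measurable (lebesgue_on {-R..R})"
      by (intro measurable_restrict_space1 measurable_abs_powr borel_measurable_diff
          borel_measurable_times borel_measurable_const u.slice_meas that t)
    have "\<bar>c * u t x\<bar> \<le> 1 * M" for x unfolding abs_mult using that by (intro mult_mono u.bound t) auto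
    then have "\<bar>u s x - c * u t x\<bar> \<le> 2 * M" for x using u.bound[OF that(1), of x] by (smt (verit))
    then show "\<bar>\<bar>u s x - c * u t x\<bar> powr p\<bar> \<le> (2 * M) powr p" for x using \<open>1 \<le> p\<close> by (simp add: powr_mono2)
  qed auto
  show "set_integrable lebesgue {-R..R} (\<lambda>x. \<bar>u t x\<bar> powr p)" using ai[OF t, of 0] by simp
  show "((\<lambda>s. LINT x:{-R..R}|lebesgue. \<bar>u s x - u t x\<bar> powr p) \<longlongrightarrow> 0) (at t within {0..T})"
  proof (rule Lim_null_comparison)
    show "((\<lambda>s. (2 * M) powr (p - 1) * integral {-R..R} (\<lambda>x. \<bar>u s x - u t x\<bar>)) \<longlongrightarrow> 0) (at t within {0..T})"
      using tendsto_mult[OF tendsto_const u.L1_cont[OF t R]] by simp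
    have "norm (LINT x:{-R..R}|lebesgue. \<bar>u s x - u t x\<bar> powr p)
        \<le> (2 * M) powr (p - 1) * integral {-R..R} (\<lambda>x. \<bar>u s x - u t x\<bar>)" if s: "s \<in> {0..T}" for s
    proof -
      have i: "(\<lambda>x. \<bar>u s x - u t x\<bar> powr p) absolutely_integrable_on {-R..R}" using ai[OF s, of 1] by simp
      have j: "(\<lambda>x. \<bar>u s x - u t x\<bar>) integrable_on {-R..R}"
        by (intro set_lebesgue_integral_eq_integral(1) set_integrable_abs set_integral_diff u.slice_abs_integrable s t)
      have "(LINT x:{-R..R}|lebesgue. \<bar>u s x - u t x\<bar> powr p) = integral {-R..R} (\<lambda>x. \<bar>u s x - u t x\<bar> powr p)"
        by (rule set_lebesgue_integral_eq_integral(2)[OF i])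
      also have "norm \<dots> \<le> integral {-R..R} (\<lambda>x. (2 * M) powr (p - 1) * \<bar>u s x - u t x\<bar>)"
      proof (rule integral_norm_bound_integral[OF set_lebesgue_integral_eq_integral(1)[OF i]])
        show "(\<lambda>x. (2 * M) powr (p - 1) * \<bar>u s x - u t x\<bar>) integrable_on {-R..R}"
          using j by (rule integrable_on_mult_right)
        fix x
        have d: "\<bar>u s x - u t x\<bar> \<le> 2 * M" using u.bound[OF s, of x] u.bound[OF t, of x] by linarith
        have "\<bar>u s x - u t x\<bar> powr p = \<bar>u s x - u t x\<bar> powr (p - 1) * \<bar>u s x - u t x\<bar>"
          by (cases "u s x = u t x") (simp_all add: powr_diff)
        also have "\<dots> \<le> (2 * M) powr (p - 1) * \<bar>u s x - u t x\<bar>"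
          using \<open>1 \<le> p\<close> d by (intro mult_right_mono powr_mono2) auto
        finally show "norm (\<bar>u s x - u t x\<bar> powr p) \<le> (2 * M) powr (p - 1) * \<bar>u s x - u t x\<bar>" by simp
      qed
      finally show ?thesis by simp
    qed
    then show "\<forall>\<^sub>F s in at t within {0..T}. norm (LINT x:{-R..R}|lebesgue. \<bar>u s x - u t x\<bar> powr p)
        \<le> (2 * M) powr (p - 1) * integral {-R..R} (\<lambda>x. \<bar>u s x - u t x\<bar>)"
      unfolding eventually_at_filter by (intro always_eventually allI impI)
  qed
qed

lemma (in entropy_strip) hj_regular_W:
  assumes U: "\<And>t x. t \<in> {0..T} \<Longrightarrow> U t x = W t x + c"
  shows "hj_regular T U"
  unfolding hj_regular_def
proof (intro conjI ballI)
  have "continuous_on ({0..T} \<times> UNIV) (\<lambda>p. (case p of (t, x) \<Rightarrow> W t x) + c)"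
    by (intro continuous_intros W_continuous)
  then show Uc: "continuous_on ({0..T} \<times> UNIV) (\<lambda>(t, x). U t x)"
    by (rule continuous_on_eq) (auto simp: U)
  fix v :: "real \<times> real"
  let ?I = "indicator ({0<..T} \<times> UNIV) :: real \<times> real \<Rightarrow> real"
  \<comment> \<open>The gradient \<open>(- f u, u)\<close> paired with \<open>v\<close>, set to zero
    at time 0 so as to be Borel on the whole plane.\<close>
  define g where "g p = - (?I p * f (u (fst p) (snd p))) * fst v + (?I p * u (fst p) (snd p)) * snd v" for p
  define G where "G = M * \<bar>fst v\<bar> + M * \<bar>snd v\<bar>"
  have gm: "g \<in> borel_measurable borel"
    unfolding g_def using u.strip_borel flux.strip_borel by measurable
  have gG: "\<bar>g p\<bar> \<le> G" for p
  proof (cases "fst p \<in> {0<..T}")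
    case True
    then have 1: "\<bar>u (fst p) (snd p)\<bar> \<le> M" "\<bar>f (u (fst p) (snd p))\<bar> \<le> M"
      using u.bound[of "fst p"] flux.bound[of "fst p"] by auto
    have "p \<in> {0<..T} \<times> UNIV" using True by (cases p) auto
    then have "\<bar>g p\<bar> \<le> \<bar>f (u (fst p) (snd p))\<bar> * \<bar>fst v\<bar> + \<bar>u (fst p) (snd p)\<bar> * \<bar>snd v\<bar>"
      unfolding abs_mult[symmetric] g_def by simp
    also have "\<dots> \<le> G" unfolding G_def using 1 by (intro add_mono mult_right_mono) auto
    finally show ?thesis .
  next
    case False
    then have "p \<notin> {0<..T} \<times> UNIV" by (cases p) auto
    then show ?thesis using u.M_nonneg by (simp add: g_def G_def)
  qed
  have gmS: "g \<in> borel_measurable (lebesgue_on S)" for S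
    using gm by (intro measurable_restrict_space1 measurable_completion) simp
  have "Linf_on ({0..T} \<times> UNIV) g"
    unfolding Linf_on_def using gmS gG by (intro conjI exI[of _ G]) auto
  moreover have "weak_deriv \<Omega> v (\<lambda>(t, x). U t x) g"
    unfolding weak_deriv_def L1_loc_def
  proof (intro conjI allI impI; (elim conjE)?)
    fix K :: "(real \<times> real) set" assume K: "compact K" "K \<subseteq> \<Omega>"
    then have "K \<subseteq> {0..T} \<times> UNIV" by auto
    from absolutely_integrable_on_compact(1)[OF K(1) continuous_on_subset[OF Uc this]]
    show "(\<lambda>(t, x). U t x) absolutely_integrable_on K" .
    show "g absolutely_integrable_on K"
      using gmS gG K(1) by (intro absolutely_integrable_bounded lmeasurable_compact) auto
  next
    fix \<phi> assume \<phi>: "C1c_on \<Omega> \<phi>"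
    have "(LINT p:\<Omega>|lebesgue. (case p of (t, x) \<Rightarrow> U t x) * frechet_derivative \<phi> (at p) v)
        = (LINT p:\<Omega>|lebesgue. (W (fst p) (snd p) + c) * frechet_derivative \<phi> (at p) v)"
      unfolding set_lebesgue_integral_def by (intro Bochner_Integration.integral_cong) (auto simp: indicator_def U)
    also have "\<dots> = - (LINT p:\<Omega>|lebesgue. (- f (u (fst p) (snd p)) * fst v + u (fst p) (snd p) * snd v) * \<phi> p)"
      by (rule W_weak_derivative[OF \<phi>])
    also have "(LINT p:\<Omega>|lebesgue. (- f (u (fst p) (snd p)) * fst v + u (fst p) (snd p) * snd v) * \<phi> p)
        = (LINT p:\<Omega>|lebesgue. g p * \<phi> p)"
      unfolding set_lebesgue_integral_def by (intro Bochner_Integration.integral_cong) (auto simp: indicator_def g_def)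
    finally show "(LINT p:\<Omega>|lebesgue. (case p of (t, x) \<Rightarrow> U t x) * frechet_derivative \<phi> (at p) v)
        = - (LINT p:\<Omega>|lebesgue. g p * \<phi> p)" .
  qed
  ultimately show "\<exists>g. Linf_on ({0..T} \<times> UNIV) g \<and> weak_deriv \<Omega> v (\<lambda>(t, x). U t x) g" by blast
next
  have Us: "continuous_on S (U t)" if t: "t \<in> {0..T}" for t S
    by (rule continuous_on_eq[where f="\<lambda>x. W t x + c"]) (auto simp: U[OF t] intro!: continuous_intros W_slice_continuous t)
  have "Linf_loc UNIV (U t) \<and> Linf_loc UNIV (u t) \<and> weak_deriv UNIV 1 (U t) (u t)" if t: "t \<in> {0..T}" for t
  proof (intro conjI)
    show "Linf_loc UNIV (U t)"
      unfolding Linf_loc_def using absolutely_integrable_on_compact(2) Us[OF t] by blast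
    have um: "u t \<in> borel_measurable (lebesgue_on K)" for K
      by (intro measurable_restrict_space1 u.slice_meas t)
    show "Linf_loc UNIV (u t)"
      unfolding Linf_loc_def Linf_on_def using um u.bound[OF t] by (auto intro!: exI[of _ M])
    show "weak_deriv UNIV 1 (U t) (u t)"
      unfolding weak_deriv_def L1_loc_def
    proof (intro conjI allI impI; (elim conjE)?)
      fix K :: "real set" assume K: "compact K"
      show "U t absolutely_integrable_on K" by (rule absolutely_integrable_on_compact(1)[OF K Us[OF t]])
      show "u t absolutely_integrable_on K"
        using um u.bound[OF t] K by (intro absolutely_integrable_bounded lmeasurable_compact) auto
    next
      fix \<phi> :: "real \<Rightarrow> real" assume "C1c_on UNIV \<phi>"
      from W_weak_derivative_slice[OF t this, of c]
      show "(LINT x:UNIV|lebesgue. U t x * frechet_derivative \<phi> (at x) 1) = - (LINT x:UNIV|lebesgue. u t x * \<phi> x)"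
        by (simp add: U[OF t])
    qed
  qed
  then show "\<exists>V. (\<forall>t\<in>{0..T}. Linf_loc UNIV (U t) \<and> Linf_loc UNIV (V t) \<and> weak_deriv UNIV 1 (U t) (V t)) \<and>
      (\<forall>p\<ge>1. C0_Lp_loc p T V)"
    using C0_Lp_loc_bounded by (intro exI[of _ u]) blast
qed

lemma (in entropy_strip) hj_viscosity_solution_W:
  assumes lip: "\<And>R. \<exists>L. \<forall>x y. \<bar>x\<bar> \<le> R \<longrightarrow> \<bar>y\<bar> \<le> R \<longrightarrow> \<bar>f x - f y\<bar> \<le> L * \<bar>x - y\<bar>"
    and U: "\<And>t x. t \<in> {0..T} \<Longrightarrow> U t x = W t x + c"
  shows "hj_viscosity_solution f T U"
  unfolding hj_viscosity_solution_def
proof (intro conjI allI impI; (elim conjE)?)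
  show "hj_regular T U" by (rule hj_regular_W[OF U])
next
  fix \<phi> and t0 x0 :: real
  assume \<phi>: "Cinf_on \<Omega> \<phi>" and t0: "t0 \<in> {0<..<T}"
  let ?A = "frechet_derivative \<phi> (at (t0, x0)) (1, 0) + f (frechet_derivative \<phi> (at (t0, x0)) (0, 1))"
  have \<phi>2: "Ck_on 2 \<Omega> \<phi>" using \<phi> by (simp add: Cinf_on_def)
  have ev: "\<forall>\<^sub>F p in nhds (t0, x0). p \<in> \<Omega>"
    using t0 by (intro eventually_nhds_in_open open_\<Omega>) auto
  have U0: "U t0 x0 = W t0 x0 + c" using t0 by (intro U) auto
  show "?A \<le> 0"
    if max: "\<forall>\<^sub>F (t, x) in nhds (t0, x0). U t x - \<phi> (t, x) \<le> U t0 x0 - \<phi> (t0, x0)"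
  proof -
    have "\<forall>\<^sub>F (t, x) in nhds (t0, x0). (- 1) * (W t0 x0 - \<phi> (t0, x0)) \<le> (- 1) * (W t x - \<phi> (t, x))"
      using max ev by eventually_elim (auto simp: U U0)
    from touching_smooth[OF lip \<phi>2 t0 _ this] show ?thesis by simp
  qed
  show "0 \<le> ?A"
    if min: "\<forall>\<^sub>F (t, x) in nhds (t0, x0). U t x - \<phi> (t, x) \<ge> U t0 x0 - \<phi> (t0, x0)"
  proof -
    have "\<forall>\<^sub>F (t, x) in nhds (t0, x0). 1 * (W t0 x0 - \<phi> (t0, x0)) \<le> 1 * (W t x - \<phi> (t, x))"
      using min ev by eventually_elim (auto simp: U U0)
    from touching_smooth[OF lip \<phi>2 t0 _ this] show ?thesis by simp
  qed
qed

section \<open>Reduction to a bounded solution\<close>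

lemma AE_lebesgue_negligible:
  fixes P :: "'a::euclidean_space \<Rightarrow> bool"
  assumes "AE x in lebesgue. P x"
  obtains N where "negligible N" "\<And>x. x \<notin> N \<Longrightarrow> P x"
proof -
  obtain N where "N \<in> null_sets lebesgue" "{x \<in> space lebesgue. \<not> P x} \<subseteq> N"
    using assms unfolding eventually_ae_filter by blast
  then show thesis using that[of N] by (auto simp: negligible_iff_null_sets)
qed

text \<open>\<open>hj_primitive\<close> integrates the original data, while the argument works with
  versions that are bounded everywhere. The two agree off a null set and inside the interval only,
  and that is enough for either orientation.\<close>

lemma interval_integral_lebesgue_eq:
  fixes k g :: "real \<Rightarrow> real"
  assumes "a \<le> b" and g: "g absolutely_integrable_on {a..b}"
    and N: "negligible N" "\<And>x. x \<in> {a<..<b} - N \<Longrightarrow> k x = g x"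
  shows "(LINT x=a..b|lebesgue. k x) = integral {a..b} g"
    and "(LINT x=b..a|lebesgue. k x) = - integral {a..b} g"
proof -
  have N': "negligible (N \<union> {a, b})" using N(1) by (intro negligible_Un) auto
  have k: "k absolutely_integrable_on {a..b}"
    by (rule absolutely_integrable_spike[OF g N']) (use N(2) in auto)
  then have k': "set_integrable lebesgue {a<..<b} k" by (rule set_integrable_subset) auto
  have "(LINT x:{a<..<b}|lebesgue. k x) = integral {a<..<b} k"
    by (rule set_lebesgue_integral_eq_integral(2)[OF k'])
  also have "\<dots> = integral {a..b} k" by (simp add: integral_open_interval_real)
  also have "\<dots> = integral {a..b} g"
    by (rule integral_spike[OF N']) (use N(2) in auto)
  finally have eq: "(LINT x:{a<..<b}|lebesgue. k x) = integral {a..b} g" .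
  then show "(LINT x=a..b|lebesgue. k x) = integral {a..b} g"
    using assms(1) by (simp add: interval_lebesgue_integral_def)
  show "(LINT x=b..a|lebesgue. k x) = - integral {a..b} g"
  proof (cases "a = b")
    case True
    then show ?thesis by (simp add: interval_lebesgue_integral_def set_lebesgue_integral_def)
  next
    case False
    then show ?thesis using eq assms(1) by (simp add: interval_lebesgue_integral_def)
  qed
qed

lemma AE_lborel_exists_in_interval:
  fixes c d :: real
  assumes "AE t in lebesgue. P t" "c < d"
  obtains t where "t \<in> {c<..<d}" "P t"
proof (rule ccontr)
  assume "\<not> thesis"
  then have no: "\<not> P t" if "t \<in> {c<..<d}" for t using that \<open>\<And>t. t \<in> {c<..<d} \<Longrightarrow> P t \<Longrightarrow> thesis\<close> by blast
  obtain N where "negligible N" "\<And>t. t \<notin> N \<Longrightarrow> P t"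
    using AE_lebesgue_negligible[OF assms(1)] by blast
  then have "negligible {c<..<d}" using no negligible_subset by blast
  then show False using open_not_negligible[of "{c<..<d}"] assms(2) by auto
qed

lemma C0_L1_loc_slice:
  assumes "C0_Lp_loc 1 T u" "t \<in> {0..T}"
  shows "u t \<in> borel_measurable lebesgue" and "0 < R \<Longrightarrow> u t absolutely_integrable_on {-R..R}"
proof -
  show um: "u t \<in> borel_measurable lebesgue" using assms by (auto simp: C0_Lp_loc_def)
  have "set_borel_measurable lebesgue {-R..R} (u t)"
    unfolding set_borel_measurable_def by (intro borel_measurable_scaleR borel_measurable_indicator um) auto
  moreover assume "0 < R"
  then have "set_integrable lebesgue {-R..R} (\<lambda>x. \<bar>u t x\<bar>)"
    using assms by (auto simp: C0_Lp_loc_def)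
  ultimately show "u t absolutely_integrable_on {-R..R}"
    by (intro set_integrable_bound[of lebesgue "{-R..R}" "\<lambda>x. \<bar>u t x\<bar>" "u t"]) auto
qed

text \<open>Fubini gives the bound for almost every time only. At such times \<open>s\<close> the
  excess of \<open>\<bar>u t\<bar>\<close> over \<open>M\<close> is at most
  \<open>\<bar>u s - u t\<bar>\<close> almost everywhere, and letting \<open>s\<close> tend to
  \<open>t\<close> in L^1 removes it, for every \<open>t\<close> including 0 and
  \<open>T\<close>.\<close>

lemma AE_slice_bound:
  assumes T: "0 < T" and M: "0 \<le> M"
    and bd: "AE p in lebesgue_on ({0..T} \<times> UNIV). \<bar>case p of (t, x) \<Rightarrow> u t x\<bar> \<le> M"
    and C0: "C0_Lp_loc 1 T u" and t: "t \<in> {0..T}"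
  shows "AE x in lebesgue. \<bar>u t x\<bar> \<le> M"
proof -
  have S: "{0..T} \<times> (UNIV :: real set) \<in> sets lebesgue"
    by (intro sets_completionI_sets) (auto simp: borel_prod[symmetric])
  have "AE p in lebesgue. p \<in> {0..T} \<times> UNIV \<longrightarrow> \<bar>u (fst p) (snd p)\<bar> \<le> M"
    using bd S by (simp add: AE_restrict_space_iff case_prod_unfold)
  then have "AE p in lborel \<Otimes>\<^sub>M lborel. p \<in> {0..T} \<times> UNIV \<longrightarrow> \<bar>u (fst p) (snd p)\<bar> \<le> M"
    unfolding lborel_prod by (simp only: AE_completion_iff)
  from lborel_pair.AE_pair[OF this]
  have "AE s in lborel. AE x in lborel. s \<in> {0..T} \<longrightarrow> \<bar>u s x\<bar> \<le> M" by simp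
  note good = AE_completion[OF this]
  have um: "u s \<in> borel_measurable lebesgue" if "s \<in> {0..T}" for s
    using C0 that by (rule C0_L1_loc_slice(1))
  have ui: "u s absolutely_integrable_on {-R..R}" if "s \<in> {0..T}" "0 < R" for s R
    using C0 that by (rule C0_L1_loc_slice(2))
  have "AE x in lebesgue. x \<in> {-R..R} \<longrightarrow> \<bar>u t x\<bar> \<le> M" if R: "0 < R" for R
  proof -
    let ?e = "\<lambda>x. max 0 (\<bar>u t x\<bar> - M)"
    have "?e \<in> borel_measurable lebesgue"
      by (intro borel_measurable_max borel_measurable_const borel_measurable_diff borel_measurable_abs um t)
    then have "set_borel_measurable lebesgue {-R..R} ?e"
      unfolding set_borel_measurable_def by (intro borel_measurable_scaleR borel_measurable_indicator) auto
    then have ei: "set_integrable lebesgue {-R..R} ?e"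
      using M by (intro set_integrable_bound[OF set_integrable_abs[OF ui[OF t R]]]) auto
    have "(LINT x:{-R..R}|lebesgue. ?e x) \<le> \<epsilon>" if "\<epsilon> > 0" for \<epsilon>
    proof -
      have "((\<lambda>s. LINT x:{-R..R}|lebesgue. \<bar>u s x - u t x\<bar>) \<longlongrightarrow> 0) (at t within {0..T})"
        using C0 t R by (simp add: C0_Lp_loc_def)
      from order_tendstoD(2)[OF this \<open>\<epsilon> > 0\<close>]
      obtain d where d: "d > 0" "\<And>s. s \<in> {0..T} \<Longrightarrow> s \<noteq> t \<Longrightarrow> \<bar>s - t\<bar> < d \<Longrightarrow> (LINT x:{-R..R}|lebesgue. \<bar>u s x - u t x\<bar>) < \<epsilon>"
        unfolding eventually_at dist_real_def by blast
      obtain s where s: "s \<in> {0..T}" "s \<noteq> t" "\<bar>s - t\<bar> < d" "AE x in lborel. s \<in> {0..T} \<longrightarrow> \<bar>u s x\<bar> \<le> M"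
      proof (cases "t < T")
        case True
        obtain s where "s \<in> {t<..<min T (t + d)}" "AE x in lborel. s \<in> {0..T} \<longrightarrow> \<bar>u s x\<bar> \<le> M"
          using AE_lborel_exists_in_interval[OF good, of t "min T (t + d)"] True d(1) by auto
        then show thesis using that[of s] t by auto
      next
        case False
        obtain s where "s \<in> {max 0 (t - d)<..<t}" "AE x in lborel. s \<in> {0..T} \<longrightarrow> \<bar>u s x\<bar> \<le> M"
          using AE_lborel_exists_in_interval[OF good, of "max 0 (t - d)" t] False d(1) t T by auto
        then show thesis using that[of s] t by auto
      qed
      have "AE x in lebesgue. \<bar>u s x\<bar> \<le> M" using AE_completion[OF s(4)] s(1) by simp
      then have "AE x\<in>{-R..R} in lebesgue. ?e x \<le> \<bar>u s x - u t x\<bar>" by eventually_elim auto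
      then have "(LINT x:{-R..R}|lebesgue. ?e x) \<le> (LINT x:{-R..R}|lebesgue. \<bar>u s x - u t x\<bar>)"
        by (intro set_integral_mono_AE ei set_integrable_abs set_integral_diff ui s t R)
      then show ?thesis using d(2)[OF s(1-3)] by linarith
    qed
    then have le: "(LINT x:{-R..R}|lebesgue. ?e x) \<le> 0" using field_le_epsilon[of _ "0 :: real"] by simp
    have ge: "0 \<le> (LINT x:{-R..R}|lebesgue. ?e x)"
      unfolding set_lebesgue_integral_def by (intro integral_nonneg_AE) auto
    from order.antisym[OF le ge] have "(LINT x|lebesgue. indicator {-R..R} x *\<^sub>R ?e x) = 0"
      unfolding set_lebesgue_integral_def .
    then have "AE x in lebesgue. indicator {-R..R} x *\<^sub>R ?e x = 0"
      using integral_nonneg_eq_0_iff_AE[OF ei[unfolded set_integrable_def]] by simp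
    then show ?thesis by eventually_elim (auto simp: max_def split: if_splits)
  qed
  then have "AE x in lebesgue. x \<in> {- real (Suc n)..real (Suc n)} \<longrightarrow> \<bar>u t x\<bar> \<le> M" for n
    using of_nat_0_less_iff zero_less_Suc by blast
  then have "AE x in lebesgue. \<forall>n. x \<in> {- real (Suc n)..real (Suc n)} \<longrightarrow> \<bar>u t x\<bar> \<le> M"
    unfolding AE_all_countable by blast
  then show ?thesis
  proof eventually_elim
    case (elim x)
    obtain n where "\<bar>x\<bar> \<le> real n" using real_arch_simple by blast
    then have "x \<in> {- real (Suc n)..real (Suc n)}" by auto
    then show ?case using elim by blast
  qed
qed

text \<open>Composition with a Lipschitz map preserves left continuity and L^1 continuity of the
  slices. The intended maps are the cut-off at the essential bound and \<open>f\<close> after this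
  cut-off.\<close>

lemma lipschitz_left_continuous_strip:
  assumes T: "0 < T" and C0: "C0_Lp_loc 1 T u"
    and left: "\<And>t x. t \<in> {0<..T} \<Longrightarrow> continuous (at_left x) (u t)"
    and h: "\<And>y. \<bar>h y\<bar> \<le> M" "\<And>y z. \<bar>h y - h z\<bar> \<le> L * \<bar>y - z\<bar>"
  shows "left_continuous_strip T M (\<lambda>t x. h (u t x))"
proof
  have "0 \<le> L" using h(2)[of 0 1] by simp
  have hc: "continuous_on UNIV h"
    by (rule lipschitz_on_continuous_on[OF lipschitz_onI[of _ _ L]]) (auto simp: dist_real_def h \<open>0 \<le> L\<close>)
  have um: "u t \<in> borel_measurable lebesgue" if "t \<in> {0..T}" for t
    using C0 that by (rule C0_L1_loc_slice(1))
  show hm: "(\<lambda>x. h (u t x)) \<in> borel_measurable lebesgue" if "t \<in> {0..T}" for t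
    using measurable_compose[OF um[OF that] borel_measurable_continuous_onI[OF hc]] .
  show "((\<lambda>x. h (u t x)) \<longlongrightarrow> h (u t x)) (at_left x)" if "t \<in> {0<..T}" for t x
    using left[OF that, of x] hc
    by (intro isCont_tendsto_compose[of _ h]) (auto simp: continuous_within continuous_on_eq_continuous_at)
  fix t R :: real assume t: "t \<in> {0..T}" and R: "0 < R"
  have ui: "u s absolutely_integrable_on {-R..R}" if "s \<in> {0..T}" for s
    using C0 that R by (rule C0_L1_loc_slice(2))
  show "((\<lambda>s. integral {-R..R} (\<lambda>x. \<bar>h (u s x) - h (u t x)\<bar>)) \<longlongrightarrow> 0) (at t within {0..T})"
  proof (rule Lim_null_comparison)
    show "((\<lambda>s. L * (LINT x:{-R..R}|lebesgue. \<bar>u s x - u t x\<bar>)) \<longlongrightarrow> 0) (at t within {0..T})"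
      using C0 t R by (intro tendsto_mult_right_zero) (simp add: C0_Lp_loc_def)
    have "norm (integral {-R..R} (\<lambda>x. \<bar>h (u s x) - h (u t x)\<bar>)) \<le> L * (LINT x:{-R..R}|lebesgue. \<bar>u s x - u t x\<bar>)"
      if s: "s \<in> {0..T}" for s
    proof -
      have i: "(\<lambda>x. \<bar>u s x - u t x\<bar>) absolutely_integrable_on {-R..R}"
        by (intro set_integrable_abs set_integral_diff ui s t)
      have "\<bar>h (u s x) - h (u t x)\<bar> \<le> 2 * M" for x
        using h(1)[of "u s x"] h(1)[of "u t x"] by linarith
      then have "(\<lambda>x. h (u s x) - h (u t x)) absolutely_integrable_on {-R..R}"
        by (intro absolutely_integrable_bounded[where B="2 * M"] measurable_restrict_space1 borel_measurable_diff hm s t) auto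
      then have j: "(\<lambda>x. \<bar>h (u s x) - h (u t x)\<bar>) integrable_on {-R..R}"
        by (intro set_lebesgue_integral_eq_integral(1) set_integrable_abs)
      have "norm (integral {-R..R} (\<lambda>x. \<bar>h (u s x) - h (u t x)\<bar>)) \<le> integral {-R..R} (\<lambda>x. L * \<bar>u s x - u t x\<bar>)"
        using j integrable_on_mult_right[OF set_lebesgue_integral_eq_integral(1)[OF i], of L] h(2)
        by (intro integral_norm_bound_integral) auto
      then show ?thesis using set_lebesgue_integral_eq_integral(2)[OF i] by simp
    qed
    then show "\<forall>\<^sub>F s in at t within {0..T}. norm (integral {-R..R} (\<lambda>x. \<bar>h (u s x) - h (u t x)\<bar>))
        \<le> L * (LINT x:{-R..R}|lebesgue. \<bar>u s x - u t x\<bar>)"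
      unfolding eventually_at_filter by (intro always_eventually allI impI)
  qed
qed (use T h in auto)

text \<open>The representative \<open>\<gamma>'\<close> is bounded only off a null set. The chain
  rule along \<open>\<gamma>\<close> uses one that is bounded everywhere and whose integrals give
  the increments of \<open>\<gamma>\<close> up to the endpoints.\<close>

lemma W1inf_path_derivative:
  fixes T :: real and \<gamma> \<gamma>' :: "real \<Rightarrow> real"
  assumes "0 < T" and \<gamma>: "continuous_on {0..T} \<gamma>" and \<gamma>': "Linf_on {0<..<T} \<gamma>'" "weak_deriv {0<..<T} 1 \<gamma> \<gamma>'"
  obtains g G N where "g absolutely_integrable_on {0..T}" "\<And>t. \<bar>g t\<bar> \<le> G"
    "negligible N" "\<And>t. t \<in> {0<..<T} - N \<Longrightarrow> \<gamma>' t = g t"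
    "\<And>s t. 0 \<le> s \<Longrightarrow> s \<le> t \<Longrightarrow> t \<le> T \<Longrightarrow> \<gamma> t - \<gamma> s = integral {s..t} g"
proof -
  let ?I = "{0<..<T}"
  obtain G0 where m: "\<gamma>' \<in> borel_measurable (lebesgue_on ?I)" and ae: "AE t in lebesgue_on ?I. \<bar>\<gamma>' t\<bar> \<le> G0"
    using \<gamma>'(1) by (auto simp: Linf_on_def)
  have "?I \<inter> space lebesgue \<in> sets lebesgue" by simp
  from iffD1[OF AE_restrict_space_iff[OF this] ae]
  have "AE t in lebesgue. t \<in> ?I \<longrightarrow> \<bar>\<gamma>' t\<bar> \<le> G0" .
  then obtain N where N: "negligible N" "\<And>t. t \<notin> N \<Longrightarrow> t \<in> ?I \<longrightarrow> \<bar>\<gamma>' t\<bar> \<le> G0"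
    using AE_lebesgue_negligible[of "\<lambda>t. t \<in> ?I \<longrightarrow> \<bar>\<gamma>' t\<bar> \<le> G0"] by blast
  define G where "G = max G0 0"
  \<comment> \<open>Truncation at the essential bound changes \<open>\<gamma>'\<close> only on the
    null set \<open>N\<close>; outside the open interval the value is 0.\<close>
  define g where "g t = max (- G) (min G (\<gamma>' t)) * indicator ?I t" for t
  have g_bd: "\<bar>g t\<bar> \<le> G" for t by (auto simp: g_def G_def indicator_def)
  have g_eq: "\<gamma>' t = g t" if "t \<in> ?I - N" for t
    using N(2)[of t] that by (auto simp: g_def G_def)
  have "(\<lambda>t. max (- G) (min G (\<gamma>' t))) \<in> borel_measurable (lebesgue_on ?I)"
    by (intro borel_measurable_max borel_measurable_min borel_measurable_const m)
  then have "(\<lambda>t. max (- G) (min G (\<gamma>' t))) absolutely_integrable_on ?I"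
    by (rule absolutely_integrable_bounded[where B=G]) (auto simp: G_def)
  then have gI: "g absolutely_integrable_on ?I"
    by (rule absolutely_integrable_spike[of _ _ "{}"]) (auto simp: g_def)
  then have gi: "g absolutely_integrable_on {0..T}"
    by (rule absolutely_integrable_spike_set) (rule negligible_subset[of "{0, T}"]; auto)+
  have "\<gamma>' absolutely_integrable_on ?I"
    by (rule absolutely_integrable_spike[OF gI N(1)]) (use g_eq in auto)
  then have inc: "\<gamma> t - \<gamma> s = integral {s..t} \<gamma>'" if "0 \<le> s" "s \<le> t" "t \<le> T" for s t
    using \<gamma>'(2) that by (intro weak_derivative_imp_integral[OF \<gamma>]) (auto simp: weak_deriv_def)
  have "integral {s..t} \<gamma>' = integral {s..t} g" if "0 \<le> s" "s \<le> t" "t \<le> T" for s t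
  proof (rule integral_spike)
    show "negligible (N \<union> {0, T})" using N(1) by (intro negligible_Un) auto
    show "g x = \<gamma>' x" if "x \<in> {s..t} - (N \<union> {0, T})" for x
      using g_eq[of x] that \<open>0 \<le> s\<close> \<open>t \<le> T\<close> by auto
  qed
  then show thesis using that[OF gi g_bd N(1) g_eq] inc by simp
qed

lemma Ck2_lipschitz:
  fixes f :: "real \<Rightarrow> real"
  assumes "Ck_on 2 UNIV f"
  shows "\<exists>L. \<forall>x y. \<bar>x\<bar> \<le> R \<longrightarrow> \<bar>y\<bar> \<le> R \<longrightarrow> \<bar>f x - f y\<bar> \<le> L * \<bar>x - y\<bar>"
proof -
  let ?f' = "\<lambda>x. frechet_derivative f (at x) 1"
  have d: "(f has_derivative frechet_derivative f (at x)) (at x)" for x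
    using assms by (simp add: numeral_2_eq_2 frechet_derivative_works[symmetric])
  have "frechet_derivative f (at x) = (*) (?f' x)" for x
  proof
    fix h show "frechet_derivative f (at x) h = ?f' x * h"
      using linear_scale[OF has_derivative_linear[OF d], of x h 1]
      by (simp only: real_scaleR_def mult_1_right mult_1_left mult.commute)
  qed
  then have D: "(f has_real_derivative ?f' x) (at x)" for x
    using d[of x] by (simp only: has_field_derivative_def)
  have "?f' differentiable (at x)" for x
    using assms by (simp add: numeral_2_eq_2)
  then have "continuous_on {-R..R} ?f'"
    by (intro continuous_at_imp_continuous_on ballI differentiable_imp_continuous_within)
  then have "bounded (?f' ` {-R..R})" by (intro compact_imp_bounded compact_continuous_image) auto
  then obtain L where L: "\<And>x. x \<in> {-R..R} \<Longrightarrow> norm (?f' x) \<le> L" unfolding bounded_iff by (metis imageI)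
  have "norm (f x - f y) \<le> L * norm (x - y)" if "x \<in> {-R..R}" "y \<in> {-R..R}" for x y
    by (rule field_differentiable_bound[of "{-R..R}" f ?f'])
      (use that L D in \<open>auto intro: has_field_derivative_at_within\<close>)
  then show ?thesis by (intro exI[of _ L]) (auto simp: abs_le_iff)
qed

lemma (in entropy_strip) path_flux_abs_integrable:
  assumes g: "g absolutely_integrable_on {0..T}" and cont: "continuous_on {0..T} \<gamma>" and t: "t \<in> {0..T}"
  shows "(\<lambda>\<tau>. g \<tau> * u \<tau> (\<gamma> \<tau>) - f (u \<tau> (\<gamma> \<tau>))) absolutely_integrable_on {0..t}"
proof (rule set_integral_diff(1))
  have sub: "{0..t} \<subseteq> {0..T}" using t by auto
  show "(\<lambda>\<tau>. f (u \<tau> (\<gamma> \<tau>))) absolutely_integrable_on {0..t}"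
    by (rule flux.path_abs_integrable[OF cont sub])
  have "(\<lambda>\<tau>. u \<tau> (\<gamma> \<tau>) * g \<tau>) absolutely_integrable_on {0..t}"
  proof (rule absolutely_integrable_bounded_measurable_product_real)
    show "(\<lambda>\<tau>. u \<tau> (\<gamma> \<tau>)) \<in> borel_measurable (lebesgue_on {0..t})"
      by (intro absolutely_integrable_measurable[THEN iffD1, THEN conjunct1] u.path_abs_integrable[OF cont sub]) auto
    show "bounded ((\<lambda>\<tau>. u \<tau> (\<gamma> \<tau>)) ` {0..t})"
      using u.bound sub by (intro boundedI[of _ M]) auto
    show "g absolutely_integrable_on {0..t}" by (rule set_integrable_subset[OF g _ sub]) auto
  qed auto
  then show "(\<lambda>\<tau>. g \<tau> * u \<tau> (\<gamma> \<tau>)) absolutely_integrable_on {0..t}" by (simp add: mult.commute)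
qed

theorem proposition2p5:
  fixes f :: "real \<Rightarrow> real" and c T C :: real
    and u\<^sub>o :: "real \<Rightarrow> real" and u :: "real \<Rightarrow> real \<Rightarrow> real"
    and \<gamma> \<gamma>' :: "real \<Rightarrow> real"
  assumes f_C2: "Ck_on 2 UNIV f"
    and c_pos: "c > 0"
    and f_convex: "\<And>w. (deriv ^^ 2) f w \<ge> c"
    and f_min: "\<And>w. f w \<ge> f 0" "f 0 = 0"
    and T_pos: "T > 0"
    and datum_Linf: "Linf_on UNIV u\<^sub>o"
    and u_entropy: "weak_entropy_solution f T u"
    and u_datum: "AE x in lebesgue. u 0 x = u\<^sub>o x"
    and u_left_continuous: "\<And>t x. t \<in> {0<..T} \<Longrightarrow> continuous (at_left x) (u t)"
    and \<gamma>_continuous: "continuous_on {0..T} \<gamma>"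
    and \<gamma>_W1inf: "Linf_on {0<..<T} \<gamma>" "Linf_on {0<..<T} \<gamma>'" "weak_deriv {0<..<T} 1 \<gamma> \<gamma>'"
  shows "hj_viscosity_solution f T (hj_primitive f u \<gamma> \<gamma>' C) \<and>
         (\<forall>x. hj_primitive f u \<gamma> \<gamma>' C 0 x = (LINT \<xi>=\<gamma> 0..x|lebesgue. (u\<^sub>o \<xi>)) + C)"
proof -
  have C0: "C0_Lp_loc 1 T u" using u_entropy by (simp add: weak_entropy_solution_def)
  obtain M0 where "AE p in lebesgue_on ({0..T} \<times> UNIV). \<bar>case p of (t, x) \<Rightarrow> u t x\<bar> \<le> M0"
    using u_entropy by (auto simp: weak_entropy_solution_def Linf_on_def)
  then have bd: "AE p in lebesgue_on ({0..T} \<times> UNIV). \<bar>case p of (t, x) \<Rightarrow> u t x\<bar> \<le> max M0 0"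
    by eventually_elim auto
  define B where "B = max M0 0"
  have B: "0 \<le> B" by (simp add: B_def)
  have AE_bd: "AE x in lebesgue. \<bar>u t x\<bar> \<le> B" if "t \<in> {0..T}" for t
    using AE_slice_bound[OF T_pos _ bd C0 that] by (simp add: B_def)
  \<comment> \<open>By left continuity a single value above \<open>B\<close> would force an interval
    of such values, which the almost everywhere bound excludes.\<close>
  have pt_bd: "\<bar>u t x\<bar> \<le> B" if t: "t \<in> {0<..T}" for t x
  proof (rule ccontr)
    assume "\<not> \<bar>u t x\<bar> \<le> B"
    have "((\<lambda>y. \<bar>u t y\<bar>) \<longlongrightarrow> \<bar>u t x\<bar>) (at_left x)"
      using u_left_continuous[OF t, of x] by (intro tendsto_rabs) (simp add: continuous_within)
    from order_tendstoD(1)[OF this, of B] \<open>\<not> \<bar>u t x\<bar> \<le> B\<close>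
    obtain b where b: "b < x" "\<And>y. b < y \<Longrightarrow> y < x \<Longrightarrow> B < \<bar>u t y\<bar>"
      by (auto simp: eventually_at_left[of "x - 1"])
    obtain y where "y \<in> {b<..<x}" "\<bar>u t y\<bar> \<le> B"
      using AE_lborel_exists_in_interval[OF AE_bd[of t] b(1)] t by auto
    then show False using b(2)[of y] by auto
  qed
  \<comment> \<open>The cut-off alters \<open>u\<close> at most on a null set at time 0, where
    \<open>pt_bd\<close> gives nothing. It also makes the local Lipschitz bound of \<open>f\<close>
    a global one for \<open>f\<close> after \<open>cl\<close>.\<close>
  define cl where "cl y = max (- B) (min B y)" for y :: real
  have cl: "\<bar>cl y\<bar> \<le> B" "\<bar>cl y - cl z\<bar> \<le> 1 * \<bar>y - z\<bar>" "\<bar>y\<bar> \<le> B \<Longrightarrow> cl y = y" for y z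
    using B by (auto simp: cl_def)
  note lip = Ck2_lipschitz[OF f_C2]
  obtain L0 where L0: "\<And>x y. \<bar>x\<bar> \<le> B \<Longrightarrow> \<bar>y\<bar> \<le> B \<Longrightarrow> \<bar>f x - f y\<bar> \<le> L0 * \<bar>x - y\<bar>" using lip by metis
  define L where "L = max L0 0"
  have L: "\<bar>f (cl x) - f (cl y)\<bar> \<le> L * \<bar>x - y\<bar>" for x y
  proof -
    have "\<bar>f (cl x) - f (cl y)\<bar> \<le> L0 * \<bar>cl x - cl y\<bar>" by (intro L0 cl)
    also have "\<dots> \<le> L * \<bar>x - y\<bar>" using cl(2)[of x y] by (intro mult_mono) (auto simp: L_def)
    finally show ?thesis .
  qed
  \<comment> \<open>One bound for both strips: \<open>B\<close> for the solution and, as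
    \<open>f 0 = 0\<close>, \<open>L * B\<close> for the flux.\<close>
  define M where "M = max B (L * B)"
  have fM: "\<bar>f (cl y)\<bar> \<le> M" for y
  proof -
    have "\<bar>f (cl (cl y)) - f (cl 0)\<bar> \<le> L * \<bar>cl y - 0\<bar>" by (rule L)
    moreover have "L * \<bar>cl y\<bar> \<le> L * B" using cl(1) by (intro mult_left_mono) (auto simp: L_def)
    ultimately show ?thesis using cl(3)[OF cl(1)] cl(3)[of 0] B f_min(2) by (simp add: M_def)
  qed
  have clM: "\<bar>cl y\<bar> \<le> M" for y using cl(1)[of y] by (simp add: M_def)
  interpret u: left_continuous_strip T M "\<lambda>t x. cl (u t x)"
    by (rule lipschitz_left_continuous_strip[OF T_pos C0 u_left_continuous clM cl(2)])
  interpret flux: left_continuous_strip T M "\<lambda>t x. f (cl (u t x))"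
    by (rule lipschitz_left_continuous_strip[OF T_pos C0 u_left_continuous fM L])
  interpret entropy_strip T M "\<lambda>t x. cl (u t x)" f
  proof
    fix k and \<phi> :: "real \<times> real \<Rightarrow> real" assume \<phi>: "C1c_on ({0<..<T} \<times> UNIV) \<phi>" "\<And>p. 0 \<le> \<phi> p"
    have "(LINT p:{0<..<T} \<times> UNIV|lebesgue.
            \<bar>cl (u (fst p) (snd p)) - k\<bar> * frechet_derivative \<phi> (at p) (1, 0)
            + sgn (cl (u (fst p) (snd p)) - k) * (f (cl (u (fst p) (snd p))) - f k)
                * frechet_derivative \<phi> (at p) (0, 1))
        = (LINT p:{0<..<T} \<times> UNIV|lebesgue. (case p of (t, x) \<Rightarrow>
            \<bar>u t x - k\<bar> * frechet_derivative \<phi> (at (t, x)) (1, 0)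
            + sgn (u t x - k) * (f (u t x) - f k) * frechet_derivative \<phi> (at (t, x)) (0, 1)))"
      unfolding set_lebesgue_integral_def
      by (intro Bochner_Integration.integral_cong) (auto simp: indicator_def cl(3) pt_bd)
    then show "0 \<le> (LINT p:{0<..<T} \<times> UNIV|lebesgue.
            \<bar>cl (u (fst p) (snd p)) - k\<bar> * frechet_derivative \<phi> (at p) (1, 0)
            + sgn (cl (u (fst p) (snd p)) - k) * (f (cl (u (fst p) (snd p))) - f k)
                * frechet_derivative \<phi> (at p) (0, 1))"
      using u_entropy \<phi> by (simp add: weak_entropy_solution_def)
  qed
  obtain g G N where g: "g absolutely_integrable_on {0..T}" "\<And>t. \<bar>g t\<bar> \<le> G"
    and N: "negligible N" "\<And>t. t \<in> {0<..<T} - N \<Longrightarrow> \<gamma>' t = g t"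
    and \<gamma>: "\<And>s t. 0 \<le> s \<Longrightarrow> s \<le> t \<Longrightarrow> t \<le> T \<Longrightarrow> \<gamma> t - \<gamma> s = integral {s..t} g"
    using W1inf_path_derivative[OF T_pos \<gamma>_continuous \<gamma>_W1inf(2,3)] by blast
  \<comment> \<open>Stated for any \<open>v\<close> in the class of the slice, so that it applies to
    \<open>u t\<close> and also to the datum \<open>u\<^sub>o\<close>.\<close>
  have space: "(LINT \<xi>=a..b|lebesgue. (v \<xi>)) = W t b - W t a"
    if t: "t \<in> {0..T}" and v: "AE x in lebesgue. v x = u t x" for t a b and v :: "real \<Rightarrow> real"
  proof -
    have "AE x in lebesgue. v x = cl (u t x)"
      using v AE_bd[OF t] by eventually_elim (simp add: cl(3))
    then obtain N' where N': "negligible N'" "\<And>x. x \<notin> N' \<Longrightarrow> v x = cl (u t x)"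
      using AE_lebesgue_negligible[of "\<lambda>x. v x = cl (u t x)"] by blast
    show ?thesis
    proof (cases "a \<le> b")
      case True
      from interval_integral_lebesgue_eq(1)[OF True u.slice_abs_integrable[OF t] N'(1), of v] N'(2)
      show ?thesis using W_space[OF t True] by simp
    next
      case False
      then have ba: "b \<le> a" by simp
      from interval_integral_lebesgue_eq(2)[OF ba u.slice_abs_integrable[OF t] N'(1), of v] N'(2)
      show ?thesis using W_space[OF t ba] by simp
    qed
  qed
  have time: "(LINT \<tau>=0..t|lebesgue. (\<gamma>' \<tau> * u \<tau> (\<gamma> \<tau>) - f (u \<tau> (\<gamma> \<tau>)))) = W t (\<gamma> t) - W 0 (\<gamma> 0)"
    if t: "t \<in> {0..T}" for t
  proof -
    have "(LINT \<tau>=0..t|lebesgue. (\<gamma>' \<tau> * u \<tau> (\<gamma> \<tau>) - f (u \<tau> (\<gamma> \<tau>))))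
        = integral {0..t} (\<lambda>\<tau>. g \<tau> * cl (u \<tau> (\<gamma> \<tau>)) - f (cl (u \<tau> (\<gamma> \<tau>))))"
    proof (rule interval_integral_lebesgue_eq(1)[OF _ path_flux_abs_integrable[OF g(1) \<gamma>_continuous t] N(1), unfolded zero_ereal_def[symmetric]])
      show "\<gamma>' \<tau> * u \<tau> (\<gamma> \<tau>) - f (u \<tau> (\<gamma> \<tau>)) = g \<tau> * cl (u \<tau> (\<gamma> \<tau>)) - f (cl (u \<tau> (\<gamma> \<tau>)))"
        if "\<tau> \<in> {0<..<t} - N" for \<tau>
        using that t N(2)[of \<tau>] by (simp add: cl(3) pt_bd)
    qed (use t in auto)
    also have "\<dots> = W t (\<gamma> t) - W 0 (\<gamma> 0)"
      by (rule W_path[OF \<gamma> g \<gamma>_continuous t, symmetric])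
    finally show ?thesis .
  qed
  \<comment> \<open>The space integral contributes \<open>W t x - W t (\<gamma> t)\<close> and the
    time integral \<open>W t (\<gamma> t) - W 0 (\<gamma> 0)\<close>. The value on the path at time
    \<open>t\<close> cancels, so the choice of \<open>\<gamma>\<close> affects only the
    constant.\<close>
  have U: "hj_primitive f u \<gamma> \<gamma>' C t x = W t x + (C - W 0 (\<gamma> 0))" if t: "t \<in> {0..T}" for t x
    unfolding hj_primitive_def time[OF t] using space[OF t, of "u t" "\<gamma> t" x] by simp
  have 0: "0 \<in> {0..T}" using T_pos by simp
  have "AE x in lebesgue. u\<^sub>o x = u 0 x" using u_datum by eventually_elim simp
  from space[OF 0 this]
  have "hj_primitive f u \<gamma> \<gamma>' C 0 x = (LINT \<xi>=\<gamma> 0..x|lebesgue. (u\<^sub>o \<xi>)) + C" for x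
    by (simp add: U[OF 0])
  moreover have "hj_viscosity_solution f T (hj_primitive f u \<gamma> \<gamma>' C)"
    by (rule hj_viscosity_solution_W[OF lip U])
  ultimately show ?thesis by blast
qed

end
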